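(* Let $r\in\{0,1,\dots,5\}$, let $n$ be an integer with $n+1\equiv r\pmod 6$ and $n\ge 101-5r$, and let $\alpha=n-6$. Then the minimizer graphs $T^*$ of $\mathbb{G}_{n,\alpha}$ are (up to isomorphism) exactly the following, with the stated spectral radius: - $r=0$: $F^6_3\circ(\frac{n-5}{6},\frac{n-23}{6},\frac{n-23}{6},\frac{n-5}{6},\frac{n-5}{6},\frac{n-5}{6})$, $F^6_4\circ(\frac{n-5}{6},\frac{n-23}{6},\frac{n-17}{6},\frac{n-11}{6},\frac{n-5}{6},\frac{n-5}{6})$, $F^6_6\circ(\frac{n-5}{6},\frac{n-11}{6},\frac{n-17}{6},\frac{n-17}{6},\frac{n-11}{6},\frac{n-5}{6})$; $\rho(T^* )=\sqrt{\frac{n+1}{6}+\sqrt2}$. - $r=1$ (write $m=n/6$): $F^6_5\circ(m-1,m-2,m-5,m-3,m,m)$, $F^6_5\circ(m-1,m-2,m-5,m-2,m-1,m)$, $F^6_5\circ(m,m-3,m-5,m-3,m,m)$, $F^6_5\circ(m-1,m-2,m-4,m-3,m,m-1)$, $F^6_5\circ(m-1,m-2,m-4,m-2,m-1,m-1)$, $F^6_5\circ(m,m-3,m-4,m-3,m,m-1)$, $F^6_6\circ(m-1,m-2,m-3,m-2,m-2,m-1)$, $F^6_6\circ(m-1,m-2,m-3,m-2,m-3,m)$, $F^6_6\circ(m-1,m-2,m-2,m-3,m-3,m)$, $F^6_6\circ(m,m-3,m-3,m-2,m-3,m)$; $\rho(T^* )=\sqrt{\frac n6+\frac{1+\sqrt5}{2}}$.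 - $r=2$: $F^6_3\circ(\frac{n-1}{6},\frac{n-31}{6},\frac{n-31}{6},\frac{n-1}{6},\frac{n-1}{6},\frac{n-1}{6})$, $F^6_4\circ(\frac{n-1}{6},\frac{n-31}{6},\frac{n-13}{6},\frac{n-19}{6},\frac{n-1}{6},\frac{n-1}{6})$, $F^6_6\circ(\frac{n-1}{6},\frac{n-19}{6},\frac{n-13}{6},\frac{n-13}{6},\frac{n-19}{6},\frac{n-1}{6})$; $\rho(T^* )=\sqrt{\frac{n-1}{6}+\sqrt3}$. - $r=3$: $F^6_1\circ(\frac{n-2}{6},\frac{n-56}{6},\frac{n-2}{6},\frac{n-2}{6},\frac{n-2}{6},\frac{n-2}{6})$; $\rho(T^* )=\sqrt{\frac{n-11}{6}+\frac{\sqrt{45}}{2}}$. - $r=4$: $F^6_1\circ(\frac{n-3}{6},\frac{n-51}{6},\frac{n-3}{6},\frac{n-3}{6},\frac{n-3}{6},\frac{n-3}{6})$, $F^6_2\circ(\frac{n-3}{6},\frac{n-39}{6},\frac{n-15}{6},\frac{n-3}{6},\frac{n-3}{6},\frac{n-3}{6})$, $F^6_3\circ(\frac{n-3}{6},\frac{n-27}{6},\frac{n-27}{6},\frac{n-3}{6},\frac{n-3}{6},\frac{n-3}{6})$, $F^6_4\circ(\frac{n-3}{6},\frac{n-27}{6},\frac{n-15}{6},\frac{n-15}{6},\frac{n-3}{6},\frac{n-3}{6})$, $F^6_5\circ(\frac{n-3}{6},\frac{n-15}{6},\frac{n-27}{6},\frac{n-15}{6},\frac{n-3}{6},\frac{n-3}{6})$,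 $F^6_6\circ(\frac{n-3}{6},\frac{n-15}{6},\frac{n-15}{6},\frac{n-15}{6},\frac{n-15}{6},\frac{n-3}{6})$; $\rho(T^* )=\sqrt{\frac{n+9}{6}}$. - $r=5$: $F^6_1\circ(\frac{n-4}{6},\frac{n-46}{6},\frac{n-4}{6},\frac{n-4}{6},\frac{n-4}{6},\frac{n-4}{6})$; $\rho(T^* )=\sqrt{\frac{n-7}{6}+\frac{\sqrt{29}}{2}}$.
   Context: $\mathbb{G}_{n,\alpha}$ is the set of connected simple graphs on $n$ vertices with independence number $\alpha$; a minimizer graph of $\mathbb{G}_{n,\alpha}$ is one whose spectral radius $\rho$ (largest adjacency eigenvalue) is minimum in $\mathbb{G}_{n,\alpha}$. Trees (each with an ordered list of six vertices): $F^6_1$: path $v_0v_1v_2v_3v_4$ plus edges $v_2x_{1j},x_{1j}y_{1j}$ for $j=1,2,3$; order $(v_0,v_2,v_4,y_{11},y_{12},y_{13})$. $F^6_2$: path $v_0v_1\cdots v_6$ plus edges $v_2x_{11},x_{11}y_{11},v_2x_{12},x_{12}y_{12}$; order $(v_0,v_2,v_4,v_6,y_{11},y_{12})$. $F^6_3$: path $v_0\cdots v_6$ plus edges $v_2x_{11},x_{11}y_{11},v_4x_{12},x_{12}y_{12}$; order $(v_0,v_2,v_4,v_6,y_{11},y_{12})$. $F^6_4$: path $v_0\cdots v_8$ plus edges $v_2x_{11},x_{11}y_{11}$; order $(v_0,v_2,v_4,v_6,v_8,y_{11})$. $F^6_5$: path $v_0\cdots v_8$ plus edges $v_4x_{11},x_{11}y_{11}$;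 order $(v_0,v_2,v_4,v_6,v_8,y_{11})$. $F^6_6$: path $v_0v_1\cdots v_{10}$; order $(v_0,v_2,v_4,v_6,v_8,v_{10})$. For such a tree $F$ with ordered vertices $(u_1,\dots,u_6)$ and nonnegative integers $a_1,\dots,a_6$, $F\circ(a_1,\dots,a_6)$ is obtained from $F$ by attaching $a_i$ new pendant vertices to $u_i$ for each $i$. *)

theory Defs
  imports
    "Graph_Theory.Graph_Theory"
    "Jordan_Normal_Form.Char_Poly"
    "HOL-Number_Theory.Cong"
begin

text \<open>
  Finite simple graphs are modelled by the locale \<^locale>\<open>pair_graph\<close>: an undirected
  edge \<open>uv\<close> is the pair of arcs \<open>(u, v)\<close> and \<open>(v, u)\<close>.
\<close>

definition independent_set :: "'a pair_pre_digraph \<Rightarrow> 'a set \<Rightarrow> bool" where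
  "independent_set G S \<longleftrightarrow> S \<subseteq> pverts G \<and> (\<forall>u\<in>S. \<forall>v\<in>S. (u, v) \<notin> parcs G)"

definition independence_number :: "'a pair_pre_digraph \<Rightarrow> nat" where
  "independence_number G = Max (card ` {S. independent_set G S})"

text \<open>Rows and columns are indexed by the vertices in increasing order.\<close>

definition adjacency_matrix :: "'a::linorder pair_pre_digraph \<Rightarrow> real mat" where
  "adjacency_matrix G =
     (let vs = sorted_list_of_set (pverts G)
      in mat (length vs) (length vs)
           (\<lambda>(i, j). if (vs ! i, vs ! j) \<in> parcs G then 1 else 0))"

definition graph_spectral_radius :: "'a::linorder pair_pre_digraph \<Rightarrow> real" where
  "graph_spectral_radius G = Max {k. eigenvalue (adjacency_matrix G) k}"

text \<open>
  Every finite graph is isomorphic to one whose vertices are natural numbers. The constant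
  for connectedness is qualified because of its topological namesake.
\<close>

definition conn_graphs :: "nat \<Rightarrow> nat \<Rightarrow> nat pair_pre_digraph set" where
  "conn_graphs n \<alpha> =
     {G. pair_graph G \<and> Digraph_Component.connected (with_proj G) \<and>
         card (pverts G) = n \<and> independence_number G = \<alpha>}"

definition minimizer_graphs :: "nat \<Rightarrow> nat \<Rightarrow> nat pair_pre_digraph set" where
  "minimizer_graphs n \<alpha> =
     {G \<in> conn_graphs n \<alpha>.
        \<forall>H\<in>conn_graphs n \<alpha>. graph_spectral_radius G \<le> graph_spectral_radius H}"

definition iso_copies :: "'b pair_pre_digraph set \<Rightarrow> nat pair_pre_digraph set" where
  "iso_copies \<H> = {G. \<exists>H\<in>\<H>. digraph_iso (with_proj G) (with_proj H)}"

text \<open>Only suitable for graphs without isolated vertices.\<close>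

definition graph_of_edges :: "('a \<times> 'a) set \<Rightarrow> 'a pair_pre_digraph" where
  "graph_of_edges E = \<lparr> pverts = Field E, parcs = E \<union> E\<inverse> \<rparr>"

text \<open>
  \<open>Vtx_v i\<close>, \<open>Vtx_x j\<close> and \<open>Vtx_y j\<close> stand for the vertices $v_i$, $x_{1j}$ and $y_{1j}$.
\<close>

datatype tree_vertex = Vtx_v nat | Vtx_x nat | Vtx_y nat

definition path_edges :: "nat \<Rightarrow> (tree_vertex \<times> tree_vertex) set" where
  "path_edges k = {(Vtx_v i, Vtx_v (Suc i)) | i. i < k}"

definition branch_edges :: "nat \<Rightarrow> nat \<Rightarrow> (tree_vertex \<times> tree_vertex) set" where
  "branch_edges i j = {(Vtx_v i, Vtx_x j), (Vtx_x j, Vtx_y j)}"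

type_synonym marked_tree = "tree_vertex pair_pre_digraph \<times> tree_vertex list"

definition F6_1 :: marked_tree where
  "F6_1 = (graph_of_edges (path_edges 4 \<union> branch_edges 2 1 \<union> branch_edges 2 2 \<union> branch_edges 2 3),
           [Vtx_v 0, Vtx_v 2, Vtx_v 4, Vtx_y 1, Vtx_y 2, Vtx_y 3])"

definition F6_2 :: marked_tree where
  "F6_2 = (graph_of_edges (path_edges 6 \<union> branch_edges 2 1 \<union> branch_edges 2 2),
           [Vtx_v 0, Vtx_v 2, Vtx_v 4, Vtx_v 6, Vtx_y 1, Vtx_y 2])"

definition F6_3 :: marked_tree where
  "F6_3 = (graph_of_edges (path_edges 6 \<union> branch_edges 2 1 \<union> branch_edges 4 2),
           [Vtx_v 0, Vtx_v 2, Vtx_v 4, Vtx_v 6, Vtx_y 1, Vtx_y 2])"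

definition F6_4 :: marked_tree where
  "F6_4 = (graph_of_edges (path_edges 8 \<union> branch_edges 2 1),
           [Vtx_v 0, Vtx_v 2, Vtx_v 4, Vtx_v 6, Vtx_v 8, Vtx_y 1])"

definition F6_5 :: marked_tree where
  "F6_5 = (graph_of_edges (path_edges 8 \<union> branch_edges 4 1),
           [Vtx_v 0, Vtx_v 2, Vtx_v 4, Vtx_v 6, Vtx_v 8, Vtx_y 1])"

definition F6_6 :: marked_tree where
  "F6_6 = (graph_of_edges (path_edges 10),
           [Vtx_v 0, Vtx_v 2, Vtx_v 4, Vtx_v 6, Vtx_v 8, Vtx_v 10])"

text \<open>
  \<open>Inr (i, k)\<close> is the \<open>k\<close>-th new pendant vertex at the \<open>i\<close>-th vertex of the list, both
  counted from 0; \<open>Inl\<close> embeds the original tree.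
\<close>

definition attach_pendants ::
  "'a pair_pre_digraph \<times> 'a list \<Rightarrow> nat list \<Rightarrow> ('a + nat \<times> nat) pair_pre_digraph" where
  "attach_pendants Fu as =
     (let F = fst Fu; us = snd Fu;
          E = {(Inl (us ! i), Inr (i, k)) | i k. i < length us \<and> k < as ! i}
      in \<lparr> pverts = Inl ` pverts F \<union> snd ` E,
           parcs = map_prod Inl Inl ` parcs F \<union> E \<union> E\<inverse> \<rparr>)"

end

theory Submission
  imports Defs "HOL-Analysis.Function_Topology"
begin

text \<open>
  Let \<open>S\<close> be an independent set of \<open>n - 6\<close> vertices and \<open>C\<close> its complement. Extending a vector \<open>y\<close> on \<open>C\<close>
  to \<open>S\<close> by \<open>1 / \<theta>\<close> times the sum over the neighbours shows that \<open>\<rho> \<le> \<theta>\<close> forces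
  \<open>\<Sum>s\<in>S. (\<Sum>c\<sim>s. y c)\<^sup>2 + \<theta> (y \<bullet> A\<^sub>C y) \<le> \<theta>\<^sup>2 (y \<bullet> y)\<close>. For \<open>y = 1\<close> and \<open>6 \<theta>\<^sup>2 < n + 10\<close> a count of the
  edges leaves only one possibility: \<open>C\<close> is independent, five vertices of \<open>S\<close> subdivide the edges of a
  tree on \<open>C\<close>, and all others are pendant.

  Write \<open>n + 9 = 6 k + s\<close> with \<open>s \<le> 5\<close>, and let \<open>k - deg i - \<delta> i\<close> be the number of pendant vertices at the
  \<open>i\<close>-th vertex of the tree. Then \<open>\<rho>\<^sup>2 - k\<close> is the largest eigenvalue of the adjacency matrix of the tree
  minus \<open>diag \<delta>\<close>, where \<open>\<Sum>i. \<delta> i = 10 - s\<close>. A bound below 1 forces \<open>\<delta> \<ge> 0\<close>, so for each of the six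
  trees a finite search by Gaussian elimination from the leaves finds all optimal \<open>\<delta>\<close>, whose eigenvalues
  are certified by explicit positive eigenvectors.
\<close>

subsection \<open>The spectral radius\<close>

text \<open>With six vertices in C and \<theta> at least 5/2, n + 9 is the smallest value that the
  left side of the inequality can take at y = 1. Exactly the wanted structure attains it and every
  other one costs at least 1 more; hence the bound n + 10. So \<open>6 \<rho>^2\<close> is never
  below n + 9 and the excess \<open>\<rho>^2 - k\<close> never below s/6, which is why n + 9 and not
  n is divided by 6. The optimal excesses 0, (sqrt 29 - 5)/2, sqrt 2 - 1, (sqrt 5 - 1)/2, sqrt 3 -
  1, (sqrt 45 - 5)/2 for s = 0, ..., 5 all lie below (s + 1)/6, so a single structure theorem serves
  all residue classes. The total 10 - s of \<delta> is what remains of 6 k after the n - 11 pendant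
  vertices (six tree vertices and five subdividing vertices are the other eleven) and the degree sum
  10. For s = 0 the vector 1 attains the lower bound, which forces \<delta> to be the degree vector;
  therefore each of the six trees occurs exactly once there.\<close>

lemma linear_term_vanishes:
  fixes b c :: real
  assumes "\<And>t. 0 \<le> 2 * t * b + t\<^sup>2 * c"
  shows "b = 0"
proof (rule ccontr)
  assume b: "b \<noteq> 0"
  define d where "d = \<bar>c\<bar> + 1"
  have d: "d > 0" "c \<le> d - 1" by (auto simp: d_def)
  \<comment> \<open>At t = - b / d the linear term wins, since c < d makes c - 2 d negative.\<close>
  have "0 \<le> 2 * (- b / d) * b + (- b / d)\<^sup>2 * c" by (rule assms)
  also have "\<dots> = (b\<^sup>2 / d\<^sup>2) * (c - 2 * d)"
    using d by (simp add: field_simps power2_eq_square)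
  also have "\<dots> < 0" using b d by (intro mult_pos_neg) auto
  finally show False by simp
qed

text \<open>A maximizer of the form on the unit sphere is an eigenvector, and homogeneity turns the
  maximum into the global bound. Vectors are functions on the whole type, which avoids an
  enumeration of V.\<close>

lemma symmetric_form_maximizer:
  fixes w :: "'a \<Rightarrow> 'a \<Rightarrow> real"
  assumes fin: "finite V" and ne: "V \<noteq> {}" and sym: "\<And>u v. w u v = w v u"
  shows "\<exists>x l. (\<forall>v\<in>V. (\<Sum>u\<in>V. w v u * x u) = l * x v) \<and> (\<exists>v\<in>V. x v \<noteq> 0) \<and>
    (\<forall>y. (\<Sum>u\<in>V. \<Sum>v\<in>V. w u v * y u * y v) \<le> l * (\<Sum>v\<in>V. (y v)\<^sup>2))"
proof -
  define B where "B x y = (\<Sum>u\<in>V. \<Sum>v\<in>V. w u v * x u * y v)" for x y :: "'a \<Rightarrow> real"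
  define N where "N x = (\<Sum>v\<in>V. (x v)\<^sup>2)" for x :: "'a \<Rightarrow> real"
  \<comment> \<open>Coordinates outside V are pinned to 0, so K is a closed part of a product of
    compact sets and compact by Tychonoff, even for an infinite vertex type.\<close>
  define K where "K = {x::'a \<Rightarrow> real. (\<forall>i. x i \<in> (if i \<in> V then {-1..1} else {0})) \<and> N x = 1}"
  have contc: "continuous_on UNIV (\<lambda>x::'a \<Rightarrow> real. x i)" for i
    by simp
  have contN: "continuous_on UNIV N"
    unfolding N_def by (intro continuous_intros contc)
  have contB: "continuous_on UNIV (\<lambda>x. B x x)"
    unfolding B_def by (intro continuous_intros contc)
  have "compactin (product_topology (\<lambda>_. euclidean) UNIV)
          (PiE UNIV (\<lambda>i. if i \<in> V then {-1..1::real} else {0}))"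
    by (subst compactin_PiE) auto
  hence "compact (PiE UNIV (\<lambda>i::'a. if i \<in> V then {-1..1::real} else {0}))"
    by (simp add: euclidean_product_topology)
  moreover have "closed {x. N x = 1}"
    using closed_Collect_eq[OF contN continuous_on_const] by simp
  ultimately have "compact (PiE UNIV (\<lambda>i::'a. if i \<in> V then {-1..1::real} else {0}) \<inter> {x. N x = 1})"
    by (rule compact_Int_closed)
  also have "PiE UNIV (\<lambda>i::'a. if i \<in> V then {-1..1::real} else {0}) \<inter> {x. N x = 1} = K"
    by (auto simp: K_def PiE_def Pi_def)
  finally have "compact K" .
  obtain v0 where v0: "v0 \<in> V" using ne by blast
  have "N (\<lambda>i. if i = v0 then 1 else 0) = (\<Sum>i\<in>V. if i = v0 then 1 else 0)"
    unfolding N_def by (intro sum.cong) auto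
  hence "(\<lambda>i. if i = v0 then 1 else 0) \<in> K"
    using v0 fin by (auto simp: K_def)
  hence "K \<noteq> {}" by blast
  obtain x where x: "x \<in> K" and max: "\<And>y. y \<in> K \<Longrightarrow> B y y \<le> B x x"
    using continuous_attains_sup[OF \<open>compact K\<close> \<open>K \<noteq> {}\<close> continuous_on_subset[OF contB]] by blast
  define l where "l = B x x"
  have Nx: "N x = 1" using x by (simp add: K_def)
  have bound: "B y y \<le> l * N y" for y
  proof (cases "N y = 0")
    case True
    hence "y v = 0" if "v \<in> V" for v
      using that fin by (simp add: N_def sum_nonneg_eq_0_iff)
    hence "B y y = 0" by (simp add: B_def)
    thus ?thesis using True by simp
  next
    case False
    moreover have "N y \<ge> 0" by (simp add: N_def sum_nonneg)
    ultimately have Ny: "N y > 0" by simp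
    define z where "z i = (if i \<in> V then y i / sqrt (N y) else 0)" for i
    have Nz: "N z = 1"
      using Ny by (simp add: N_def z_def power_divide flip: sum_divide_distrib)
    have "\<bar>z i\<bar> \<le> 1" if "i \<in> V" for i
    proof -
      have "(z i)\<^sup>2 \<le> N z"
        unfolding N_def using that fin by (intro member_le_sum) auto
      thus ?thesis using Nz by (simp add: abs_square_le_1)
    qed
    moreover have "z i = 0" if "i \<notin> V" for i using that by (simp add: z_def)
    ultimately have "z \<in> K"
      using Nz by (auto simp: K_def abs_le_iff minus_le_iff)
    hence "B z z \<le> l" using max by (simp add: l_def)
    moreover have "B z z = B y y / N y"
    proof -
      have "B z z = (\<Sum>u\<in>V. \<Sum>v\<in>V. w u v * y u * y v / N y)"
        unfolding B_def using Ny
        by (intro sum.cong refl) (simp add: z_def)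
      thus ?thesis by (simp add: B_def sum_divide_distrib)
    qed
    ultimately show ?thesis using Ny by (simp add: field_simps)
  qed
  have eig: "(\<Sum>u\<in>V. w v u * x u) = l * x v" if v: "v \<in> V" for v
  proof -
    define e where "e i = (if i = v then 1 else 0 :: real)" for i
    define b where "b = l * x v - (\<Sum>u\<in>V. w v u * x u)"
    have Bsym: "B y z = B z y" for y z
      unfolding B_def by (subst sum.swap) (intro sum.cong refl, simp add: mult_ac sym)
    have Bx: "B (\<lambda>i. x i + t * e i) (\<lambda>i. x i + t * e i) = B x x + 2 * t * B e x + t\<^sup>2 * B e e" for t
    proof -
      have "B (\<lambda>i. x i + t * e i) (\<lambda>i. x i + t * e i)
          = B x x + t * B x e + t * B e x + t\<^sup>2 * B e e"
        unfolding B_def sum_distrib_left sum.distrib[symmetric]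
        by (intro sum.cong refl) (simp add: algebra_simps power2_eq_square)
      thus ?thesis by (simp add: Bsym[of x e])
    qed
    have Bex: "B e x = (\<Sum>u\<in>V. w v u * x u)"
    proof -
      have "B e x = (\<Sum>u\<in>V. if u = v then \<Sum>k\<in>V. w v k * x k else 0)"
        unfolding B_def by (intro sum.cong refl) (simp add: e_def)
      thus ?thesis using v fin by simp
    qed
    have "N (\<lambda>i. x i + t * e i) = N x + 2 * t * (\<Sum>i\<in>V. x i * e i) + t\<^sup>2 * (\<Sum>i\<in>V. (e i)\<^sup>2)" for t
      unfolding N_def sum_distrib_left sum.distrib[symmetric]
      by (intro sum.cong refl) (simp add: algebra_simps power2_eq_square)
    moreover have "(\<Sum>i\<in>V. x i * e i) = (\<Sum>i\<in>V. if i = v then x v else 0)"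
      "(\<Sum>i\<in>V. (e i)\<^sup>2) = (\<Sum>i\<in>V. if i = v then 1 else 0)"
      by (intro sum.cong refl; simp add: e_def)+
    ultimately have Ne: "N (\<lambda>i. x i + t * e i) = 1 + 2 * t * x v + t\<^sup>2" for t
      using v fin by (simp add: Nx)
    \<comment> \<open>The difference \<open>l * N - B\<close> is nonnegative by \<open>bound\<close>
      and vanishes at x, so its linear coefficient 2 b in direction e must vanish.\<close>
    have "0 \<le> 2 * t * b + t\<^sup>2 * (l - B e e)" for t
      using bound[of "\<lambda>i. x i + t * e i"] unfolding Bx Ne
      by (simp add: b_def Bex l_def algebra_simps)
    hence "b = 0" by (rule linear_term_vanishes)
    thus ?thesis by (simp add: b_def)
  qed
  have "\<exists>v\<in>V. x v \<noteq> 0"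
  proof (rule ccontr)
    assume "\<not> ?thesis"
    hence "N x = 0" by (simp add: N_def)
    thus False using Nx by simp
  qed
  thus ?thesis using eig bound unfolding B_def N_def by blast
qed

text \<open>Forgets the order of the vertices: from here on an eigenvector is a function on the
  vertex set.\<close>

lemma eigenvalue_adjacency_matrix_iff:
  fixes G :: "'a::linorder pair_pre_digraph"
  assumes fin: "finite (pverts G)"
  shows "eigenvalue (adjacency_matrix G) k \<longleftrightarrow>
    (\<exists>f. (\<exists>v\<in>pverts G. f v \<noteq> 0) \<and>
      (\<forall>v\<in>pverts G. (\<Sum>u\<in>pverts G. of_bool ((v, u) \<in> parcs G) * f u) = k * f v))"
    (is "_ = ?R")
proof -
  define vs where "vs = sorted_list_of_set (pverts G)"
  define m where "m = length vs"
  have set: "set vs = pverts G" and dist: "distinct vs"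
    using fin by (auto simp: vs_def)
  have bij: "bij_betw ((!) vs) {..<m} (pverts G)"
    using bij_betw_nth[OF dist] set by (simp add: m_def)
  have A: "adjacency_matrix G = mat m m (\<lambda>(i, j). of_bool ((vs ! i, vs ! j) \<in> parcs G))"
    unfolding adjacency_matrix_def Let_def vs_def[symmetric] m_def[symmetric]
    by (rule eq_matI) (simp_all add: of_bool_def)
  have inV: "vs ! i \<in> pverts G" if "i < m" for i
    using that nth_mem[of i vs] unfolding set m_def by blast
  have ex: "\<exists>i<m. v = vs ! i" if "v \<in> pverts G" for v
    using that unfolding set[symmetric] m_def by (metis in_set_conv_nth)
  have mv: "(adjacency_matrix G *\<^sub>v x) $ i = (\<Sum>j<m. of_bool ((vs ! i, vs ! j) \<in> parcs G) * x $ j)"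
    if "dim_vec x = m" "i < m" for x i
    using that by (simp add: A scalar_prod_def lessThan_atLeast0)
  have dimA: "dim_row (adjacency_matrix G) = m" by (simp add: A)
  show ?thesis
  proof
    assume "eigenvalue (adjacency_matrix G) k"
    then obtain x where x: "dim_vec x = m" "x \<noteq> 0\<^sub>v m" "adjacency_matrix G *\<^sub>v x = k \<cdot>\<^sub>v x"
      unfolding eigenvalue_def eigenvector_def carrier_vec_def by (auto simp: dimA)
    define f where "f v = x $ (the_inv_into {..<m} ((!) vs) v)" for v
    have f: "f (vs ! i) = x $ i" if "i < m" for i
      using that bij by (simp add: f_def the_inv_into_f_f bij_betw_def)
    have "\<exists>i<m. x $ i \<noteq> 0"
    proof (rule ccontr)
      assume "\<not> ?thesis"
      hence "x = 0\<^sub>v m" using x(1) by (intro eq_vecI) auto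
      thus False using x by simp
    qed
    hence "\<exists>v\<in>pverts G. f v \<noteq> 0" using f inV by metis
    moreover have "(\<Sum>u\<in>pverts G. of_bool ((v, u) \<in> parcs G) * f u) = k * f v"
      if v: "v \<in> pverts G" for v
    proof -
      obtain i where i: "i < m" "v = vs ! i" using ex v by blast
      have "(\<Sum>u\<in>pverts G. of_bool ((v, u) \<in> parcs G) * f u)
          = (\<Sum>j<m. of_bool ((v, vs ! j) \<in> parcs G) * f (vs ! j))"
        by (rule sum.reindex_bij_betw[OF bij, symmetric])
      also have "\<dots> = (adjacency_matrix G *\<^sub>v x) $ i"
        unfolding mv[OF x(1) i(1)] using f i by simp
      also have "\<dots> = k * f v" using x i f by simp
      finally show ?thesis .
    qed
    ultimately show ?R by blast
  next
    assume ?R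
    then obtain f where f: "\<exists>v\<in>pverts G. f v \<noteq> 0"
      "\<And>v. v \<in> pverts G \<Longrightarrow> (\<Sum>u\<in>pverts G. of_bool ((v, u) \<in> parcs G) * f u) = k * f v"
      by blast
    define x where "x = Matrix.vec m (\<lambda>i. f (vs ! i))"
    have x: "dim_vec x = m" by (simp add: x_def)
    have "x \<noteq> 0\<^sub>v m"
    proof
      assume x0: "x = 0\<^sub>v m"
      have "f (vs ! i) = 0" if "i < m" for i
        using that arg_cong[OF x0, of "\<lambda>x. x $ i"] by (simp add: x_def)
      thus False using f(1) ex by metis
    qed
    moreover have "adjacency_matrix G *\<^sub>v x = k \<cdot>\<^sub>v x"
    proof (intro eq_vecI)
      fix i assume "i < dim_vec (k \<cdot>\<^sub>v x)"
      hence i: "i < m" by (simp add: x_def)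
      have "(adjacency_matrix G *\<^sub>v x) $ i
          = (\<Sum>j<m. of_bool ((vs ! i, vs ! j) \<in> parcs G) * f (vs ! j))"
        unfolding mv[OF x i] by (simp add: x_def)
      also have "\<dots> = (\<Sum>u\<in>pverts G. of_bool ((vs ! i, u) \<in> parcs G) * f u)"
        by (rule sum.reindex_bij_betw[OF bij])
      also have "\<dots> = (k \<cdot>\<^sub>v x) $ i" using f(2)[OF inV[OF i]] i by (simp add: x_def)
      finally show "(adjacency_matrix G *\<^sub>v x) $ i = (k \<cdot>\<^sub>v x) $ i" .
    qed (simp add: dimA x)
    ultimately show "eigenvalue (adjacency_matrix G) k"
      using x unfolding eigenvalue_def eigenvector_def dimA by (metis carrier_vecI)
  qed
qed

text \<open>\<open>graph_spectral_radius\<close> is a \<open>Max\<close>, which is only meaningful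
  on a finite set; the eigenvalues are the roots of a monic polynomial.\<close>

lemma finite_eigenvalues_adjacency_matrix: "finite {k. eigenvalue (adjacency_matrix G) k}"
proof -
  define A where "A = adjacency_matrix G"
  have A: "A \<in> carrier_mat (dim_row A) (dim_row A)"
    by (simp add: A_def adjacency_matrix_def Let_def)
  have "{k. eigenvalue A k} = {k. poly (char_poly A) k = 0}"
    using eigenvalue_root_char_poly[OF A] by blast
  moreover have "char_poly A \<noteq> 0"
    using degree_monic_char_poly[OF A] by force
  ultimately show ?thesis
    using poly_roots_finite unfolding A_def by metis
qed

lemma (in pair_graph) arcs_commute: "(u, v) \<in> parcs G \<longleftrightarrow> (v, u) \<in> parcs G"
  using pair_sym_arcs by (auto simp: symmetric_def elim: symE)

text \<open>The constant l of \<open>symmetric_form_maximizer\<close> is itself an eigenvalue, hence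
  at most the largest one.\<close>

lemma rayleigh_le_spectral_radius:
  fixes G :: "'a::linorder pair_pre_digraph"
  assumes "pair_graph G" and ne: "pverts G \<noteq> {}"
  shows "(\<Sum>(u, v)\<in>parcs G. y u * y v) \<le> graph_spectral_radius G * (\<Sum>v\<in>pverts G. (y v)\<^sup>2)"
proof -
  interpret pair_graph G by fact
  define w :: "'a \<Rightarrow> 'a \<Rightarrow> real" where "w u v = of_bool ((u, v) \<in> parcs G)" for u v
  have fin: "finite (pverts G)" by simp
  have sub: "parcs G \<subseteq> pverts G \<times> pverts G" by (auto dest: wellformed')
  obtain x l where xl: "\<forall>v\<in>pverts G. (\<Sum>u\<in>pverts G. w v u * x u) = l * x v" "\<exists>v\<in>pverts G. x v \<noteq> 0"
    and bound: "\<And>y. (\<Sum>u\<in>pverts G. \<Sum>v\<in>pverts G. w u v * y u * y v) \<le> l * (\<Sum>v\<in>pverts G. (y v)\<^sup>2)"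
    using symmetric_form_maximizer[OF fin ne, of w] by (auto simp: w_def arcs_commute)
  have "eigenvalue (adjacency_matrix G) l"
    unfolding eigenvalue_adjacency_matrix_iff[OF fin] using xl by (auto simp: w_def)
  hence "l \<le> graph_spectral_radius G"
    unfolding graph_spectral_radius_def
    by (intro Max_ge finite_eigenvalues_adjacency_matrix) auto
  hence "l * (\<Sum>v\<in>pverts G. (y v)\<^sup>2) \<le> graph_spectral_radius G * (\<Sum>v\<in>pverts G. (y v)\<^sup>2)"
    by (intro mult_right_mono sum_nonneg) auto
  moreover have "(\<Sum>(u, v)\<in>parcs G. y u * y v) = (\<Sum>u\<in>pverts G. \<Sum>v\<in>pverts G. w u v * y u * y v)"
  proof -
    have "(\<Sum>u\<in>pverts G. \<Sum>v\<in>pverts G. w u v * y u * y v)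
        = (\<Sum>(u, v)\<in>pverts G \<times> pverts G. if (u, v) \<in> parcs G then y u * y v else 0)"
      unfolding sum.cartesian_product by (intro sum.cong refl) (auto simp: w_def)
    also have "\<dots> = (\<Sum>(u, v)\<in>parcs G. y u * y v)"
      using sub fin by (intro sum.mono_neutral_cong_right) auto
    finally show ?thesis ..
  qed
  ultimately show ?thesis using bound[of y] by linarith
qed

text \<open>The Perron-Frobenius certificate by which all radii are evaluated: for any eigenvector
  g, \<open>\<bar>g\<bar>\<close> is at most a multiple of the positive f with equality at some
  vertex, and the eigenvalue equations at that vertex compare k with l.\<close>

lemma spectral_radius_eqI:
  fixes G :: "'a::linorder pair_pre_digraph"
  assumes fin: "finite (pverts G)" and ne: "pverts G \<noteq> {}"
    and pos: "\<And>v. v \<in> pverts G \<Longrightarrow> f v > 0"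
    and eig: "\<And>v. v \<in> pverts G \<Longrightarrow> (\<Sum>u | u \<in> pverts G \<and> (v, u) \<in> parcs G. f u) = l * f v"
  shows "graph_spectral_radius G = l"
proof -
  have conv: "(\<Sum>u\<in>pverts G. of_bool ((v, u) \<in> parcs G) * g u)
      = (\<Sum>u | u \<in> pverts G \<and> (v, u) \<in> parcs G. g u)" for v and g :: "'a \<Rightarrow> real"
    using fin by (intro sum.mono_neutral_cong_right) auto
  have "eigenvalue (adjacency_matrix G) l"
    unfolding eigenvalue_adjacency_matrix_iff[OF fin] conv using eig pos ne
    by (metis all_not_in_conv less_irrefl)
  moreover have "k \<le> l" if ev: "eigenvalue (adjacency_matrix G) k" for k
  proof -
    obtain g where g: "\<exists>v\<in>pverts G. g v \<noteq> 0"
      "\<And>v. v \<in> pverts G \<Longrightarrow> (\<Sum>u | u \<in> pverts G \<and> (v, u) \<in> parcs G. g u) = k * g v"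
      using ev unfolding eigenvalue_adjacency_matrix_iff[OF fin] conv
      by (elim exE conjE) (rule that, assumption, drule (1) bspec)
    \<comment> \<open>Compare at the vertex where \<open>\<bar>g\<bar> / f\<close> is largest.\<close>
    define q where "q v = \<bar>g v\<bar> / f v" for v
    define M where "M = Max (q ` pverts G)"
    have "M \<in> q ` pverts G" unfolding M_def using fin ne by (intro Max_in) auto
    then obtain v where v: "v \<in> pverts G" "q v = M" by auto
    have qM: "q u \<le> M" if "u \<in> pverts G" for u
      unfolding M_def using that fin by (intro Max_ge) auto
    have "M > 0"
    proof -
      obtain u where "u \<in> pverts G" "g u \<noteq> 0" using g by blast
      hence "0 < q u" using pos by (simp add: q_def)
      thus ?thesis using qM \<open>u \<in> pverts G\<close> by fastforce
    qed
    have le: "\<bar>g u\<bar> \<le> M * f u" if "u \<in> pverts G" for u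
      using qM[OF that] pos[OF that] by (simp add: q_def field_simps)
    have gv: "\<bar>g v\<bar> = M * f v" using v pos[OF v(1)] by (simp add: q_def field_simps)
    have "k * \<bar>g v\<bar> \<le> \<bar>k * g v\<bar>" by (simp add: abs_mult mult_right_mono)
    also have "\<dots> = \<bar>\<Sum>u | u \<in> pverts G \<and> (v, u) \<in> parcs G. g u\<bar>" using g v by simp
    also have "\<dots> \<le> (\<Sum>u | u \<in> pverts G \<and> (v, u) \<in> parcs G. \<bar>g u\<bar>)" by (rule sum_abs)
    also have "\<dots> \<le> (\<Sum>u | u \<in> pverts G \<and> (v, u) \<in> parcs G. M * f u)"
      using le by (intro sum_mono) auto
    also have "\<dots> = M * (l * f v)" using eig[OF v(1)] by (simp flip: sum_distrib_left)
    finally have "k * (M * f v) \<le> l * (M * f v)" by (simp add: gv mult_ac)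
    thus ?thesis using \<open>M > 0\<close> pos[OF v(1)] by simp
  qed
  ultimately show ?thesis
    unfolding graph_spectral_radius_def
    by (intro Max_eqI finite_eigenvalues_adjacency_matrix) auto
qed

subsection \<open>Connectivity\<close>

text \<open>If no arc left U, reachability could not leave it either. Connectivity of a given graph
  is exploited only in this form.\<close>

lemma (in pair_graph) connected_cut:
  assumes conn: "Digraph_Component.connected (with_proj G)"
    and U: "U \<subseteq> pverts G" "U \<noteq> {}" "U \<noteq> pverts G"
  shows "\<exists>u\<in>U. \<exists>v\<in>pverts G - U. (u, v) \<in> parcs G"
proof (rule ccontr)
  assume no: "\<not> ?thesis"
  obtain u w where u: "u \<in> U" and w: "w \<in> pverts G" "w \<notin> U" using U by blast
  have "(u, w) \<in> rtrancl_on (pverts G) ((parcs G)\<^sup>s)"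
    using conn u w U(1) unfolding connected_conv by auto
  hence "w \<in> U"
  proof (induction rule: rtrancl_on_induct)
    case base
    show ?case by (rule u)
  next
    case (step x z)
    have "(x, z) \<in> parcs G" using step by (auto simp: symcl_def arcs_commute)
    thus ?case using step no by blast
  qed
  thus False using w by simp
qed

text \<open>Prim-style growth for an arbitrary relation. It serves for adjacency in the whole graph
  and for sharing a neighbour of degree two inside the complement of the independent set.\<close>

lemma growing_enumeration:
  assumes fin: "finite X"
    and cut: "\<And>U. U \<subseteq> X \<Longrightarrow> U \<noteq> {} \<Longrightarrow> U \<noteq> X \<Longrightarrow> \<exists>u\<in>U. \<exists>v\<in>X - U. R u v"
  shows "\<exists>f. bij_betw f {..<card X} X \<and> (\<forall>i. 0 < i \<and> i < card X \<longrightarrow> (\<exists>j<i. R (f j) (f i)))"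
proof -
  have "\<exists>f. inj_on f {..<m} \<and> f ` {..<m} \<subseteq> X \<and> (\<forall>i. 0 < i \<and> i < m \<longrightarrow> (\<exists>j<i. R (f j) (f i)))"
    if "m \<le> card X" for m
    using that
  proof (induction m)
    case 0
    show ?case by simp
  next
    case (Suc m)
    then obtain f where f: "inj_on f {..<m}" "f ` {..<m} \<subseteq> X"
      "\<And>i. 0 < i \<Longrightarrow> i < m \<Longrightarrow> \<exists>j<i. R (f j) (f i)" by auto
    have "card (f ` {..<m}) = m" using f by (simp add: card_image)
    hence ne: "f ` {..<m} \<noteq> X" using Suc by auto
    obtain v where v: "v \<in> X" "v \<notin> f ` {..<m}" "m > 0 \<Longrightarrow> \<exists>j<m. R (f j) v"
    proof (cases "m = 0")
      case True
      with ne show ?thesis using that by blast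
    next
      case False
      hence "f ` {..<m} \<noteq> {}" by auto
      from cut[OF f(2) this ne] show ?thesis using that by blast
    qed
    show ?case
    proof (intro exI[of _ "f(m := v)"] conjI allI impI)
      show "inj_on (f(m := v)) {..<Suc m}"
        using f(1) v(2) by (auto simp: inj_on_def less_Suc_eq)
      show "f(m := v) ` {..<Suc m} \<subseteq> X"
        using f(2) v(1) by (auto simp: less_Suc_eq)
      show "\<exists>j<i. R ((f(m := v)) j) ((f(m := v)) i)" if "0 < i \<and> i < Suc m" for i
      proof (cases "i = m")
        case True
        with v(3) that obtain j where "j < m" "R (f j) v" by auto
        thus ?thesis using True by (intro exI[of _ j]) simp
      next
        case False
        with f(3)[of i] that obtain j where "j < i" "R (f j) (f i)" by auto
        thus ?thesis using False that by (intro exI[of _ j]) simp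
      qed
    qed
  qed
  from this[of "card X"] obtain f where f: "inj_on f {..<card X}" "f ` {..<card X} \<subseteq> X"
    "\<forall>i. 0 < i \<and> i < card X \<longrightarrow> (\<exists>j<i. R (f j) (f i))" by auto
  have "f ` {..<card X} = X"
    using f fin by (intro card_subset_eq) (auto simp: card_image)
  thus ?thesis using f by (auto simp: bij_betw_def)
qed

text \<open>In a growing enumeration every vertex but the first receives an arc from an earlier one.
  These arcs and their reverses are all distinct, which is the tree bound with each edge counted as
  two arcs.\<close>

lemma (in pair_graph) connected_card_arcs:
  assumes conn: "Digraph_Component.connected (with_proj G)"
  shows "2 * (card (pverts G) - 1) \<le> card (parcs G)"
proof -
  define n where "n = card (pverts G)"
  obtain f where f: "bij_betw f {..<n} (pverts G)"
    and ex: "\<And>i. 0 < i \<Longrightarrow> i < n \<Longrightarrow> \<exists>j<i. (f j, f i) \<in> parcs G"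
    using growing_enumeration[of "pverts G" "\<lambda>u v. (u, v) \<in> parcs G"] connected_cut[OF conn]
    unfolding n_def by (metis pair_finite_verts)
  obtain p where p: "\<And>i. 0 < i \<Longrightarrow> i < n \<Longrightarrow> p i < i \<and> (f (p i), f i) \<in> parcs G"
    using ex by metis
  define A where "A = (\<lambda>i. (f (p i), f i)) ` {0<..<n}"
  have inj: "f i = f j \<longleftrightarrow> i = j" if "i < n" "j < n" for i j
    using f that by (auto simp: bij_betw_def inj_on_def)
  have cA: "card A = n - 1"
    unfolding A_def using inj by (subst card_image) (auto simp: inj_on_def)
  have "A \<inter> A\<inverse> = {}"
  proof (rule ccontr)
    assume "A \<inter> A\<inverse> \<noteq> {}"
    then obtain i j where ij: "0 < i" "i < n" "0 < j" "j < n" "f (p i) = f j" "f i = f (p j)"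
      by (auto simp: A_def)
    have "p i < i" "p j < j" using p ij by auto
    hence "p i = j" "i = p j" using ij inj by auto
    thus False using \<open>p i < i\<close> \<open>p j < j\<close> by simp
  qed
  moreover have "A \<union> A\<inverse> \<subseteq> parcs G" using p by (auto simp: A_def arcs_commute)
  moreover have "finite A" by (simp add: A_def)
  ultimately have "card A + card (A\<inverse>) \<le> card (parcs G)"
    by (metis card_Un_disjoint card_mono finite_converse pair_finite_arcs)
  thus ?thesis using cA by (simp add: n_def card_inverse)
qed

subsection \<open>Test vectors\<close>

text \<open>
  A vector \<open>y\<close> on the complement \<open>C\<close> of an independent set \<open>S\<close> is extended to \<open>S\<close> the way a
  \<open>\<theta>\<close>-eigenvector would have to be.
\<close>

lemma test_vector_bound:
  fixes G :: "'a::linorder pair_pre_digraph"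
  assumes "pair_graph G" and S: "independent_set G S" and C: "C = pverts G - S" and "C \<noteq> {}"
    and \<theta>: "\<theta> > 0" "graph_spectral_radius G \<le> \<theta>"
  shows "(\<Sum>s\<in>S. (\<Sum>c | (s, c) \<in> parcs G. y c)\<^sup>2) + \<theta> * (\<Sum>(u, v)\<in>parcs G \<inter> C \<times> C. y u * y v)
    \<le> \<theta>\<^sup>2 * (\<Sum>c\<in>C. (y c)\<^sup>2)"
proof -
  interpret pair_graph G by fact
  define Z where "Z s = (\<Sum>c | (s, c) \<in> parcs G. y c)" for s
  define x where "x v = (if v \<in> S then Z v / \<theta> else y v)" for v
  define Q where "Q = (\<Sum>(u, v)\<in>parcs G \<inter> C \<times> C. y u * y v)"
  define B where "B = (SIGMA s:S. {c. (s, c) \<in> parcs G})"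
  have SV: "S \<subseteq> pverts G" and noS: "\<And>u v. u \<in> S \<Longrightarrow> v \<in> S \<Longrightarrow> (u, v) \<notin> parcs G"
    using S by (auto simp: independent_set_def)
  have fin: "finite S" "finite C" using finite_subset[OF SV] C by auto
  have NC: "c \<in> C" if "s \<in> S" "(s, c) \<in> parcs G" for s c
    using that noS C by (auto dest: wellformed')
  have finN: "finite {c. (s, c) \<in> parcs G}" for s
    by (rule finite_subset[of _ "pverts G"]) (auto dest: wellformed')
  have finB: "finite B" unfolding B_def using fin finN by auto
  have B_sum: "(\<Sum>(u, v)\<in>B. x u * x v) = (\<Sum>s\<in>S. (Z s)\<^sup>2) / \<theta>"
  proof -
    have "(\<Sum>(u, v)\<in>B. x u * x v) = (\<Sum>s\<in>S. \<Sum>c | (s, c) \<in> parcs G. x s * x c)"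
      unfolding B_def using fin finN by (subst sum.Sigma) auto
    also have "\<dots> = (\<Sum>s\<in>S. \<Sum>c | (s, c) \<in> parcs G. Z s / \<theta> * y c)"
      using noS by (intro sum.cong refl) (auto simp: x_def)
    also have "\<dots> = (\<Sum>s\<in>S. (Z s)\<^sup>2 / \<theta>)"
      unfolding sum_distrib_left[symmetric] Z_def[symmetric] by (simp add: power2_eq_square)
    finally show ?thesis by (simp add: sum_divide_distrib)
  qed
  have Binv: "(\<Sum>(u, v)\<in>B\<inverse>. x u * x v) = (\<Sum>(u, v)\<in>B. x u * x v)"
    by (rule sum.reindex_bij_witness[of _ prod.swap prod.swap]) (auto simp: mult.commute)
  have split: "parcs G = (parcs G \<inter> C \<times> C) \<union> (B \<union> B\<inverse>)"
    using C NC by (auto simp: B_def arcs_commute dest: wellformed')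
  have "(\<Sum>(u, v)\<in>parcs G. x u * x v)
      = (\<Sum>(u, v)\<in>parcs G \<inter> C \<times> C. x u * x v) + (\<Sum>(u, v)\<in>B \<union> B\<inverse>. x u * x v)"
    by (subst split, rule sum.union_disjoint) (use finB C in \<open>auto simp: B_def\<close>)
  also have "(\<Sum>(u, v)\<in>B \<union> B\<inverse>. x u * x v) = (\<Sum>(u, v)\<in>B. x u * x v) + (\<Sum>(u, v)\<in>B\<inverse>. x u * x v)"
    by (rule sum.union_disjoint) (use finB noS in \<open>auto simp: B_def\<close>)
  also have "(\<Sum>(u, v)\<in>parcs G \<inter> C \<times> C. x u * x v) = Q"
    unfolding Q_def using C by (intro sum.cong refl) (auto simp: x_def)
  finally have lhs: "(\<Sum>(u, v)\<in>parcs G. x u * x v) = Q + 2 * ((\<Sum>s\<in>S. (Z s)\<^sup>2) / \<theta>)"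
    by (simp add: Binv B_sum)
  have "(\<Sum>v\<in>pverts G. (x v)\<^sup>2) = (\<Sum>v\<in>C. (x v)\<^sup>2) + (\<Sum>v\<in>S. (x v)\<^sup>2)"
    using SV C by (simp add: sum.subset_diff)
  also have "(\<Sum>v\<in>C. (x v)\<^sup>2) = (\<Sum>c\<in>C. (y c)\<^sup>2)"
    using C by (intro sum.cong refl) (auto simp: x_def)
  also have "(\<Sum>v\<in>S. (x v)\<^sup>2) = (\<Sum>s\<in>S. (Z s)\<^sup>2) / \<theta>\<^sup>2"
    by (simp add: x_def power_divide sum_divide_distrib)
  finally have rhs: "(\<Sum>v\<in>pverts G. (x v)\<^sup>2) = (\<Sum>c\<in>C. (y c)\<^sup>2) + (\<Sum>s\<in>S. (Z s)\<^sup>2) / \<theta>\<^sup>2" .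
  have "pverts G \<noteq> {}" using C \<open>C \<noteq> {}\<close> by auto
  from rayleigh_le_spectral_radius[OF \<open>pair_graph G\<close> this, of x]
  have "Q + 2 * ((\<Sum>s\<in>S. (Z s)\<^sup>2) / \<theta>) \<le> graph_spectral_radius G * (\<Sum>v\<in>pverts G. (x v)\<^sup>2)"
    unfolding lhs .
  also have "\<dots> \<le> \<theta> * (\<Sum>v\<in>pverts G. (x v)\<^sup>2)"
    by (intro mult_right_mono \<theta> sum_nonneg) auto
  \<comment> \<open>On S the form gains \<open>2 / \<theta>\<close> and the norm costs
    \<open>1 / \<theta>\<close> times the same sum of squares; the value
    \<open>Z s / \<theta>\<close> maximizes this net gain.\<close>
  also have "\<dots> = \<theta> * (\<Sum>c\<in>C. (y c)\<^sup>2) + (\<Sum>s\<in>S. (Z s)\<^sup>2) / \<theta>"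
    unfolding rhs using \<theta> by (simp add: field_simps power2_eq_square)
  finally have "Q + (\<Sum>s\<in>S. (Z s)\<^sup>2) / \<theta> \<le> \<theta> * (\<Sum>c\<in>C. (y c)\<^sup>2)" by simp
  hence "\<theta> * (Q + (\<Sum>s\<in>S. (Z s)\<^sup>2) / \<theta>) \<le> \<theta> * (\<theta> * (\<Sum>c\<in>C. (y c)\<^sup>2))"
    using \<theta> by (intro mult_left_mono) auto
  thus ?thesis
    using \<theta> by (simp add: Z_def Q_def algebra_simps power2_eq_square)
qed

subsection \<open>Subdivided trees with pendant vertices\<close>

text \<open>A midpoint is named by its edge as a set, so a permutation of the core vertices acts on
  the names and no orientation of edges has to be chosen.\<close>

datatype sub_vertex = Core nat | Mid "nat set" | Leaf nat nat

definition sub_edges :: "nat \<Rightarrow> nat set set \<Rightarrow> (nat \<Rightarrow> nat) \<Rightarrow> (sub_vertex \<times> sub_vertex) set" where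
  "sub_edges m E a = {(Core i, Mid e) | i e. e \<in> E \<and> i \<in> e} \<union> {(Core i, Leaf i k) | i k. i < m \<and> k < a i}"

definition pendant_subdivision :: "nat \<Rightarrow> nat set set \<Rightarrow> (nat \<Rightarrow> nat) \<Rightarrow> sub_vertex pair_pre_digraph" where
  "pendant_subdivision m E a =
     \<lparr> pverts = Core ` {..<m} \<union> Mid ` E \<union> {Leaf i k | i k. i < m \<and> k < a i},
       parcs = sub_edges m E a \<union> (sub_edges m E a)\<inverse> \<rparr>"

text \<open>Isomorphism by a vertex map alone; \<open>digraph_iso_iff_is_copy\<close> relates it to
  \<open>digraph_iso\<close>, which also carries maps for arcs and their ends.\<close>

definition is_copy :: "'a pair_pre_digraph \<Rightarrow> 'b pair_pre_digraph \<Rightarrow> bool" where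
  "is_copy H G \<longleftrightarrow> (\<exists>g. inj_on g (pverts H) \<and> pverts G = g ` pverts H \<and> parcs G = map_prod g g ` parcs H)"

text \<open>The tree on \<open>{0..length ps}\<close> in which \<open>Suc i\<close> is attached to the earlier vertex \<open>ps ! i\<close>.\<close>

definition tree_edges :: "nat list \<Rightarrow> nat set set" where
  "tree_edges ps = (\<lambda>i. {ps ! i, Suc i}) ` {..<length ps}"

definition parent_list :: "nat list \<Rightarrow> bool" where
  "parent_list ps \<longleftrightarrow> (\<forall>i<length ps. ps ! i \<le> i)"

text \<open>Since (d - 1)(d - 2) is nonnegative for integers d, the squares of the degrees on S sum
  to at least 3 times the degree sum minus 2 \<open>card S\<close>, and connectivity bounds twice
  the degree sum plus e below by 2 (n - 1). Hence the left side of \<open>test_vector_bound\<close>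
  at y = 1 is at least n + 2 m - 3 + (\<theta> - 3/2) e, while its right side is below n + 2 m - 2.
  A slack smaller than 1 forces e = 0 and equality in both estimates.\<close>

theorem small_radius_structure:
  fixes G :: "'a::linorder pair_pre_digraph"
  assumes G: "pair_graph G" and conn: "Digraph_Component.connected (with_proj G)"
    and S: "independent_set G S" and n: "card (pverts G) = n" and m: "card (pverts G - S) = m" "m > 0"
    and \<theta>: "\<theta> \<ge> 5 / 2" "graph_spectral_radius G \<le> \<theta>" "real m * \<theta>\<^sup>2 < real n + 2 * real m - 2"
  shows "\<exists>ps a. length ps = m - 1 \<and> parent_list ps \<and> is_copy (pendant_subdivision m (tree_edges ps) a) G"
proof -
  interpret pair_graph G by fact
  define C where "C = pverts G - S"
  define N where "N s = {c. (s, c) \<in> parcs G}" for s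
  define d where "d s = card (N s)" for s
  \<comment> \<open>Arcs, so every edge inside C counts twice.\<close>
  define e where "e = card (parcs G \<inter> C \<times> C)"
  have SV: "S \<subseteq> pverts G" and noS: "\<And>u v. u \<in> S \<Longrightarrow> v \<in> S \<Longrightarrow> (u, v) \<notin> parcs G"
    using S by (auto simp: independent_set_def)
  have fin: "finite S" "finite C" using finite_subset[OF SV] by (auto simp: C_def)
  have cC: "card C = m" using m by (simp add: C_def)
  have "C \<noteq> {}" using cC m by auto
  have cS: "card S + m = n"
    using n cC SV fin by (metis C_def card_Diff_subset card_mono le_add_diff_inverse pair_finite_verts)
  have NC: "N s \<subseteq> C" if "s \<in> S" for s
    using that noS by (auto simp: N_def C_def dest: wellformed')
  have finN: "finite (N s)" for s
    unfolding N_def by (rule finite_subset[of _ "pverts G"]) (auto dest: wellformed')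
  have d1: "d s \<ge> 1" if s: "s \<in> S" for s
  proof -
    have "{s} \<noteq> pverts G" using s \<open>C \<noteq> {}\<close> by (auto simp: C_def)
    then obtain v where "(s, v) \<in> parcs G"
      using connected_cut[OF conn, of "{s}"] s SV by auto
    hence "N s \<noteq> {}" by (auto simp: N_def)
    thus ?thesis using finN[of s] by (simp add: d_def Suc_le_eq card_gt_0_iff)
  qed
  have arcs: "card (parcs G) = e + 2 * (\<Sum>s\<in>S. d s)"
  proof -
    define B where "B = (SIGMA s:S. N s)"
    have split: "parcs G = (parcs G \<inter> C \<times> C) \<union> (B \<union> B\<inverse>)"
      using NC by (auto simp: B_def N_def C_def arcs_commute dest: wellformed')
    have finB: "finite B" using fin finN by (auto simp: B_def)
    have "card (parcs G) = e + card (B \<union> B\<inverse>)"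
      unfolding e_def by (subst (1) split, rule card_Un_disjoint) (use finB in \<open>auto simp: B_def C_def\<close>)
    also have "card (B \<union> B\<inverse>) = card B + card (B\<inverse>)"
      by (rule card_Un_disjoint) (use finB noS in \<open>auto simp: B_def N_def\<close>)
    also have "card B = (\<Sum>s\<in>S. d s)" using fin finN by (simp add: B_def d_def)
    finally show ?thesis using finB by (simp add: card_inverse B_def d_def fin finN)
  qed
  have edges: "2 * (real n - 1) \<le> real e + 2 * (\<Sum>s\<in>S. real (d s))"
  proof -
    have "n \<ge> 1" using cS m by simp
    hence "2 * (real n - 1) = real (2 * (n - 1))" by (simp add: of_nat_diff)
    also have "\<dots> \<le> real (e + 2 * (\<Sum>s\<in>S. d s))"
      using connected_card_arcs[OF conn] arcs n by (intro of_nat_mono) simp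
    finally show ?thesis by simp
  qed
  have "(\<Sum>s\<in>S. (real (d s))\<^sup>2) + \<theta> * e \<le> \<theta>\<^sup>2 * real m"
    using test_vector_bound[OF G S C_def \<open>C \<noteq> {}\<close> _ \<theta>(2), of "\<lambda>_. 1"] \<theta>(1) cC
    by (simp add: d_def N_def e_def)
  hence sq: "(\<Sum>s\<in>S. (real (d s))\<^sup>2) + \<theta> * e < real n + 2 * real m - 2"
    using \<theta>(3) by (simp add: mult.commute)
  have gap: "0 \<le> (real (d s) - 1) * (real (d s) - 2)" if "s \<in> S" for s
    using d1[OF that] by (cases "d s = 1") auto
  have gap_sum: "(\<Sum>s\<in>S. (real (d s) - 1) * (real (d s) - 2))
      = (\<Sum>s\<in>S. (real (d s))\<^sup>2) - 3 * (\<Sum>s\<in>S. real (d s)) + 2 * real (card S)"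
    by (simp add: algebra_simps sum.distrib sum_subtractf sum_distrib_left power2_eq_square)
  have gap_nn: "0 \<le> (\<Sum>s\<in>S. (real (d s) - 1) * (real (d s) - 2))"
    by (rule sum_nonneg) (rule gap)
  have cS': "real (card S) = real n - real m" using cS by linarith
  have "(\<theta> - 3 / 2) * e < 1"
    using edges sq gap_nn unfolding gap_sum cS' by (simp add: algebra_simps)
  \<comment> \<open>The bound 5/2 on \<theta> is what makes each arc inside C cost at least
    1.\<close>
  moreover have "(\<theta> - 3 / 2) * e \<ge> 1 * real e" using \<theta>(1) by (intro mult_right_mono) auto
  ultimately have e0: "e = 0" by simp
  have noC: "(u, v) \<notin> parcs G" if "u \<in> C" "v \<in> C" for u v
    using e0 that by (auto simp: e_def card_eq_0_iff)
  have sum_d: "(\<Sum>s\<in>S. d s) + 1 = n"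
  proof -
    \<comment> \<open>Both sides are integers, so the strict bound improves to n + 2 m - 3, where
      the two estimates are tight.\<close>
    have "real (\<Sum>s\<in>S. (d s)\<^sup>2) < real (n + 2 * m - 2)"
      using sq e0 m by (simp add: of_nat_diff)
    hence "(\<Sum>s\<in>S. (d s)\<^sup>2) + 3 \<le> n + 2 * m" by linarith
    hence "(\<Sum>s\<in>S. (real (d s))\<^sup>2) + 3 \<le> real n + 2 * real m"
      by (metis (mono_tags, lifting) of_nat_add of_nat_le_iff of_nat_mult of_nat_numeral of_nat_power of_nat_sum sum.cong)
    hence "(\<Sum>s\<in>S. real (d s)) \<le> real n - 1" "(\<Sum>s\<in>S. real (d s)) \<ge> real n - 1"
      using gap_nn edges e0 unfolding gap_sum cS' by (auto simp: algebra_simps)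
    hence "real ((\<Sum>s\<in>S. d s) + 1) = real n" by simp
    thus ?thesis by (simp only: of_nat_eq_iff)
  qed
  have d12: "d s = 1 \<or> d s = 2" if s: "s \<in> S" for s
  proof -
    have "real (\<Sum>s\<in>S. (d s)\<^sup>2) < real (n + 2 * m - 2)"
      using sq e0 m by (simp add: of_nat_diff)
    hence "(\<Sum>s\<in>S. (d s)\<^sup>2) + 3 \<le> n + 2 * m" by linarith
    hence "real ((\<Sum>s\<in>S. (d s)\<^sup>2) + 3) \<le> real (n + 2 * m)" by (simp only: of_nat_le_iff)
    moreover have "(\<Sum>s\<in>S. real (d s)) = real n - 1"
      using arg_cong[OF sum_d, of real] by simp
    ultimately have "(\<Sum>s\<in>S. (real (d s) - 1) * (real (d s) - 2)) = 0"
      using gap_nn unfolding gap_sum cS' by simp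
    hence "(real (d s) - 1) * (real (d s) - 2) = 0"
      using s fin gap by (subst (asm) sum_nonneg_eq_0_iff) auto
    thus ?thesis by auto
  qed
  define S2 where "S2 = {s\<in>S. d s = 2}"
  have cS2: "card S2 = m - 1"
  proof -
    have "(\<Sum>s\<in>S. d s) = (\<Sum>s\<in>S. 1 + (if d s = 2 then 1 else 0))"
      using d12 by (intro sum.cong refl) fastforce
    also have "\<dots> = card S + card S2"
      unfolding sum.distrib S2_def using fin by (simp add: sum.inter_filter[symmetric])
    finally show ?thesis using sum_d cS by simp
  qed
  \<comment> \<open>Adjoin to U the vertices of S with all neighbours in U. An edge leaving this set
    must run from U to some v in S that has a neighbour outside U, and v has degree at most
    two.\<close>
  have cut: "\<exists>u\<in>U. \<exists>v\<in>C - U. \<exists>s\<in>S. N s = {u, v}" if U: "U \<subseteq> C" "U \<noteq> {}" "U \<noteq> C" for U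
  proof -
    define W where "W = U \<union> {s\<in>S. N s \<subseteq> U}"
    have "W \<subseteq> pverts G" "W \<noteq> {}" "W \<noteq> pverts G"
      using U SV by (auto simp: W_def C_def)
    from connected_cut[OF conn this] obtain u v
      where uv: "u \<in> W" "v \<in> pverts G" "v \<notin> W" "(u, v) \<in> parcs G" by auto
    have "u \<in> U"
      using uv by (auto simp: W_def N_def)
    hence vS: "v \<in> S" using noC uv(2,4) U by (auto simp: C_def)
    have uN: "u \<in> N v" using uv(4) by (simp add: N_def arcs_commute)
    obtain w where w: "w \<in> N v" "w \<notin> U" using uv vS by (auto simp: W_def)
    have "card {u, w} = 2" using w \<open>u \<in> U\<close> by (metis card_2_iff)
    moreover have "card {u, w} \<le> d v" unfolding d_def using uN w finN by (intro card_mono) auto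
    ultimately have "d v = 2" using d12[OF vS] by auto
    hence "N v = {u, w}"
      using uN w finN \<open>card {u, w} = 2\<close> unfolding d_def
      by (metis card_subset_eq empty_subsetI insert_subset)
    thus ?thesis using \<open>u \<in> U\<close> w NC[OF vS] vS by blast
  qed
  obtain c where c: "bij_betw c {..<m} C"
    and ex: "\<forall>i. 0 < i \<and> i < m \<longrightarrow> (\<exists>j<i. \<exists>s\<in>S. N s = {c j, c i})"
    using growing_enumeration[OF fin(2) cut] unfolding cC by blast
  have "\<forall>i. \<exists>j s. 0 < i \<and> i < m \<longrightarrow> j < i \<and> s \<in> S \<and> N s = {c j, c i}"
    using ex by blast
  then obtain P M where PM: "\<And>i. 0 < i \<Longrightarrow> i < m \<Longrightarrow> P i < i \<and> M i \<in> S \<and> N (M i) = {c (P i), c i}"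
    by metis
  have injc: "c i = c j \<longleftrightarrow> i = j" if "i < m" "j < m" for i j
    using c that by (auto simp: bij_betw_def inj_on_def)
  have cimg: "c ` {..<m} = C" using c by (simp add: bij_betw_def)
  have NM: "c ` {P i, i} = N (M i)" if "0 < i" "i < m" for i using PM[OF that] by auto
  have injM: "inj_on M {0<..<m}"
  proof (rule inj_onI)
    fix i j assume ij: "i \<in> {0<..<m}" "j \<in> {0<..<m}" "M i = M j"
    hence "P i < i" "P j < j" using PM by auto
    moreover have "{c (P i), c i} = {c (P j), c j}"
      using PM[of i] PM[of j] ij by (metis greaterThanLessThan_iff)
    moreover from calculation have "P i < m" "P j < m" using ij by auto
    ultimately show "i = j" using ij injc by (auto simp: doubleton_eq_iff)
  qed
  \<comment> \<open>The m - 1 midpoints picked by the enumeration are distinct and of degree two,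
    and S contains only m - 1 such vertices.\<close>
  have imgM: "M ` {0<..<m} = S2"
  proof (rule card_subset_eq)
    show "M ` {0<..<m} \<subseteq> S2"
    proof
      fix s assume "s \<in> M ` {0<..<m}"
      then obtain i where i: "0 < i" "i < m" "s = M i" by auto
      have "P i < i" "s \<in> S" "N s = {c (P i), c i}" using PM[OF i(1,2)] i(3) by auto
      moreover have "c (P i) \<noteq> c i" using injc[of "P i" i] i \<open>P i < i\<close> by auto
      ultimately show "s \<in> S2" by (simp add: S2_def d_def)
    qed
    show "finite S2" using fin by (simp add: S2_def)
    show "card (M ` {0<..<m}) = card S2" using injM by (simp add: card_image cS2)
  qed
  \<comment> \<open>Entry i is the parent of vertex i + 1, as \<open>tree_edges\<close>
    expects.\<close>
  define ps where "ps = map (\<lambda>i. P (Suc i)) [0..<m - 1]"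
  have len: "length ps = m - 1" by (simp add: ps_def)
  have par: "parent_list ps"
    unfolding parent_list_def len using PM by (auto simp: ps_def less_Suc_eq_le[symmetric] less_diff_conv)
  have te: "tree_edges ps = (\<lambda>i. {P i, i}) ` {0<..<m}"
  proof -
    have "tree_edges ps = (\<lambda>i. {P (Suc i), Suc i}) ` {..<m - 1}"
      unfolding tree_edges_def len by (intro image_cong refl) (simp add: ps_def)
    also have "\<dots> = (\<lambda>i. {P i, i}) ` (Suc ` {..<m - 1})" by (simp add: image_image)
    also have "Suc ` {..<m - 1} = {0<..<m}"
      unfolding image_Suc_lessThan using m(2) by auto
    finally show ?thesis .
  qed
  define L where "L i = {s\<in>S. N s = {c i}}" for i
  define a where "a i = card (L i)" for i
  have "\<forall>i. \<exists>h. bij_betw h {..<a i} (L i)"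
    unfolding a_def lessThan_atLeast0 using fin by (auto simp: L_def intro!: ex_bij_betw_nat_finite)
  then obtain h where h: "\<And>i. bij_betw (h i) {..<a i} (L i)" by metis
  \<comment> \<open>Parents come earlier, so the larger end of an edge is the child that indexes its
    midpoint.\<close>
  define g where "g v = (case v of Core i \<Rightarrow> c i | Mid e \<Rightarrow> M (Max e) | Leaf i k \<Rightarrow> h i k)" for v
  define H where "H = pendant_subdivision m (tree_edges ps) a"
  have Max: "Max {P i, i} = i" if "0 < i" "i < m" for i using PM[OF that] by auto
  have gM: "g (Mid {P i, i}) = M i" if "0 < i" "i < m" for i
    using Max[OF that] by (simp add: g_def)
  have gC: "g (Core i) = c i" for i by (simp add: g_def)
  have gL: "g (Leaf i k) \<in> L i" if "k < a i" for i k
    using h[of i] that by (auto simp: g_def bij_betw_def)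
  have gLimg: "\<exists>k<a i. s = g (Leaf i k)" if "s \<in> L i" for i s
    using h[of i] that by (auto simp: g_def bij_betw_def image_iff)
  have MidE: "\<exists>i. 0 < i \<and> i < m \<and> e = {P i, i}" if "e \<in> tree_edges ps" for e
    using that by (auto simp: te)
  have injg: "inj_on g (pverts H)"
  proof (rule inj_onI)
    fix u v assume uv: "u \<in> pverts H" "v \<in> pverts H" "g u = g v"
    have locC: "i < m" "g (Core i) \<in> C - S" if "Core i \<in> pverts H" for i
      using that cimg by (auto simp: H_def pendant_subdivision_def gC C_def)
    have locM: "\<exists>j. 0 < j \<and> j < m \<and> e = {P j, j}" "g (Mid e) \<in> S2" if "Mid e \<in> pverts H" for e
    proof -
      have "e \<in> tree_edges ps" using that by (auto simp: H_def pendant_subdivision_def)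
      then obtain i where i: "0 < i" "i < m" "e = {P i, i}" using MidE by blast
      hence "g (Mid e) \<in> M ` {0<..<m}" using gM by simp
      thus "g (Mid e) \<in> S2" using imgM by simp
      show "\<exists>j. 0 < j \<and> j < m \<and> e = {P j, j}" using i by blast
    qed
    have locL: "i < m" "k < a i" "g (Leaf i k) \<in> L i" if "Leaf i k \<in> pverts H" for i k
      using that gL by (auto simp: H_def pendant_subdivision_def)
    have SL: "x \<in> S \<and> x \<notin> S2" if "x \<in> L i" for x i using that by (simp add: L_def S2_def d_def)
    have SS: "x \<in> S" if "x \<in> S2" for x using that by (simp add: S2_def)
    show "u = v"
    proof (cases u)
      case u: (Core i)
      show ?thesis
      proof (cases v)
        case (Core j)
        thus ?thesis using uv u injc locC by (simp add: gC)
      next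
        case (Mid e)
        thus ?thesis using uv u locC(2) locM(2) SS by (metis DiffD2)
      next
        case (Leaf j k)
        thus ?thesis using uv u locC(2) locL(3) SL by (metis DiffD2)
      qed
    next
      case u: (Mid e)
      show ?thesis
      proof (cases v)
        case (Core i)
        thus ?thesis using uv u locC(2) locM(2) SS by (metis DiffD2)
      next
        case (Mid e')
        obtain i where i: "0 < i" "i < m" "e = {P i, i}" using locM(1) uv(1) u by blast
        obtain j where j: "0 < j" "j < m" "e' = {P j, j}" using locM(1) uv(2) Mid by blast
        have "M i = M j" using uv(3) u Mid gM i j by simp
        hence "i = j" using injM i j by (auto simp: inj_on_def)
        thus ?thesis using i j u Mid by simp
      next
        case (Leaf j k)
        thus ?thesis using uv u locM(2) locL(3) SL by metis
      qed
    next
      case u: (Leaf i k)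
      show ?thesis
      proof (cases v)
        case (Core j)
        thus ?thesis using uv u locC(2) locL(3) SL by (metis DiffD2)
      next
        case (Mid e)
        thus ?thesis using uv u locM(2) locL(3) SL by metis
      next
        case (Leaf j l)
        have bd: "i < m" "j < m" "k < a i" "l < a j" using locL(1,2) uv(1,2) u Leaf by auto
        have "g (Leaf i k) \<in> L i" "g (Leaf i k) \<in> L j" using locL(3) uv u Leaf by metis+
        hence "c i = c j" by (auto simp: L_def)
        hence "i = j" using bd injc by simp
        moreover from this have "k = l"
          using uv(3) u Leaf bd h[of i] by (auto simp: g_def bij_betw_def inj_on_def)
        ultimately show ?thesis using u Leaf by simp
      qed
    qed
  qed
  have S_cases: "(\<exists>i. 0 < i \<and> i < m \<and> s = M i) \<or> (\<exists>i<m. s \<in> L i)" if s: "s \<in> S" for s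
  proof (cases "d s = 2")
    case True
    hence "s \<in> M ` {0<..<m}" unfolding imgM using s by (simp add: S2_def)
    thus ?thesis by auto
  next
    case False
    hence "card (N s) = 1" using d12[OF s] by (simp add: d_def)
    then obtain x where x: "N s = {x}" by (auto simp: card_1_singleton_iff)
    hence "x \<in> c ` {..<m}" using NC[OF s] cimg by auto
    then obtain i where "i < m" "x = c i" by auto
    thus ?thesis using s x by (auto simp: L_def)
  qed
  have img: "pverts G = g ` pverts H"
  proof
    show "g ` pverts H \<subseteq> pverts G"
    proof
      fix x assume "x \<in> g ` pverts H"
      then obtain v where v: "v \<in> pverts H" "x = g v" by auto
      show "x \<in> pverts G"
      proof (cases v)
        case (Core i)
        hence "x \<in> C" using v cimg by (auto simp: H_def pendant_subdivision_def gC)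
        thus ?thesis by (simp add: C_def)
      next
        case (Mid e)
        hence "e \<in> tree_edges ps" using v by (auto simp: H_def pendant_subdivision_def)
        then obtain i where i: "0 < i" "i < m" "e = {P i, i}" using MidE by blast
        hence "x = M i" using v Mid gM by simp
        thus ?thesis using PM[OF i(1,2)] SV by auto
      next
        case (Leaf i k)
        hence "x \<in> L i" using v gL by (auto simp: H_def pendant_subdivision_def)
        thus ?thesis using SV by (auto simp: L_def)
      qed
    qed
    show "pverts G \<subseteq> g ` pverts H"
    proof
      fix x assume x: "x \<in> pverts G"
      show "x \<in> g ` pverts H"
      proof (cases "x \<in> S")
        case False
        hence "x \<in> c ` {..<m}" using x cimg by (simp add: C_def)
        then obtain i where "i < m" "x = g (Core i)" by (auto simp: gC)
        thus ?thesis by (auto simp: H_def pendant_subdivision_def)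
      next
        case True
        from S_cases[OF this] show ?thesis
        proof (elim disjE exE conjE)
          fix i assume "0 < i" "i < m" "x = M i"
          hence "x = g (Mid {P i, i})" "{P i, i} \<in> tree_edges ps" using gM te by auto
          thus ?thesis by (auto simp: H_def pendant_subdivision_def)
        next
          fix i assume "i < m" "x \<in> L i"
          then obtain k where "k < a i" "x = g (Leaf i k)" using gLimg by blast
          thus ?thesis using \<open>i < m\<close> by (auto simp: H_def pendant_subdivision_def)
        qed
      qed
    qed
  qed
  define B where "B = {(x, s). s \<in> S \<and> x \<in> N s}"
  have B: "map_prod g g ` sub_edges m (tree_edges ps) a = B"
  proof
    show "map_prod g g ` sub_edges m (tree_edges ps) a \<subseteq> B"
    proof
      fix z assume "z \<in> map_prod g g ` sub_edges m (tree_edges ps) a"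
      then consider (1) i e where "e \<in> tree_edges ps" "i \<in> e" "z = (g (Core i), g (Mid e))"
        | (2) i k where "i < m" "k < a i" "z = (g (Core i), g (Leaf i k))"
        by (auto simp: sub_edges_def)
      thus "z \<in> B"
      proof cases
        case 1
        then obtain j where j: "0 < j" "j < m" "e = {P j, j}" using MidE by blast
        hence "z = (c i, M j)" "c i \<in> c ` {P j, j}" using 1 gM gC by auto
        thus ?thesis using NM[OF j(1,2)] PM[OF j(1,2)] by (simp add: B_def)
      next
        case 2
        hence "g (Leaf i k) \<in> L i" using gL by blast
        thus ?thesis using 2 by (auto simp: B_def L_def gC)
      qed
    qed
    show "B \<subseteq> map_prod g g ` sub_edges m (tree_edges ps) a"
    proof
      fix z assume "z \<in> B"
      then obtain x s where z: "z = (x, s)" "s \<in> S" "x \<in> N s" by (auto simp: B_def)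
      from S_cases[OF z(2)] show "z \<in> map_prod g g ` sub_edges m (tree_edges ps) a"
      proof (elim disjE exE conjE)
        fix i assume i: "0 < i" "i < m" "s = M i"
        hence "x \<in> c ` {P i, i}" using z NM by simp
        then obtain j where j: "j \<in> {P i, i}" "x = c j" by auto
        have "z = map_prod g g (Core j, Mid {P i, i})" using z i j gM by (simp add: gC)
        moreover have "(Core j, Mid {P i, i}) \<in> sub_edges m (tree_edges ps) a"
          using i j te by (auto simp: sub_edges_def)
        ultimately show ?thesis by blast
      next
        fix i assume i: "i < m" "s \<in> L i"
        then obtain k where k: "k < a i" "s = g (Leaf i k)" using gLimg by blast
        have "x = c i" using z i by (auto simp: L_def)
        hence "z = map_prod g g (Core i, Leaf i k)" using z k by (simp add: gC)
        moreover have "(Core i, Leaf i k) \<in> sub_edges m (tree_edges ps) a"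
          using i k by (auto simp: sub_edges_def)
        ultimately show ?thesis by blast
      qed
    qed
  qed
  have "u \<in> S \<or> v \<in> S" if "(u, v) \<in> parcs G" for u v
    using noC[of u v] that wellformed'[OF that] by (auto simp: C_def)
  hence "parcs G = B \<union> B\<inverse>"
    by (auto simp: B_def N_def arcs_commute)
  also have "\<dots> = map_prod g g ` parcs H"
    unfolding B[symmetric] H_def pendant_subdivision_def by auto
  finally have "is_copy H G" unfolding is_copy_def using injg img by blast
  thus ?thesis using len par unfolding H_def by blast
qed

subsection \<open>Copies of a graph\<close>

lemma is_copyI:
  assumes "inj_on g (pverts H)" "pverts G = g ` pverts H" "parcs G = map_prod g g ` parcs H"
  shows "is_copy H G"
  using assms unfolding is_copy_def by blast

lemma is_copyE:
  assumes "is_copy H G"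
  obtains g where "inj_on g (pverts H)" "pverts G = g ` pverts H" "parcs G = map_prod g g ` parcs H"
  using assms unfolding is_copy_def by (elim exE conjE)

lemma is_copy_trans: "is_copy H K \<Longrightarrow> is_copy K G \<Longrightarrow> is_copy H G"
proof -
  assume HK: "is_copy H K" and KG: "is_copy K G"
  obtain f where f: "inj_on f (pverts H)" "pverts K = f ` pverts H" "parcs K = map_prod f f ` parcs H"
    using HK by (rule is_copyE)
  obtain g where g: "inj_on g (pverts K)" "pverts G = g ` pverts K" "parcs G = map_prod g g ` parcs K"
    using KG by (rule is_copyE)
  show ?thesis
  proof (rule is_copyI[of "g \<circ> f"])
    show "inj_on (g \<circ> f) (pverts H)" using f g by (intro comp_inj_on) auto
    show "pverts G = (g \<circ> f) ` pverts H" using f g by (simp add: image_comp)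
    show "parcs G = map_prod (g \<circ> f) (g \<circ> f) ` parcs H"
      unfolding g(3) f(3) image_image by (intro image_cong refl) auto
  qed
qed

text \<open>The inverse map is only controlled on \<open>pverts H\<close>; an arc with an end
  outside would not be mapped back.\<close>

lemma is_copy_sym:
  assumes wf: "parcs H \<subseteq> pverts H \<times> pverts H" and c: "is_copy H G"
  shows "is_copy G H"
proof -
  obtain g where g: "inj_on g (pverts H)" "pverts G = g ` pverts H" "parcs G = map_prod g g ` parcs H"
    using c by (rule is_copyE)
  define h where "h = the_inv_into (pverts H) g"
  have hg: "h (g x) = x" if "x \<in> pverts H" for x
    using that g(1) by (simp add: h_def the_inv_into_f_f)
  show ?thesis
  proof (rule is_copyI[of h])
    show "inj_on h (pverts G)" unfolding g(2) by (rule inj_onI) (auto simp: hg)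
    show "pverts H = h ` pverts G" unfolding g(2) image_image by (simp add: hg)
    have "map_prod h h ` parcs G = (\<lambda>x. x) ` parcs H"
      unfolding g(3) image_image by (rule image_cong) (use wf hg in auto)
    thus "parcs H = map_prod h h ` parcs G" by simp
  qed
qed

lemma is_copy_wf:
  assumes "parcs H \<subseteq> pverts H \<times> pverts H" "is_copy H G"
  shows "parcs G \<subseteq> pverts G \<times> pverts G"
proof -
  obtain g where "pverts G = g ` pverts H" "parcs G = map_prod g g ` parcs H"
    using assms(2) by (rule is_copyE)
  thus ?thesis using assms(1) by auto
qed

text \<open>The ends of an arc of a pair graph are its components, so an isomorphism acts on arcs as
  \<open>map_prod\<close> of its vertex map.\<close>

lemma digraph_iso_iff_is_copy:
  assumes wf: "parcs H \<subseteq> pverts H \<times> pverts H"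
  shows "digraph_iso (with_proj G) (with_proj H) \<longleftrightarrow> is_copy H G"
proof
  assume "digraph_iso (with_proj G) (with_proj H)"
  then obtain f where f: "pre_digraph.digraph_isomorphism (with_proj G) f"
    and H: "with_proj H = app_iso f (with_proj G)"
    unfolding digraph_iso_def by blast
  have V: "pverts H = iso_verts f ` pverts G" and A: "parcs H = iso_arcs f ` parcs G"
    and t: "iso_tail f = fst" "iso_head f = snd"
    using arg_cong[OF H, of verts] arg_cong[OF H, of arcs] arg_cong[OF H, of tail] arg_cong[OF H, of head]
    by simp_all
  have wfG: "wf_digraph (with_proj G)" and inj: "inj_on (iso_verts f) (pverts G)"
    and arc: "\<And>a. a \<in> parcs G \<Longrightarrow> iso_verts f (fst a) = fst (iso_arcs f a) \<and> iso_verts f (snd a) = snd (iso_arcs f a)"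
    using f unfolding pre_digraph.digraph_isomorphism_def by (simp_all add: t)
  have "iso_arcs f a = map_prod (iso_verts f) (iso_verts f) a" if "a \<in> parcs G" for a
    using arc[OF that] by (intro prod_eqI) auto
  hence "is_copy G H" using inj V A by (intro is_copyI[of "iso_verts f"]) (auto simp: image_iff)
  moreover have "parcs G \<subseteq> pverts G \<times> pverts G"
    using wf_digraph.tail_in_verts[OF wfG] wf_digraph.head_in_verts[OF wfG] by force
  ultimately show "is_copy H G" by (rule is_copy_sym[rotated])
next
  assume c: "is_copy H G"
  have wfG: "parcs G \<subseteq> pverts G \<times> pverts G" by (rule is_copy_wf[OF wf c])
  from is_copy_sym[OF wf c] obtain g
    where g: "inj_on g (pverts G)" "pverts H = g ` pverts G" "parcs H = map_prod g g ` parcs G"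
    by (rule is_copyE)
  define f where "f = \<lparr>iso_verts = g, iso_arcs = map_prod g g, iso_head = snd, iso_tail = fst\<rparr>"
  have "inj_on (map_prod g g) (parcs G)"
    using inj_on_subset[OF map_prod_inj_on[OF g(1) g(1)] wfG] .
  moreover have "wf_digraph (with_proj G)"
    using wfG by unfold_locales auto
  ultimately have "pre_digraph.digraph_isomorphism (with_proj G) f"
    unfolding pre_digraph.digraph_isomorphism_def using g(1) by (auto simp: f_def)
  moreover have "with_proj H = app_iso f (with_proj G)"
    using g by (simp add: with_proj_def app_iso_def f_def)
  ultimately show "digraph_iso (with_proj G) (with_proj H)" unfolding digraph_iso_def by blast
qed

text \<open>\<open>conn_graphs\<close> lives on natural numbers; this brings an optimal
  \<open>pendant_subdivision\<close> into it.\<close>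

lemma ex_nat_copy:
  assumes "finite (pverts H)"
  shows "\<exists>G :: nat pair_pre_digraph. is_copy H G"
proof -
  obtain g :: "_ \<Rightarrow> nat" where "inj_on g (pverts H)"
    using finite_imp_inj_to_nat_seg[OF assms] by blast
  hence "is_copy H \<lparr>pverts = g ` pverts H, parcs = map_prod g g ` parcs H\<rparr>"
    by (intro is_copyI) auto
  thus ?thesis by blast
qed

subsection \<open>Parameters of subdivided trees with pendant vertices\<close>

text \<open>The larger end of the i-th edge is \<open>Suc i\<close>.\<close>

lemma tree_edges_inj: "parent_list ps \<Longrightarrow> inj_on (\<lambda>i. {ps ! i, Suc i}) {..<length ps}"
proof (rule inj_onI)
  fix i j assume ps: "parent_list ps" and ij: "i \<in> {..<length ps}" "j \<in> {..<length ps}"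
    "{ps ! i, Suc i} = {ps ! j, Suc j}"
  have "ps ! i \<le> i" "ps ! j \<le> j" using ps ij(1,2) by (auto simp: parent_list_def)
  hence "Max {ps ! i, Suc i} = Suc i" "Max {ps ! j, Suc j} = Suc j" by auto
  thus "i = j" unfolding ij(3) by linarith
qed

lemma tree_edges_subset: "parent_list ps \<Longrightarrow> e \<in> tree_edges ps \<Longrightarrow> e \<subseteq> {..<Suc (length ps)}"
proof -
  assume ps: "parent_list ps" and e: "e \<in> tree_edges ps"
  obtain i where i: "i < length ps" "e = {ps ! i, Suc i}" using e by (auto simp: tree_edges_def)
  have "ps ! i \<le> i" using ps i by (simp add: parent_list_def)
  thus ?thesis using i by simp
qed

text \<open>Counts, independence and the spectral facts treat E as a hypergraph on the core; trees
  are inserted later through \<open>subdivision_tree_edges\<close>.\<close>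

locale subdivision =
  fixes m :: nat and E :: "nat set set" and a :: "nat \<Rightarrow> nat"
  assumes E_finite: "finite E" and E_subset: "\<And>e. e \<in> E \<Longrightarrow> e \<subseteq> {..<m}" and E_nonempty: "\<And>e. e \<in> E \<Longrightarrow> e \<noteq> {}"
begin

abbreviation "H \<equiv> pendant_subdivision m E a"

lemma verts_H: "pverts H = Core ` {..<m} \<union> (Mid ` E \<union> (\<lambda>(i, k). Leaf i k) ` (SIGMA i:{..<m}. {..<a i}))"
  by (auto simp: pendant_subdivision_def)

lemma wf_H: "parcs H \<subseteq> pverts H \<times> pverts H"
  using E_subset by (fastforce simp: pendant_subdivision_def sub_edges_def)

lemma finite_H: "finite (pverts H)"
  unfolding verts_H using E_finite by auto

lemma arcs_from_Mid: "e \<in> E \<Longrightarrow> {y. (Mid e, y) \<in> parcs H} = Core ` e"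
  by (auto simp: pendant_subdivision_def sub_edges_def)

lemma arcs_from_Leaf: "i < m \<Longrightarrow> k < a i \<Longrightarrow> {y. (Leaf i k, y) \<in> parcs H} = {Core i}"
  by (auto simp: pendant_subdivision_def sub_edges_def)

lemma arcs_from_Core: "i < m \<Longrightarrow> {y. (Core i, y) \<in> parcs H} = Mid ` {e\<in>E. i \<in> e} \<union> Leaf i ` {..<a i}"
  by (auto simp: pendant_subdivision_def sub_edges_def)

lemma sum_non_core:
  fixes f :: "sub_vertex \<Rightarrow> real"
  shows "(\<Sum>x\<in>Mid ` E \<union> (\<lambda>(i, k). Leaf i k) ` (SIGMA i:{..<m}. {..<a i}). f x)
    = (\<Sum>e\<in>E. f (Mid e)) + (\<Sum>i<m. \<Sum>k<a i. f (Leaf i k))"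
proof -
  have "(\<Sum>x\<in>Mid ` E \<union> (\<lambda>(i, k). Leaf i k) ` (SIGMA i:{..<m}. {..<a i}). f x)
      = (\<Sum>x\<in>Mid ` E. f x) + (\<Sum>x\<in>(\<lambda>(i, k). Leaf i k) ` (SIGMA i:{..<m}. {..<a i}). f x)"
    using E_finite by (intro sum.union_disjoint) auto
  also have "(\<Sum>x\<in>Mid ` E. f x) = (\<Sum>e\<in>E. f (Mid e))"
    by (subst sum.reindex) (auto simp: inj_on_def)
  also have "(\<Sum>x\<in>(\<lambda>(i, k). Leaf i k) ` (SIGMA i:{..<m}. {..<a i}). f x)
      = (\<Sum>(i, k)\<in>(SIGMA i:{..<m}. {..<a i}). f (Leaf i k))"
    by (subst sum.reindex) (auto simp: inj_on_def case_prod_beta)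
  finally show ?thesis by (simp add: sum.Sigma)
qed

lemma card_non_core:
  "card (Mid ` E \<union> (\<lambda>(i, k). Leaf i k) ` (SIGMA i:{..<m}. {..<a i})) = card E + (\<Sum>i<m. a i)"
proof -
  have "real (card (Mid ` E \<union> (\<lambda>(i, k). Leaf i k) ` (SIGMA i:{..<m}. {..<a i})))
      = real (card E + (\<Sum>i<m. a i))"
    using sum_non_core[of "\<lambda>_. 1"] by simp
  thus ?thesis by (simp only: of_nat_eq_iff)
qed

lemma card_verts_H: "card (pverts H) = m + card E + (\<Sum>i<m. a i)"
proof -
  have "card (pverts H) = card (Core ` {..<m}) + (card E + (\<Sum>i<m. a i))"
    unfolding verts_H card_non_core[symmetric] using E_finite by (intro card_Un_disjoint) auto
  also have "card (Core ` {..<m}) = m" by (subst card_image) (auto simp: inj_on_def)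
  finally show ?thesis by simp
qed

end

text \<open>\<open>sub_vertex\<close> carries no order, which \<open>graph_spectral_radius\<close>
  requires, so the graph is studied through a copy G.\<close>

locale subdivision_copy = subdivision +
  fixes G :: "'v::linorder pair_pre_digraph" and g :: "sub_vertex \<Rightarrow> 'v"
  assumes g_inj: "inj_on g (pverts H)" and G_verts: "pverts G = g ` pverts H"
    and G_arcs: "parcs G = map_prod g g ` parcs H"
begin

lemma pair_graph_G: "pair_graph G"
proof -
  have fin: "finite (pverts G)" using finite_H G_verts by simp
  have wf: "parcs G \<subseteq> pverts G \<times> pverts G"
    using wf_H G_arcs G_verts by fastforce
  have loop: "(u, u) \<notin> parcs G" for u
  proof
    assume "(u, u) \<in> parcs G"
    then obtain x y where xy: "(x, y) \<in> parcs H" "g x = g y" by (auto simp: G_arcs)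
    hence "x = y" using g_inj wf_H by (meson SigmaE2 inj_onD subsetD)
    thus False using xy(1) by (auto simp: pendant_subdivision_def sub_edges_def)
  qed
  have "sym (parcs H)" by (auto simp: pendant_subdivision_def sym_def)
  hence "sym (parcs G)" unfolding G_arcs by (fastforce simp: sym_def)
  thus ?thesis
    using fin wf loop finite_subset[OF wf]
    by unfold_locales (auto simp: symmetric_def)
qed

lemma card_G: "card (pverts G) = m + card E + (\<Sum>i<m. a i)"
  using card_verts_H card_image[OF g_inj] G_verts by simp

lemma arcs_G_iff: "x \<in> pverts H \<Longrightarrow> y \<in> pverts H \<Longrightarrow> (g x, g y) \<in> parcs G \<longleftrightarrow> (x, y) \<in> parcs H"
proof
  assume xy: "x \<in> pverts H" "y \<in> pverts H" "(g x, g y) \<in> parcs G"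
  then obtain x' y' where "(x', y') \<in> parcs H" "g x' = g x" "g y' = g y" by (auto simp: G_arcs)
  moreover from this have "x' = x" "y' = y" using xy wf_H g_inj by (auto dest: inj_onD)
  ultimately show "(x, y) \<in> parcs H" by simp
qed (auto simp: G_arcs)

lemma arcs_from_G: "x \<in> pverts H \<Longrightarrow> {u. (g x, u) \<in> parcs G} = g ` {y. (x, y) \<in> parcs H}"
proof -
  assume x: "x \<in> pverts H"
  have "y \<in> pverts H" if "(x, y) \<in> parcs H" for y using wf_H that by auto
  moreover have "\<exists>y\<in>pverts H. u = g y" if "(g x, u) \<in> parcs G" for u
    using that wf_H by (auto simp: G_arcs)
  ultimately show ?thesis using arcs_G_iff[OF x] by (auto simp: image_iff) (metis)+
qed

lemma independent_non_core:
  "independent_set G (g ` (Mid ` E \<union> (\<lambda>(i, k). Leaf i k) ` (SIGMA i:{..<m}. {..<a i})))"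
  (is "independent_set G (g ` ?S)")
proof -
  have sub: "?S \<subseteq> pverts H" unfolding verts_H by blast
  have "(x, y) \<notin> parcs H" if "x \<in> ?S" "y \<in> ?S" for x y
    using that by (auto simp: pendant_subdivision_def sub_edges_def)
  hence "(g x, g y) \<notin> parcs G" if "x \<in> ?S" "y \<in> ?S" for x y
    using that arcs_G_iff[of x y] sub by blast
  thus ?thesis unfolding independent_set_def G_verts
    using image_mono[OF sub, of g] by (auto simp only: ball_simps)
qed

text \<open>The edges from \<open>Core i\<close> to \<open>Leaf i 0\<close> form a matching of size
  m, and an independent set misses an end of each; \<open>h\<close> selects that end. The non-core
  vertices attain the resulting bound.\<close>

lemma independence_number_G:
  assumes pos: "\<And>i. i < m \<Longrightarrow> a i > 0"
  shows "independence_number G = card E + (\<Sum>i<m. a i)"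
proof -
  have finG: "finite (pverts G)" using G_verts finite_H by simp
  let ?S = "Mid ` E \<union> (\<lambda>(i, k). Leaf i k) ` (SIGMA i:{..<m}. {..<a i})"
  have "inj_on g ?S" by (rule inj_on_subset[OF g_inj]) (auto simp: verts_H)
  hence cS: "card (g ` ?S) = card E + (\<Sum>i<m. a i)"
    using card_non_core by (simp add: card_image)
  have upper: "card I \<le> card E + (\<Sum>i<m. a i)" if I: "independent_set G I" for I
  proof -
    have IV: "I \<subseteq> pverts G" using I by (simp add: independent_set_def)
    define h where "h i = (if g (Core i) \<in> I then g (Leaf i 0) else g (Core i))" for i
    have inH: "Core i \<in> pverts H" "Leaf i 0 \<in> pverts H" if "i < m" for i
      using that pos by (auto simp: pendant_subdivision_def)
    have "inj_on h {..<m}"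
    proof (rule inj_onI)
      fix i j assume ij: "i \<in> {..<m}" "j \<in> {..<m}" "h i = h j"
      have "(if g (Core i) \<in> I then Leaf i 0 else Core i) = (if g (Core j) \<in> I then Leaf j 0 else Core j)"
        using ij inH by (intro inj_onD[OF g_inj]) (auto simp: h_def)
      thus "i = j" by (auto split: if_splits)
    qed
    moreover have "h ` {..<m} \<subseteq> pverts G - I"
    proof
      fix v assume "v \<in> h ` {..<m}"
      then obtain i where i: "i < m" "v = h i" by auto
      have "(Core i, Leaf i 0) \<in> parcs H"
        using i pos by (auto simp: pendant_subdivision_def sub_edges_def)
      hence "(g (Core i), g (Leaf i 0)) \<in> parcs G" using arcs_G_iff inH i by blast
      thus "v \<in> pverts G - I"
        using i inH I by (auto simp: h_def G_verts independent_set_def)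
    qed
    ultimately have "m \<le> card (pverts G - I)"
      using card_mono[of "pverts G - I" "h ` {..<m}"] finG by (simp add: card_image)
    thus ?thesis
      using card_G card_Diff_subset[OF finite_subset[OF IV finG] IV] card_mono[OF finG IV] by linarith
  qed
  show ?thesis unfolding independence_number_def
  proof (rule Max_eqI)
    have "{I. independent_set G I} \<subseteq> Pow (pverts G)" by (auto simp: independent_set_def)
    thus "finite (card ` {I. independent_set G I})" using finG finite_subset by blast
    show "card E + (\<Sum>i<m. a i) \<in> card ` {I. independent_set G I}"
      using independent_non_core cS by force
  qed (use upper in auto)
qed

text \<open>The values at \<open>Mid\<close> and \<open>Leaf\<close> vertices are forced by those on
  the core. After their elimination only a system on m vertices is left, and its positive solution z
  extends to a positive eigenvector of G.\<close>

lemma spectral_radius_G: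
  fixes z :: "nat \<Rightarrow> real"
  assumes "m > 0" "\<theta> > 0" and z: "\<And>i. i < m \<Longrightarrow> z i > 0"
    and eig: "\<And>i. i < m \<Longrightarrow> a i * z i + (\<Sum>e | e \<in> E \<and> i \<in> e. \<Sum>j\<in>e. z j) = \<theta>\<^sup>2 * z i"
  shows "graph_spectral_radius G = \<theta>"
proof -
  define f where "f x = (case x of Core i \<Rightarrow> z i | Mid e \<Rightarrow> (\<Sum>j\<in>e. z j) / \<theta> | Leaf i k \<Rightarrow> z i / \<theta>)" for x
  define f' where "f' v = f (the_inv_into (pverts H) g v)" for v
  have f': "f' (g x) = f x" if "x \<in> pverts H" for x
    using that g_inj by (simp add: f'_def the_inv_into_f_f)
  have fpos: "f x > 0" if "x \<in> pverts H" for x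
  proof (cases x)
    case (Mid e)
    hence e: "e \<in> E" using that by (auto simp: verts_H)
    have "finite e" using E_subset[OF e] finite_subset by blast
    thus ?thesis using Mid e E_subset E_nonempty z \<open>\<theta> > 0\<close>
      by (auto simp: f_def intro!: divide_pos_pos sum_pos) 
  qed (use that z \<open>\<theta> > 0\<close> in \<open>auto simp: f_def verts_H\<close>)
  have feig: "(\<Sum>y | (x, y) \<in> parcs H. f y) = \<theta> * f x" if "x \<in> pverts H" for x
  proof (cases x)
    case (Mid e)
    hence e: "e \<in> E" using that by (auto simp: verts_H)
    show ?thesis unfolding Mid arcs_from_Mid[OF e] using \<open>\<theta> > 0\<close>
      by (subst sum.reindex) (auto simp: inj_on_def f_def)
  next
    case (Leaf i k)
    hence "i < m" "k < a i" using that by (auto simp: verts_H)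
    thus ?thesis unfolding Leaf using \<open>\<theta> > 0\<close> by (simp add: arcs_from_Leaf f_def)
  next
    case (Core i)
    hence i: "i < m" using that by (auto simp: verts_H)
    have "(\<Sum>y\<in>Mid ` {e\<in>E. i \<in> e} \<union> Leaf i ` {..<a i}. f y)
        = (\<Sum>y\<in>Mid ` {e\<in>E. i \<in> e}. f y) + (\<Sum>y\<in>Leaf i ` {..<a i}. f y)"
      using E_finite by (intro sum.union_disjoint) auto
    also have "(\<Sum>y\<in>Mid ` {e\<in>E. i \<in> e}. f y) = (\<Sum>e | e \<in> E \<and> i \<in> e. \<Sum>j\<in>e. z j) / \<theta>"
      by (subst sum.reindex) (auto simp: inj_on_def f_def sum_divide_distrib)
    also have "(\<Sum>y\<in>Leaf i ` {..<a i}. f y) = a i * z i / \<theta>"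
      by (subst sum.reindex) (auto simp: inj_on_def f_def)
    finally show ?thesis unfolding Core arcs_from_Core[OF i]
      using eig[OF i] \<open>\<theta> > 0\<close> by (simp add: f_def field_simps power2_eq_square)
  qed
  show ?thesis
  proof (rule spectral_radius_eqI[of G f'])
    show "finite (pverts G)" using G_verts finite_H by simp
    show "pverts G \<noteq> {}" using G_verts \<open>m > 0\<close> by (auto simp: verts_H)
    fix v assume "v \<in> pverts G"
    then obtain x where x: "x \<in> pverts H" "v = g x" using G_verts by auto
    show "f' v > 0" using x fpos f' by simp
    have sub: "{y. (x, y) \<in> parcs H} \<subseteq> pverts H" using wf_H by auto
    have "{u. u \<in> pverts G \<and> (v, u) \<in> parcs G} = {u. (v, u) \<in> parcs G}"
      using is_copy_wf[OF wf_H is_copyI[OF g_inj G_verts G_arcs]] by auto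
    also have "\<dots> = g ` {y. (x, y) \<in> parcs H}" using arcs_from_G x by simp
    finally have "(\<Sum>u | u \<in> pverts G \<and> (v, u) \<in> parcs G. f' u) = (\<Sum>y | (x, y) \<in> parcs H. f' (g y))"
      using inj_on_subset[OF g_inj sub] by (simp add: sum.reindex)
    also have "\<dots> = (\<Sum>y | (x, y) \<in> parcs H. f y)"
      using sub f' by (intro sum.cong) auto
    also have "\<dots> = \<theta> * f' v" using feig x f' by simp
    finally show "(\<Sum>u | u \<in> pverts G \<and> (v, u) \<in> parcs G. f' u) = \<theta> * f' v" .
  qed
qed

text \<open>This is \<open>test_vector_bound\<close> with the non-core vertices as independent set:
  a midpoint sees the ends of its edge, a pendant vertex only its neighbour, and no arc joins two
  core vertices.\<close>

lemma quadratic_form_bound: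
  fixes z :: "nat \<Rightarrow> real"
  assumes "m > 0" and \<theta>: "\<theta> > 0" "graph_spectral_radius G \<le> \<theta>"
  shows "(\<Sum>e\<in>E. (\<Sum>j\<in>e. z j)\<^sup>2) + (\<Sum>i<m. a i * (z i)\<^sup>2) \<le> \<theta>\<^sup>2 * (\<Sum>i<m. (z i)\<^sup>2)"
proof -
  let ?S = "Mid ` E \<union> (\<lambda>(i, k). Leaf i k) ` (SIGMA i:{..<m}. {..<a i})"
  define y where "y v = (case the_inv_into (pverts H) g v of Core i \<Rightarrow> z i | _ \<Rightarrow> 0)" for v
  have y: "y (g (Core i)) = z i" if "i < m" for i
    using that g_inj by (simp add: y_def the_inv_into_f_f verts_H)
  have injS: "inj_on g ?S" by (rule inj_on_subset[OF g_inj]) (auto simp: verts_H)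
  have injC: "inj_on (\<lambda>i. g (Core i)) {..<m}"
    using inj_on_subset[OF g_inj, of "Core ` {..<m}"] by (auto simp: verts_H inj_on_def)
  have "Core ` {..<m} = pverts H - ?S" unfolding verts_H by auto
  hence C: "(\<lambda>i. g (Core i)) ` {..<m} = pverts G - g ` ?S"
    unfolding G_verts using inj_on_image_set_diff[OF g_inj, of "pverts H" ?S]
    by (auto simp: image_image[symmetric] verts_H)
  have "(\<Sum>s\<in>g ` ?S. (\<Sum>c | (s, c) \<in> parcs G. y c)\<^sup>2)
      = (\<Sum>x\<in>?S. (\<Sum>c | (g x, c) \<in> parcs G. y c)\<^sup>2)"
    using injS by (simp add: sum.reindex)
  also have "\<dots> = (\<Sum>e\<in>E. (\<Sum>c | (g (Mid e), c) \<in> parcs G. y c)\<^sup>2)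
      + (\<Sum>i<m. \<Sum>k<a i. (\<Sum>c | (g (Leaf i k), c) \<in> parcs G. y c)\<^sup>2)"
    by (rule sum_non_core)
  also have "(\<Sum>e\<in>E. (\<Sum>c | (g (Mid e), c) \<in> parcs G. y c)\<^sup>2) = (\<Sum>e\<in>E. (\<Sum>j\<in>e. z j)\<^sup>2)"
  proof (rule sum.cong[OF refl])
    fix e assume e: "e \<in> E"
    hence "{c. (g (Mid e), c) \<in> parcs G} = (\<lambda>i. g (Core i)) ` e"
      by (simp add: arcs_from_G arcs_from_Mid verts_H image_image)
    hence "(\<Sum>c | (g (Mid e), c) \<in> parcs G. y c) = (\<Sum>j\<in>e. y (g (Core j)))"
      using inj_on_subset[OF injC E_subset[OF e]] by (simp add: sum.reindex)
    also have "\<dots> = (\<Sum>j\<in>e. z j)" using E_subset[OF e] y by (intro sum.cong) auto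
    finally show "(\<Sum>c | (g (Mid e), c) \<in> parcs G. y c)\<^sup>2 = (\<Sum>j\<in>e. z j)\<^sup>2" by simp
  qed
  also have "(\<Sum>i<m. \<Sum>k<a i. (\<Sum>c | (g (Leaf i k), c) \<in> parcs G. y c)\<^sup>2) = (\<Sum>i<m. a i * (z i)\<^sup>2)"
  proof (rule sum.cong[OF refl])
    fix i assume i: "i \<in> {..<m}"
    have "(\<Sum>c | (g (Leaf i k), c) \<in> parcs G. y c) = z i" if "k < a i" for k
    proof -
      have "Leaf i k \<in> pverts H" using i that by (auto simp: verts_H)
      hence "{c. (g (Leaf i k), c) \<in> parcs G} = {g (Core i)}"
        using i that by (simp add: arcs_from_G arcs_from_Leaf)
      thus ?thesis using y i by simp
    qed
    thus "(\<Sum>k<a i. (\<Sum>c | (g (Leaf i k), c) \<in> parcs G. y c)\<^sup>2) = a i * (z i)\<^sup>2" by simp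
  qed
  finally have lhs: "(\<Sum>s\<in>g ` ?S. (\<Sum>c | (s, c) \<in> parcs G. y c)\<^sup>2)
      = (\<Sum>e\<in>E. (\<Sum>j\<in>e. z j)\<^sup>2) + (\<Sum>i<m. a i * (z i)\<^sup>2)" .
  have noC: "parcs G \<inter> (\<lambda>i. g (Core i)) ` {..<m} \<times> (\<lambda>i. g (Core i)) ` {..<m} = {}"
  proof -
    have "(g (Core i), g (Core j)) \<notin> parcs G" if "i < m" "j < m" for i j
      using arcs_G_iff[of "Core i" "Core j"] that by (auto simp: pendant_subdivision_def sub_edges_def)
    thus ?thesis by auto
  qed
  have "(\<Sum>c\<in>(\<lambda>i. g (Core i)) ` {..<m}. (y c)\<^sup>2) = (\<Sum>i<m. (z i)\<^sup>2)"
    using injC y by (simp add: sum.reindex)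
  moreover have "(\<lambda>i. g (Core i)) ` {..<m} \<noteq> {}" using \<open>m > 0\<close> by auto
  ultimately show ?thesis
    using test_vector_bound[OF pair_graph_G independent_non_core C _ \<theta>, of y] unfolding lhs noC by simp
qed

end

lemma subdivision_tree_edges:
  assumes "parent_list ps" "length ps = m - 1" "m > 0"
  shows "subdivision m (tree_edges ps)"
proof
  show "finite (tree_edges ps)" by (simp add: tree_edges_def)
  show "e \<subseteq> {..<m}" if "e \<in> tree_edges ps" for e
    using tree_edges_subset[OF assms(1) that] assms by simp
  show "e \<noteq> {}" if "e \<in> tree_edges ps" for e using that by (auto simp: tree_edges_def)
qed

lemma card_tree_edges: "parent_list ps \<Longrightarrow> card (tree_edges ps) = length ps"
  unfolding tree_edges_def by (simp add: card_image tree_edges_inj)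

text \<open>Each core vertex is reached from its parent through the midpoint of their edge, hence
  from vertex 0; every other vertex is next to the core.\<close>

lemma connected_copy_tree:
  fixes G :: "'v::linorder pair_pre_digraph"
  assumes ps: "parent_list ps" "length ps = m - 1" "m > 0"
    and c: "is_copy (pendant_subdivision m (tree_edges ps) a) G"
  shows "Digraph_Component.connected (with_proj G)"
proof -
  let ?H = "pendant_subdivision m (tree_edges ps) a"
  interpret sd: subdivision m "tree_edges ps" a by (rule subdivision_tree_edges[OF ps])
  obtain g where g: "inj_on g (pverts ?H)" "pverts G = g ` pverts ?H" "parcs G = map_prod g g ` parcs ?H"
    using c by (rule is_copyE)
  have symH: "(y, x) \<in> parcs ?H" if "(x, y) \<in> parcs ?H" for x y
    using that by (auto simp: pendant_subdivision_def)
  have core: "(Core 0, Core i) \<in> (parcs ?H)\<^sup>*" if "i < m" for i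
    using that
  proof (induction i rule: less_induct)
    case (less i)
    show ?case
    proof (cases i)
      case (Suc j)
      have "j < length ps" using less.prems Suc ps by simp
      hence p: "ps ! j < i" "{ps ! j, i} \<in> tree_edges ps"
        using ps(1) Suc by (auto simp: parent_list_def tree_edges_def less_Suc_eq_le)
      hence "(Core (ps ! j), Mid {ps ! j, i}) \<in> parcs ?H" "(Mid {ps ! j, i}, Core i) \<in> parcs ?H"
        by (auto simp: pendant_subdivision_def sub_edges_def)
      moreover have "(Core 0, Core (ps ! j)) \<in> (parcs ?H)\<^sup>*" using less.IH[of "ps ! j"] less.prems p by simp
      ultimately show ?thesis by (meson rtrancl.rtrancl_into_rtrancl)
    qed simp
  qed
  have reach: "(Core 0, x) \<in> (parcs ?H)\<^sup>*" if "x \<in> pverts ?H" for x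
  proof (cases x)
    case (Core i)
    thus ?thesis using that core by (auto simp: sd.verts_H)
  next
    case (Mid e)
    hence e: "e \<in> tree_edges ps" using that by (auto simp: sd.verts_H)
    then obtain i where i: "i \<in> e" "i < m" using sd.E_nonempty sd.E_subset by fastforce
    hence "(Core i, x) \<in> parcs ?H" using e Mid by (auto simp: pendant_subdivision_def sub_edges_def)
    thus ?thesis using core[OF i(2)] by (rule rtrancl_into_rtrancl[rotated])
  next
    case (Leaf i k)
    hence "i < m" "(Core i, x) \<in> parcs ?H" using that by (auto simp: pendant_subdivision_def sub_edges_def)
    thus ?thesis using core by (meson rtrancl.rtrancl_into_rtrancl)
  qed
  have reachG: "(g (Core 0), v) \<in> (parcs G)\<^sup>*" if v: "v \<in> pverts G" for v
  proof -
    obtain x where x: "x \<in> pverts ?H" "v = g x" using v g(2) by auto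
    have "(g (Core 0), g y) \<in> (parcs G)\<^sup>*" if "(Core 0, y) \<in> (parcs ?H)\<^sup>*" for y
      using that
    proof induction
      case (step y w)
      have "(g y, g w) \<in> parcs G" using step(2) g(3) by force
      thus ?case using step.IH by (rule rtrancl_into_rtrancl[rotated])
    qed simp
    thus ?thesis using reach x by blast
  qed
  have symG: "sym (parcs G)" unfolding g(3) by (rule symI) (use symH in force)
  have wfG: "parcs G \<subseteq> pverts G \<times> pverts G" by (rule is_copy_wf[OF sd.wf_H c])
  have symcl: "(parcs G)\<^sup>s = parcs G" using symG by (auto simp: symcl_def sym_def)
  show ?thesis unfolding connected_conv
  proof (intro conjI ballI)
    show "verts (with_proj G) \<noteq> {}" using g(2) ps(3) by (auto simp: sd.verts_H)
    fix u v assume uv: "u \<in> verts (with_proj G)" "v \<in> verts (with_proj G)"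
    have "(u, g (Core 0)) \<in> (parcs G)\<^sup>*"
      using reachG[of u] uv sym_rtrancl[OF symG] by (auto elim: symE)
    hence "(u, v) \<in> (parcs G)\<^sup>*" using reachG[of v] uv by (auto intro: rtrancl_trans)
    hence "(u, v) \<in> rtrancl_on (pverts G) (parcs G)"
      using uv wfG by (intro rtrancl_consistent_rtrancl_on) auto
    thus "(u, v) \<in> rtrancl_on (verts (with_proj G)) ((arcs_ends (with_proj G))\<^sup>s)"
      by (simp add: symcl)
  qed
qed

text \<open>Used twice: to pass to a representative of the shape of a tree, and to apply a symmetry
  of that representative to the numbers of pendant vertices.\<close>

lemma relabel_copy:
  assumes E: "\<And>e. e \<in> E \<Longrightarrow> e \<subseteq> {..<m}" and \<sigma>: "bij_betw \<sigma> {..<m} {..<m}"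
    and c: "is_copy (pendant_subdivision m E a) G"
    and E': "E' = (`) \<sigma> ` E" and a': "\<And>i. i < m \<Longrightarrow> a' (\<sigma> i) = a i"
  shows "is_copy (pendant_subdivision m E' a') G"
proof -
  let ?H = "pendant_subdivision m E a" and ?H' = "pendant_subdivision m E' a'"
  define f where "f x = (case x of Core i \<Rightarrow> Core (\<sigma> i) | Mid e \<Rightarrow> Mid (\<sigma> ` e) | Leaf i k \<Rightarrow> Leaf (\<sigma> i) k)" for x
  have inj: "inj_on \<sigma> {..<m}" and img: "\<sigma> ` {..<m} = {..<m}" using \<sigma> by (auto simp: bij_betw_def)
  have \<sigma>m: "\<sigma> i < m" if "i < m" for i using img that by auto
  have ex: "\<exists>j<m. i = \<sigma> j" if "i < m" for i using img that by (metis imageE lessThan_iff)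
  have wf: "parcs ?H \<subseteq> pverts ?H \<times> pverts ?H"
    using E by (fastforce simp: pendant_subdivision_def sub_edges_def)
  have "inj_on f (pverts ?H)"
    using inj inj_on_image_eq_iff[OF inj E E]
    by (auto simp: inj_on_def[of f] inj_on_eq_iff f_def pendant_subdivision_def)
  moreover have "pverts ?H' = f ` pverts ?H"
  proof
    show "f ` pverts ?H \<subseteq> pverts ?H'"
      using \<sigma>m a' by (auto simp: f_def pendant_subdivision_def E')
    show "pverts ?H' \<subseteq> f ` pverts ?H"
    proof
      fix x assume x: "x \<in> pverts ?H'"
      show "x \<in> f ` pverts ?H"
      proof (cases x)
        case (Core i)
        then obtain j where "j < m" "x = f (Core j)" using x ex[of i] by (auto simp: pendant_subdivision_def f_def)
        thus ?thesis by (auto simp: pendant_subdivision_def)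
      next
        case (Mid e)
        then obtain e' where "e' \<in> E" "x = f (Mid e')" using x by (auto simp: pendant_subdivision_def f_def E')
        thus ?thesis by (auto simp: pendant_subdivision_def)
      next
        case (Leaf i k)
        then obtain j where j: "j < m" "i = \<sigma> j" "k < a' i" using x ex[of i] by (auto simp: pendant_subdivision_def)
        hence "x = f (Leaf j k)" "k < a j" using Leaf a' by (auto simp: f_def)
        thus ?thesis using j by (auto simp: pendant_subdivision_def)
      qed
    qed
  qed
  moreover have "sub_edges m E' a' = map_prod f f ` sub_edges m E a"
  proof
    show "map_prod f f ` sub_edges m E a \<subseteq> sub_edges m E' a'"
      using \<sigma>m a' by (auto simp: f_def sub_edges_def E')
    show "sub_edges m E' a' \<subseteq> map_prod f f ` sub_edges m E a"
    proof
      fix x assume "x \<in> sub_edges m E' a'"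
      then consider (1) i e where "e \<in> E" "i \<in> e" "x = (Core (\<sigma> i), Mid (\<sigma> ` e))"
        | (2) i k where "i < m" "k < a' i" "x = (Core i, Leaf i k)"
        by (auto simp: sub_edges_def E')
      thus "x \<in> map_prod f f ` sub_edges m E a"
      proof cases
        case 1
        hence "x = map_prod f f (Core i, Mid e)" "(Core i, Mid e) \<in> sub_edges m E a"
          by (auto simp: f_def sub_edges_def)
        thus ?thesis by blast
      next
        case 2
        then obtain j where j: "j < m" "i = \<sigma> j" using ex by blast
        hence "x = map_prod f f (Core j, Leaf j k)" "(Core j, Leaf j k) \<in> sub_edges m E a"
          using 2 a' by (auto simp: f_def sub_edges_def)
        thus ?thesis by blast
      qed
    qed
  qed
  hence "parcs ?H' = map_prod f f ` parcs ?H"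
    by (auto simp: pendant_subdivision_def)
  ultimately have "is_copy ?H ?H'" by (rule is_copyI)
  from is_copy_trans[OF is_copy_sym[OF wf this] c] show ?thesis .
qed

subsection \<open>Trees on six vertices\<close>

lemma tree_edges_append: "tree_edges (ps @ [p]) = insert {p, Suc (length ps)} (tree_edges ps)"
proof -
  have "tree_edges (ps @ [p]) = (\<lambda>i. {(ps @ [p]) ! i, Suc i}) ` insert (length ps) {..<length ps}"
    unfolding tree_edges_def by (simp add: lessThan_Suc)
  also have "\<dots> = insert {p, Suc (length ps)} (tree_edges ps)"
    by (simp add: tree_edges_def nth_append)
  finally show ?thesis .
qed

lemma parent_list_append: "parent_list (ps @ [p]) \<longleftrightarrow> parent_list ps \<and> p \<le> length ps"
  by (auto simp: parent_list_def nth_append less_Suc_eq)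

definition same_shape :: "nat list \<Rightarrow> nat list \<Rightarrow> bool" where
  "same_shape ps qs \<longleftrightarrow> length ps = length qs \<and>
     (\<exists>\<sigma>. bij_betw \<sigma> {..length ps} {..length ps} \<and> (`) \<sigma> ` tree_edges ps = tree_edges qs)"

lemma same_shape_trans:
  assumes "same_shape ps qs" "same_shape qs rs"
  shows "same_shape ps rs"
proof -
  obtain \<sigma> where \<sigma>: "length ps = length qs" "bij_betw \<sigma> {..length ps} {..length ps}"
    "(`) \<sigma> ` tree_edges ps = tree_edges qs"
    using assms(1) unfolding same_shape_def by blast
  obtain \<tau> where \<tau>: "length qs = length rs" "bij_betw \<tau> {..length qs} {..length qs}"
    "(`) \<tau> ` tree_edges qs = tree_edges rs"
    using assms(2) unfolding same_shape_def by blast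
  have "bij_betw (\<tau> \<circ> \<sigma>) {..length ps} {..length ps}"
    using \<sigma>(2) \<tau>(2) unfolding \<sigma>(1) by (rule bij_betw_trans)
  moreover have "(`) (\<tau> \<circ> \<sigma>) ` tree_edges ps = tree_edges rs"
    unfolding \<tau>(3)[symmetric] \<sigma>(3)[symmetric] by (simp add: image_image)
  ultimately show ?thesis
    using \<sigma>(1) \<tau>(1) unfolding same_shape_def by (intro conjI exI[of _ "\<tau> \<circ> \<sigma>"]) simp_all
qed

text \<open>Extending the relabelling by fixing the new vertex sends a leaf at p to a leaf at the
  image of p. So only one-leaf extensions of representatives have to be classified.\<close>

lemma same_shape_append:
  assumes shape: "same_shape ps qs" and ps: "parent_list ps" and p: "p \<le> length ps"
  shows "\<exists>q\<le>length qs. same_shape (ps @ [p]) (qs @ [q])"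
proof -
  obtain \<sigma> where len: "length ps = length qs" and bij: "bij_betw \<sigma> {..length ps} {..length ps}"
    and img: "(`) \<sigma> ` tree_edges ps = tree_edges qs"
    using shape unfolding same_shape_def by auto
  define \<tau> where "\<tau> = \<sigma>(Suc (length ps) := Suc (length ps))"
  have on: "\<tau> i = \<sigma> i" if "i \<le> length ps" for i using that by (simp add: \<tau>_def)
  have "bij_betw \<tau> {..length ps} {..length ps}"
    using bij on by (subst bij_betw_cong[of _ _ \<sigma>]) auto
  hence "bij_betw \<tau> (insert (Suc (length ps)) {..length ps}) (insert (Suc (length ps)) {..length ps})"
    using notIn_Un_bij_betw[of "Suc (length ps)" "{..length ps}" \<tau> "{..length ps}"] by (simp add: \<tau>_def)
  hence bij': "bij_betw \<tau> {..Suc (length ps)} {..Suc (length ps)}" by (simp add: atMost_Suc)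
  have "\<tau> ` e = \<sigma> ` e" if "e \<in> tree_edges ps" for e
    using tree_edges_subset[OF ps that] on by (intro image_cong refl) (auto simp: less_Suc_eq_le)
  hence "(`) \<tau> ` tree_edges ps = tree_edges qs" unfolding img[symmetric] by (rule image_cong[OF refl])
  moreover have "\<tau> ` {p, Suc (length ps)} = {\<sigma> p, Suc (length qs)}" using on p len by (auto simp: \<tau>_def)
  ultimately have "(`) \<tau> ` tree_edges (ps @ [p]) = tree_edges (qs @ [\<sigma> p])"
    unfolding tree_edges_append by simp
  moreover have "\<sigma> p \<le> length qs" using bij p len by (auto simp: bij_betw_def)
  ultimately show ?thesis using bij' len unfolding same_shape_def by auto
qed

text \<open>Executable witness for \<open>same_shape\<close>: the permutation is the list s, and
  edges are compared as ordered pairs of minimum and maximum instead of sets.\<close>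

definition relabels :: "nat list \<Rightarrow> nat list \<Rightarrow> nat list \<Rightarrow> bool" where
  "relabels s ps qs \<longleftrightarrow> length ps = length qs \<and> length s = Suc (length ps) \<and> distinct s \<and>
     list_all (\<lambda>i. i \<le> length ps) s \<and>
     set (map (\<lambda>i. (min (s ! (ps ! i)) (s ! Suc i), max (s ! (ps ! i)) (s ! Suc i))) [0..<length ps])
       = set (map (\<lambda>i. (min (qs ! i) (Suc i), max (qs ! i) (Suc i))) [0..<length qs])"

lemma relabels_bij:
  assumes "relabels s ps qs"
  shows "bij_betw ((!) s) {..<Suc (length ps)} {..<Suc (length ps)}"
proof -
  have "distinct s" "length s = Suc (length ps)" "set s \<subseteq> {..<Suc (length ps)}"
    using assms by (auto simp: relabels_def list_all_iff less_Suc_eq_le)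
  moreover from this have "set s = {..<Suc (length ps)}"
    by (intro card_subset_eq) (auto simp: distinct_card)
  ultimately show ?thesis using bij_betw_nth[of s "{..<Suc (length ps)}" "set s"] by simp
qed

lemma relabels_tree_edges:
  assumes "relabels s ps qs"
  shows "(`) ((!) s) ` tree_edges ps = tree_edges qs"
proof -
  define f :: "nat \<times> nat \<Rightarrow> nat set" where "f = (\<lambda>(x, y). {x, y})"
  have f: "f (min x y, max x y) = {x, y}" for x y :: nat by (auto simp: f_def min_def max_def)
  have "f ` set (map (\<lambda>i. (min (s ! (ps ! i)) (s ! Suc i), max (s ! (ps ! i)) (s ! Suc i))) [0..<length ps])
      = f ` set (map (\<lambda>i. (min (qs ! i) (Suc i), max (qs ! i) (Suc i))) [0..<length qs])"
    using assms unfolding relabels_def by metis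
  thus ?thesis
    by (simp add: image_image f tree_edges_def lessThan_atLeast0)
qed

lemma relabels_same_shape: "relabels s ps qs \<Longrightarrow> same_shape ps qs"
  unfolding same_shape_def using relabels_bij relabels_tree_edges
  by (metis lessThan_Suc_atMost relabels_def)

text \<open>The subdivisions of these trees are \<open>F6_1\<close> to \<open>F6_6\<close> in this
  order, and tree vertex i becomes the i-th marked vertex, counted from 0.\<close>

definition six_vertex_trees :: "nat list list" where
  "six_vertex_trees = [[0, 1, 1, 1, 1], [0, 1, 2, 1, 1], [0, 1, 2, 1, 2], [0, 1, 2, 3, 1], [0, 1, 2, 3, 2], [0, 1, 2, 3, 4]]"

text \<open>Without its last leaf, ps has the shape of some member of Q. The list W gives, for each
  one-leaf extension of a member of Q, a member of R and a relabelling onto it.\<close>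

lemma shapes_step:
  assumes IH: "\<And>ps. length ps = k \<Longrightarrow> parent_list ps \<Longrightarrow> \<exists>qs\<in>set Q. same_shape ps qs"
    and W: "list_all2 (\<lambda>qs (rs, s). rs \<in> set R \<and> relabels s qs rs)
      (concat (map (\<lambda>qs. map (\<lambda>j. qs @ [j]) [0..<Suc k]) Q)) W"
    and ps: "length ps = Suc k" "parent_list ps"
  shows "\<exists>rs\<in>set R. same_shape ps rs"
proof -
  obtain ps' p where ps': "ps = ps' @ [p]" using ps(1) by (cases ps rule: rev_cases) auto
  hence len: "length ps' = k" and par: "parent_list ps'" "p \<le> length ps'"
    using ps parent_list_append by auto
  obtain qs where qs: "qs \<in> set Q" "same_shape ps' qs" using IH[OF len par(1)] by blast
  have "length qs = k" using qs(2) len by (simp add: same_shape_def)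
  then obtain q where q: "q \<le> k" "same_shape ps (qs @ [q])"
    using same_shape_append[OF qs(2) par] ps' by auto
  have "qs @ [q] \<in> set (concat (map (\<lambda>qs. map (\<lambda>j. qs @ [j]) [0..<Suc k]) Q))"
    using qs(1) q(1) by (auto simp del: upt_Suc intro!: bexI[of _ qs])
  then obtain i where "i < length (concat (map (\<lambda>qs. map (\<lambda>j. qs @ [j]) [0..<Suc k]) Q))"
    "concat (map (\<lambda>qs. map (\<lambda>j. qs @ [j]) [0..<Suc k]) Q) ! i = qs @ [q]"
    unfolding in_set_conv_nth by blast
  hence "case W ! i of (rs, s) \<Rightarrow> rs \<in> set R \<and> relabels s (qs @ [q]) rs"
    using list_all2_nthD[OF W, of i] by (simp only:)
  then obtain rs s where "rs \<in> set R" "relabels s (qs @ [q]) rs" by (elim case_prodE conjE)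
  thus ?thesis using q(2) relabels_same_shape same_shape_trans by blast
qed

text \<open>Start of the classification; the numbers of trees with 2, ..., 6 vertices are 1, 1, 2,
  3, 6.\<close>

lemma shapes_one: "length ps = 1 \<Longrightarrow> parent_list ps \<Longrightarrow> \<exists>qs\<in>set [[0]]. same_shape ps qs"
proof -
  assume "length ps = 1" "parent_list ps"
  hence "ps = [0]" by (cases ps) (auto simp: parent_list_def)
  moreover have "same_shape [0] [0]" unfolding same_shape_def by (intro conjI exI[of _ id]) auto
  ultimately show ?thesis by simp
qed

lemma shapes_two:
  assumes "length ps = 2" "parent_list ps"
  shows "\<exists>qs\<in>set [[0, 1]]. same_shape ps qs"
proof (rule shapes_step[OF shapes_one])
  show "list_all2 (\<lambda>qs (rs, s). rs \<in> set [[0, 1]] \<and> relabels s qs rs)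
     (concat (map (\<lambda>qs. map (\<lambda>j. qs @ [j]) [0..<Suc 1]) [[0]]))
     [([0, 1], [1, 0, 2]), ([0, 1], [0, 1, 2])]"
    by code_simp
qed (use assms in simp_all)

lemma shapes_three:
  assumes "length ps = 3" "parent_list ps"
  shows "\<exists>qs\<in>set [[0, 1, 1], [0, 1, 2]]. same_shape ps qs"
proof (rule shapes_step[OF shapes_two])
  show "list_all2 (\<lambda>qs (rs, s). rs \<in> set [[0, 1, 1], [0, 1, 2]] \<and> relabels s qs rs)
     (concat (map (\<lambda>qs. map (\<lambda>j. qs @ [j]) [0..<Suc 2]) [[0, 1]]))
     [([0, 1, 2], [1, 2, 3, 0]), ([0, 1, 1], [0, 1, 2, 3]), ([0, 1, 2], [0, 1, 2, 3])]"
    by code_simp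
qed (use assms in simp_all)

lemma shapes_four:
  assumes "length ps = 4" "parent_list ps"
  shows "\<exists>qs\<in>set [[0, 1, 1, 1], [0, 1, 2, 1], [0, 1, 2, 3]]. same_shape ps qs"
proof (rule shapes_step[OF shapes_three])
  show "list_all2 (\<lambda>qs (rs, s). rs \<in> set [[0, 1, 1, 1], [0, 1, 2, 1], [0, 1, 2, 3]] \<and> relabels s qs rs)
     (concat (map (\<lambda>qs. map (\<lambda>j. qs @ [j]) [0..<Suc 3]) [[0, 1, 1], [0, 1, 2]]))
     [([0, 1, 2, 1], [2, 1, 0, 4, 3]), ([0, 1, 1, 1], [0, 1, 2, 3, 4]),
       ([0, 1, 2, 1], [0, 1, 2, 4, 3]), ([0, 1, 2, 1], [0, 1, 4, 2, 3]),
       ([0, 1, 2, 3], [1, 2, 3, 4, 0]), ([0, 1, 2, 1], [0, 1, 2, 3, 4]),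
       ([0, 1, 2, 1], [3, 2, 1, 0, 4]), ([0, 1, 2, 3], [0, 1, 2, 3, 4])]"
    by code_simp
qed (use assms in simp_all)

lemma shapes_five:
  assumes "length ps = 5" "parent_list ps"
  shows "\<exists>qs\<in>set six_vertex_trees. same_shape ps qs"
proof (rule shapes_step[OF shapes_four])
  show "list_all2 (\<lambda>qs (rs, s). rs \<in> set six_vertex_trees \<and> relabels s qs rs)
     (concat (map (\<lambda>qs. map (\<lambda>j. qs @ [j]) [0..<Suc 4]) [[0, 1, 1, 1], [0, 1, 2, 1], [0, 1, 2, 3]]))
     [([0, 1, 2, 1, 1], [2, 1, 0, 4, 5, 3]), ([0, 1, 1, 1, 1], [0, 1, 2, 3, 4, 5]),
       ([0, 1, 2, 1, 1], [0, 1, 2, 4, 5, 3]), ([0, 1, 2, 1, 1], [0, 1, 4, 2, 5, 3]),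
       ([0, 1, 2, 1, 1], [0, 1, 4, 5, 2, 3]), ([0, 1, 2, 3, 2], [1, 2, 3, 4, 5, 0]),
       ([0, 1, 2, 1, 1], [0, 1, 2, 3, 4, 5]), ([0, 1, 2, 1, 2], [0, 1, 2, 3, 4, 5]),
       ([0, 1, 2, 3, 1], [0, 1, 2, 3, 5, 4]), ([0, 1, 2, 3, 2], [5, 2, 1, 0, 3, 4]),
       ([0, 1, 2, 3, 4], [1, 2, 3, 4, 5, 0]), ([0, 1, 2, 3, 1], [0, 1, 2, 3, 4, 5]),
       ([0, 1, 2, 3, 2], [0, 1, 2, 3, 4, 5]), ([0, 1, 2, 3, 1], [4, 3, 2, 1, 0, 5]),
       ([0, 1, 2, 3, 4], [0, 1, 2, 3, 4, 5])]"
    by code_simp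
qed (use assms in simp_all)

subsection \<open>Quadratic forms on trees\<close>

text \<open>In matrix terms, \<open>diag w\<close> minus the adjacency matrix of the tree is
  positive semidefinite.\<close>

definition dominates_tree :: "nat list \<Rightarrow> (nat \<Rightarrow> real) \<Rightarrow> bool" where
  "dominates_tree ps w \<longleftrightarrow>
     (\<forall>y. 2 * (\<Sum>i<length ps. y (ps ! i) * y (Suc i)) \<le> (\<Sum>i\<le>length ps. w i * (y i)\<^sup>2))"

text \<open>A diagonal entry of a positive semidefinite matrix, tested with the unit vector at
  i.\<close>

lemma dominates_tree_nonneg:
  assumes ps: "parent_list ps" and dom: "dominates_tree ps w" and i: "i \<le> length ps"
  shows "w i \<ge> 0"
proof -
  define y where "y j = (if j = i then 1 else 0 :: real)" for j
  have "2 * (\<Sum>j<length ps. y (ps ! j) * y (Suc j)) \<le> (\<Sum>j\<le>length ps. w j * (y j)\<^sup>2)"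
    using dom by (simp add: dominates_tree_def)
  moreover have "y (ps ! j) * y (Suc j) = 0" if "j < length ps" for j
  proof -
    have "ps ! j \<le> j" using ps that by (simp add: parent_list_def)
    thus ?thesis by (simp add: y_def)
  qed
  moreover have "(\<Sum>j\<le>length ps. w j * (y j)\<^sup>2) = (\<Sum>j\<le>length ps. if j = i then w i else 0)"
    by (intro sum.cong) (auto simp: y_def)
  ultimately show ?thesis using i by simp
qed

lemma dominates_tree_mono:
  assumes "dominates_tree ps w" "\<And>i. i \<le> length ps \<Longrightarrow> w i \<le> w' i"
  shows "dominates_tree ps w'"
  unfolding dominates_tree_def
proof
  fix y :: "nat \<Rightarrow> real"
  have "2 * (\<Sum>i<length ps. y (ps ! i) * y (Suc i)) \<le> (\<Sum>i\<le>length ps. w i * (y i)\<^sup>2)"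
    using assms(1) by (simp add: dominates_tree_def)
  also have "\<dots> \<le> (\<Sum>i\<le>length ps. w' i * (y i)\<^sup>2)"
    using assms(2) by (intro sum_mono mult_right_mono) auto
  finally show "2 * (\<Sum>i<length ps. y (ps ! i) * y (Suc i)) \<le> (\<Sum>i\<le>length ps. w' i * (y i)\<^sup>2)" .
qed

text \<open>Gaussian elimination of the last vertex, which is a leaf.\<close>

lemma dominates_tree_append:
  assumes par: "parent_list (ps @ [p])" and dom: "dominates_tree (ps @ [p]) w"
  defines "l \<equiv> Suc (length ps)"
  shows "w l > 0" and "dominates_tree ps (w(p := w p - 1 / w l))"
proof -
  have p: "p \<le> length ps" and ps: "parent_list ps" using par by (auto simp: parent_list_append)
  have dom': "2 * (\<Sum>i<length ps. y (ps ! i) * y (Suc i)) + 2 * (y p * y l)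
      \<le> (\<Sum>i\<le>length ps. w i * (y i)\<^sup>2) + w l * (y l)\<^sup>2" for y
  proof -
    have "(\<Sum>i<length ps. y ((ps @ [p]) ! i) * y (Suc i)) = (\<Sum>i<length ps. y (ps ! i) * y (Suc i))"
      by (intro sum.cong refl) (simp add: nth_append)
    moreover have "2 * (\<Sum>i<length (ps @ [p]). y ((ps @ [p]) ! i) * y (Suc i))
        \<le> (\<Sum>i\<le>length (ps @ [p]). w i * (y i)\<^sup>2)"
      using dom unfolding dominates_tree_def by blast
    ultimately show ?thesis by (simp add: l_def)
  qed
  have lt: "ps ! i \<le> i" if "i < length ps" for i using ps that by (simp add: parent_list_def)
  show wl: "w l > 0"
  proof (rule ccontr)
    assume wl: "\<not> w l > 0"
    \<comment> \<open>With 1 at p and t at the leaf, the weights contribute at most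
      \<open>w p\<close>, which is less than 2 t.\<close>
    define t where "t = \<bar>w p\<bar> + 1"
    define y where "y j = (if j = l then t else if j = p then 1 else 0)" for j
    have pl: "p \<noteq> l" using p by (simp add: l_def)
    have "y (ps ! j) * y (Suc j) = 0" if "j < length ps" for j
      using lt[OF that] that by (auto simp: y_def l_def)
    hence "(\<Sum>j<length ps. y (ps ! j) * y (Suc j)) = 0" by (intro sum.neutral) auto
    moreover have "(\<Sum>i\<le>length ps. w i * (y i)\<^sup>2) = (\<Sum>i\<le>length ps. if i = p then w p else 0)"
      using pl by (intro sum.cong refl) (auto simp: y_def l_def)
    moreover have "y p = 1" "y l = t" using pl by (simp_all add: y_def)
    ultimately have "2 * t \<le> w p + w l * t\<^sup>2"
      using dom'[of y] p by simp
    moreover have "w l * t\<^sup>2 \<le> 0" using wl by (simp add: mult_nonpos_nonneg)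
    ultimately show False by (auto simp: t_def)
  qed
  show "dominates_tree ps (w(p := w p - 1 / w l))"
    unfolding dominates_tree_def
  proof
    fix y :: "nat \<Rightarrow> real"
    \<comment> \<open>The value at the leaf that minimizes
      \<open>w l * (y l)^2 - 2 * (y p * y l)\<close>; the minimum is the negative of
      \<open>(y p)^2 / w l\<close>.\<close>
    define y' where "y' = y(l := y p / w l)"
    have y': "y' i = y i" if "i \<le> length ps" for i using that by (simp add: y'_def l_def)
    have "(\<Sum>i<length ps. y' (ps ! i) * y' (Suc i)) = (\<Sum>i<length ps. y (ps ! i) * y (Suc i))"
    proof (intro sum.cong refl)
      fix i assume "i \<in> {..<length ps}"
      thus "y' (ps ! i) * y' (Suc i) = y (ps ! i) * y (Suc i)" using lt[of i] by (simp add: y')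
    qed
    moreover have "(\<Sum>i\<le>length ps. w i * (y' i)\<^sup>2) = (\<Sum>i\<le>length ps. w i * (y i)\<^sup>2)"
      by (intro sum.cong refl) (simp add: y')
    moreover have "y' p * y' l = (y p)\<^sup>2 / w l" "w l * (y' l)\<^sup>2 = (y p)\<^sup>2 / w l"
      using y'[OF p] wl by (simp_all add: y'_def power2_eq_square)
    ultimately have "2 * (\<Sum>i<length ps. y (ps ! i) * y (Suc i)) + (y p)\<^sup>2 / w l \<le> (\<Sum>i\<le>length ps. w i * (y i)\<^sup>2)"
      using dom'[of y'] by simp
    moreover have "(\<Sum>i\<le>length ps. (w(p := w p - 1 / w l)) i * (y i)\<^sup>2)
        = (\<Sum>i\<le>length ps. w i * (y i)\<^sup>2 - (if i = p then (y p)\<^sup>2 / w l else 0))"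
      by (intro sum.cong refl) (auto simp: algebra_simps)
    ultimately show "2 * (\<Sum>i<length ps. y (ps ! i) * y (Suc i))
        \<le> (\<Sum>i\<le>length ps. (w(p := w p - 1 / w l)) i * (y i)\<^sup>2)"
      using p by (simp add: sum_subtractf)
  qed
qed

text \<open>
  Enumerates the integer vectors \<open>x \<ge> 0\<close> with coordinate sum \<open>N\<close> for which elimination on the weights
  \<open>x i + c i / d i\<close> succeeds. Fractions \<open>c / d\<close> with \<open>d > 0\<close> are kept unreduced as pairs \<open>(c, d)\<close>.
\<close>

primrec elim_search :: "nat \<Rightarrow> nat list \<Rightarrow> (int \<times> int) list \<Rightarrow> int \<Rightarrow> int list \<Rightarrow> int list list" where
  "elim_search 0 ps W N xs = (case W ! 0 of (c, d) \<Rightarrow> if c + N * d < 0 then [] else [N # xs])"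
| "elim_search (Suc i) ps W N xs =
    concat (map (\<lambda>x. case W ! Suc i of (c, d) \<Rightarrow>
       let p = c + x * d in
       if p \<le> 0 then [] else
       elim_search i ps (W[ps ! i := (case W ! (ps ! i) of (c', d') \<Rightarrow> (c' * p - d * d', d' * p))]) (N - x) (x # xs)) [0..N])"

text \<open>Only this direction is used: no admissible x is lost, and whatever the search returns is
  examined by \<open>search_ok\<close>. Here xs holds the coordinates of the eliminated vertices, W
  the corrections left by their elimination, and N the sum still to be distributed.\<close>

lemma elim_search_complete:
  assumes "dominates_tree (take k ps) w" "k \<le> length ps" "parent_list ps" "k < length W"
    and "\<And>i. i \<le> k \<Longrightarrow> snd (W ! i) > 0"
    and "\<And>i. i \<le> k \<Longrightarrow> w i = of_int (x i) + of_int (fst (W ! i)) / of_int (snd (W ! i))"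
    and "\<And>i. i \<le> k \<Longrightarrow> x i \<ge> 0" "N = (\<Sum>i\<le>k. x i)"
  shows "map x [0..<Suc k] @ xs \<in> set (elim_search k ps W N xs)"
  using assms
proof (induction k arbitrary: w W N xs)
  case 0
  obtain c d where cd: "W ! 0 = (c, d)" by (cases "W ! 0") auto
  have d: "d > 0" using "0.prems"(5)[of 0] cd by simp
  have "w 0 \<ge> 0" using "0.prems"(1) by (auto simp: dominates_tree_def dest!: spec[of _ "\<lambda>_. 1"])
  hence "real_of_int (x 0) + c / d \<ge> 0" using "0.prems"(6)[of 0] cd by simp
  hence "real_of_int (c + x 0 * d) \<ge> 0" using d by (simp add: field_simps)
  hence "c + x 0 * d \<ge> 0" by (simp only: of_int_0_le_iff)
  thus ?case using cd "0.prems"(8) by simp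
next
  case (Suc k)
  define p where "p = ps ! k"
  have tk: "take (Suc k) ps = take k ps @ [p]" using Suc.prems(2) by (simp add: take_Suc_conv_app_nth p_def)
  have len: "length (take k ps) = k" using Suc.prems(2) by simp
  have par: "parent_list (take k ps @ [p])"
    using Suc.prems(2,3) unfolding tk[symmetric] by (simp add: parent_list_def)
  have pk: "p \<le> k" using par by (simp add: parent_list_append len)
  have wl: "w (Suc k) > 0" and dom: "dominates_tree (take k ps) (w(p := w p - 1 / w (Suc k)))"
    using dominates_tree_append[OF par, of w] Suc.prems(1) unfolding tk len by auto
  obtain c d where cd: "W ! Suc k = (c, d)" by (cases "W ! Suc k") auto
  obtain c' d' where cd': "W ! p = (c', d')" by (cases "W ! p") auto
  have d: "d > 0" "d' > 0" using Suc.prems(5)[of "Suc k"] Suc.prems(5)[of p] cd cd' pk by simp_all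
  define q where "q = c + x (Suc k) * d"
  \<comment> \<open>The weight is q / d, so eliminating the vertex subtracts d / q at its
    parent.\<close>
  have wq: "w (Suc k) = of_int q / of_int d"
    using Suc.prems(6)[of "Suc k"] cd d by (simp add: q_def field_simps)
  hence q: "q > 0" using wl d by (simp add: zero_less_divide_iff)
  define W' where "W' = W[p := (c' * q - d * d', d' * q)]"
  define N' where "N' = N - x (Suc k)"
  have lenW: "k < length W" "p < length W" using Suc.prems(4) pk by auto
  have N': "N' = (\<Sum>i\<le>k. x i)" using Suc.prems(8) by (simp add: N'_def)
  have "map x [0..<Suc k] @ x (Suc k) # xs \<in> set (elim_search k ps W' N' (x (Suc k) # xs))"
  proof (rule Suc.IH[OF dom _ Suc.prems(3)])
    show "snd (W' ! i) > 0" if "i \<le> k" for i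
      using Suc.prems(5)[of i] that d q lenW by (cases "i = p") (auto simp: W'_def)
    show "(w(p := w p - 1 / w (Suc k))) i = of_int (x i) + of_int (fst (W' ! i)) / of_int (snd (W' ! i))"
      if "i \<le> k" for i
    proof (cases "i = p")
      case True
      have "w p = of_int (x p) + of_int c' / of_int d'" using Suc.prems(6)[of p] pk cd' by simp
      moreover have "real_of_int (c' * q - d * d') / of_int (d' * q) = of_int c' / of_int d' - of_int d / of_int q"
        using d q by (simp add: field_simps)
      ultimately show ?thesis using True lenW by (simp add: W'_def wq)
    next
      case False
      thus ?thesis using Suc.prems(6)[of i] that by (simp add: W'_def)
    qed
  qed (use Suc.prems lenW N' in \<open>auto simp: W'_def\<close>)
  hence "map x [0..<Suc (Suc k)] @ xs \<in> set (case W ! Suc k of (c, d) \<Rightarrow> let p = c + x (Suc k) * d in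
       if p \<le> 0 then [] else
       elim_search k ps (W[ps ! k := (case W ! (ps ! k) of (c', d') \<Rightarrow> (c' * p - d * d', d' * p))])
         (N - x (Suc k)) (x (Suc k) # xs))"
    using q by (simp add: W'_def N'_def p_def[symmetric] cd cd' q_def[symmetric])
  moreover have "0 \<le> (\<Sum>i\<le>k. x i)" using Suc.prems(7) by (intro sum_nonneg) auto
  hence "x (Suc k) \<in> set [0..N]" using Suc.prems(7)[of "Suc k"] N' by (simp add: N'_def)
  ultimately show ?case unfolding elim_search.simps(2) set_concat set_map by blast
qed

definition tree_degree :: "nat list \<Rightarrow> nat \<Rightarrow> nat" where
  "tree_degree ps i = length (filter (\<lambda>j. ps ! j = i \<or> Suc j = i) [0..<length ps])"

lemma sum_tree_edges:
  fixes f :: "nat set \<Rightarrow> real"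
  assumes "parent_list ps"
  shows "(\<Sum>e\<in>tree_edges ps. f e) = (\<Sum>j<length ps. f {ps ! j, Suc j})"
  unfolding tree_edges_def by (subst sum.reindex[OF tree_edges_inj[OF assms]]) simp

text \<open>Double counting: vertex i contributes \<open>f i\<close> once for each of its
  edges.\<close>

lemma sum_tree_degree:
  fixes f :: "nat \<Rightarrow> real"
  assumes ps: "parent_list ps"
  shows "(\<Sum>j<length ps. f (ps ! j) + f (Suc j)) = (\<Sum>i\<le>length ps. tree_degree ps i * f i)"
proof -
  have lt: "ps ! j \<le> j" if "j < length ps" for j using ps that by (simp add: parent_list_def)
  have "(\<Sum>i\<le>length ps. if ps ! j = i \<or> Suc j = i then f i else 0) = f (ps ! j) + f (Suc j)"
    if j: "j < length ps" for j
  proof -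
    have "(\<Sum>i\<le>length ps. if ps ! j = i \<or> Suc j = i then f i else 0)
        = (\<Sum>i\<le>length ps. (if i = ps ! j then f (ps ! j) else 0) + (if i = Suc j then f (Suc j) else 0))"
      using lt[OF j] by (intro sum.cong refl) auto
    thus ?thesis using lt[OF j] j by (simp add: sum.distrib)
  qed
  hence "(\<Sum>j<length ps. f (ps ! j) + f (Suc j))
      = (\<Sum>j<length ps. \<Sum>i\<le>length ps. if ps ! j = i \<or> Suc j = i then f i else 0)"
    by (intro sum.cong) auto
  also have "\<dots> = (\<Sum>i\<le>length ps. \<Sum>j<length ps. if ps ! j = i \<or> Suc j = i then f i else 0)"
    by (rule sum.swap)
  also have "\<dots> = (\<Sum>i\<le>length ps. tree_degree ps i * f i)"
  proof (rule sum.cong[OF refl])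
    fix i
    have "tree_degree ps i = card {j\<in>{..<length ps}. ps ! j = i \<or> Suc j = i}"
      unfolding tree_degree_def by (subst distinct_card[symmetric]) (auto intro: arg_cong[where f = card])
    thus "(\<Sum>j<length ps. if ps ! j = i \<or> Suc j = i then f i else 0) = tree_degree ps i * f i"
      by (simp add: sum.inter_filter[symmetric])
  qed
  finally show ?thesis .
qed

subsection \<open>Minimizers from a search\<close>

text \<open>Expanding the square on each edge puts the degrees on the diagonal and leaves the
  adjacency matrix of the tree in the mixed terms.\<close>

lemma copy_dominates_tree:
  fixes G :: "'a::linorder pair_pre_digraph"
  assumes ps: "parent_list ps" and c: "is_copy (pendant_subdivision (Suc (length ps)) (tree_edges ps) a) G"
    and \<theta>: "\<theta> > 0" "graph_spectral_radius G \<le> \<theta>"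
  shows "dominates_tree ps (\<lambda>i. \<theta>\<^sup>2 - a i - tree_degree ps i)"
  unfolding dominates_tree_def
proof
  fix y :: "nat \<Rightarrow> real"
  let ?m = "Suc (length ps)"
  obtain g where g: "inj_on g (pverts (pendant_subdivision ?m (tree_edges ps) a))"
    "pverts G = g ` pverts (pendant_subdivision ?m (tree_edges ps) a)"
    "parcs G = map_prod g g ` parcs (pendant_subdivision ?m (tree_edges ps) a)"
    using c by (rule is_copyE)
  interpret subdivision ?m "tree_edges ps" a
    by (rule subdivision_tree_edges) (use ps in auto)
  interpret subdivision_copy ?m "tree_edges ps" a G g
    by unfold_locales (fact g)+
  have lt: "ps ! j \<le> j" if "j < length ps" for j using ps that by (simp add: parent_list_def)
  have "(\<Sum>e\<in>tree_edges ps. (\<Sum>j\<in>e. y j)\<^sup>2) = (\<Sum>j<length ps. (\<Sum>i\<in>{ps ! j, Suc j}. y i)\<^sup>2)"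
    by (rule sum_tree_edges[OF ps])
  also have "\<dots> = (\<Sum>j<length ps. ((y (ps ! j))\<^sup>2 + (y (Suc j))\<^sup>2) + 2 * (y (ps ! j) * y (Suc j)))"
  proof (intro sum.cong refl)
    fix j assume "j \<in> {..<length ps}"
    hence "ps ! j \<noteq> Suc j" using lt[of j] by auto
    thus "(\<Sum>i\<in>{ps ! j, Suc j}. y i)\<^sup>2 = ((y (ps ! j))\<^sup>2 + (y (Suc j))\<^sup>2) + 2 * (y (ps ! j) * y (Suc j))"
      by (simp add: power2_sum)
  qed
  also have "\<dots> = (\<Sum>i\<le>length ps. tree_degree ps i * (y i)\<^sup>2) + 2 * (\<Sum>j<length ps. y (ps ! j) * y (Suc j))"
    using sum_tree_degree[OF ps, of "\<lambda>i. (y i)\<^sup>2"] by (simp add: sum.distrib sum_distrib_left)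
  finally have "(\<Sum>i\<le>length ps. tree_degree ps i * (y i)\<^sup>2) + 2 * (\<Sum>j<length ps. y (ps ! j) * y (Suc j))
      + (\<Sum>i\<le>length ps. a i * (y i)\<^sup>2) \<le> \<theta>\<^sup>2 * (\<Sum>i\<le>length ps. (y i)\<^sup>2)"
    using quadratic_form_bound[OF _ \<theta>, of y] by (simp add: lessThan_Suc_atMost)
  moreover have "(\<Sum>i\<le>length ps. (\<theta>\<^sup>2 - a i - tree_degree ps i) * (y i)\<^sup>2)
      = \<theta>\<^sup>2 * (\<Sum>i\<le>length ps. (y i)\<^sup>2) - (\<Sum>i\<le>length ps. a i * (y i)\<^sup>2) - (\<Sum>i\<le>length ps. tree_degree ps i * (y i)\<^sup>2)"
    unfolding sum_distrib_left sum_subtractf[symmetric] by (intro sum.cong refl) (simp add: algebra_simps)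
  ultimately show "2 * (\<Sum>i<length ps. y (ps ! i) * y (Suc i)) \<le> (\<Sum>i\<le>length ps. (\<theta>\<^sup>2 - a i - tree_degree ps i) * (y i)\<^sup>2)"
    by linarith
qed

text \<open>
  Besides the identity, the two relabellings are the reversals of the path and of the tree underlying
  \<open>F6_5\<close>.
\<close>

definition search_ok :: "int \<times> int \<Rightarrow> int \<Rightarrow> (nat list \<times> nat list) list \<Rightarrow> bool" where
  "search_ok \<mu> N L \<longleftrightarrow> list_all (\<lambda>qs. list_all (\<lambda>x. list_ex (\<lambda>(qs', b). qs' = qs \<and>
       list_ex (\<lambda>s. relabels s qs qs \<and> list_all (\<lambda>i. int (b ! (s ! i)) = x ! i + int (tree_degree qs i)) [0..<6])
         [[0, 1, 2, 3, 4, 5], [5, 4, 3, 2, 1, 0], [4, 3, 2, 1, 0, 5]]) L)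
       (elim_search 5 qs (replicate 6 \<mu>) N [])) six_vertex_trees"

text \<open>The left side is the signless Laplacian of the tree applied to z. With
  \<open>b ! i = k - a i\<close> this is the hypothesis \<open>eig\<close> of
  \<open>spectral_radius_G\<close> for \<open>\<theta>^2 = k + \<mu>\<close>.\<close>

definition perron_vector :: "nat list \<Rightarrow> nat list \<Rightarrow> real \<Rightarrow> real list \<Rightarrow> bool" where
  "perron_vector qs b \<mu> z \<longleftrightarrow> (\<forall>i<6. z ! i > 0 \<and>
     (\<Sum>j<5. if qs ! j = i \<or> Suc j = i then z ! (qs ! j) + z ! Suc j else 0) = (b ! i + \<mu>) * z ! i)"

lemma six_vertex_trees_props:
  assumes "qs \<in> set six_vertex_trees"
  shows "parent_list qs" "length qs = 5"
  using assms by (auto simp: six_vertex_trees_def parent_list_def less_Suc_eq numeral_eq_Suc)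

definition listed :: "nat \<Rightarrow> (nat list \<times> nat list) list \<Rightarrow> 'a pair_pre_digraph \<Rightarrow> bool" where
  "listed k L G \<longleftrightarrow> (\<exists>(qs, b)\<in>set L. is_copy (pendant_subdivision 6 (tree_edges qs) ((!) (map (\<lambda>x. k - x) b))) G)"

text \<open>The fraction p / q is a rational upper bound of \<mu> for the search;
  \<open>p < q\<close> makes \<delta> nonnegative, and \<open>6 * \<mu> < real s + 1\<close> is the
  condition that \<open>6 \<theta>^2\<close> stays below n + 10. Each b is \<delta> plus the
  degrees, with sum (10 - s) + 10. Entries up to 10 and \<open>k \<ge> 11\<close> leave every tree
  vertex a pendant vertex and make the natural subtraction k - x exact.\<close>

locale minimizer_data =
  fixes n k s :: nat and p q :: int and \<mu> :: real and L :: "(nat list \<times> nat list) list"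
  assumes n: "n + 9 = 6 * k + s" and s: "s \<le> 5" and k: "k \<ge> 11"
    and \<mu>: "0 \<le> \<mu>" "\<mu> \<le> of_int p / of_int q" "6 * \<mu> < real s + 1" and pq: "0 \<le> p" "p < q"
    and L: "L \<noteq> []" "\<And>qs b. (qs, b) \<in> set L \<Longrightarrow> qs \<in> set six_vertex_trees \<and> length b = 6 \<and> sum_list b = 20 - s \<and>
      (\<forall>x\<in>set b. x \<le> 10) \<and> (\<exists>z. perron_vector qs b \<mu> z)"
    and search: "search_ok (p, q) (10 - int s) L"
begin

definition "\<theta> = sqrt (real k + \<mu>)"

lemma \<theta>_sq: "\<theta>\<^sup>2 = k + \<mu>" using \<mu>(1) by (simp add: \<theta>_def)

lemma \<theta>_ge: "\<theta> \<ge> 5 / 2"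
proof -
  have "(5 / 2)\<^sup>2 \<le> real k + \<mu>" using k \<mu>(1) by (simp add: power2_eq_square)
  thus ?thesis unfolding \<theta>_def by (rule real_le_rsqrt)
qed

lemma listed_properties:
  fixes G :: "nat pair_pre_digraph"
  assumes "listed k L G"
  shows "G \<in> conn_graphs n (n - 6)" "graph_spectral_radius G = \<theta>"
proof -
  obtain qs b where qb: "(qs, b) \<in> set L"
    and c: "is_copy (pendant_subdivision 6 (tree_edges qs) ((!) (map (\<lambda>x. k - x) b))) G"
    using assms unfolding listed_def by blast
  define a where "a = (!) (map (\<lambda>x. k - x) b)"
  obtain z where qs: "parent_list qs" "length qs = 5" and b: "length b = 6" "sum_list b = 20 - s" "\<And>x. x \<in> set b \<Longrightarrow> x \<le> 10"
    and z: "perron_vector qs b \<mu> z"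
    using L(2)[OF qb] six_vertex_trees_props by blast
  have a: "a i = k - b ! i" "b ! i \<le> 10" if "i < 6" for i using that b by (auto simp: a_def)
  interpret subdivision 6 "tree_edges qs" a by (rule subdivision_tree_edges) (use qs in auto)
  obtain g where g: "inj_on g (pverts (pendant_subdivision 6 (tree_edges qs) a))"
    "pverts G = g ` pverts (pendant_subdivision 6 (tree_edges qs) a)"
    "parcs G = map_prod g g ` parcs (pendant_subdivision 6 (tree_edges qs) a)"
    using c unfolding a_def by (rule is_copyE)
  interpret subdivision_copy 6 "tree_edges qs" a G g by unfold_locales (fact g)+
  have cE: "card (tree_edges qs) = 5" using card_tree_edges qs by simp
  have "(\<Sum>i<6. a i) + sum_list b = (\<Sum>i<6. a i + b ! i)"
    using b(1) by (simp add: sum.distrib sum_list_sum_nth lessThan_atLeast0)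
  also have "\<dots> = (\<Sum>i<6::nat. k)"
  proof (intro sum.cong refl)
    fix i :: nat assume "i \<in> {..<6}"
    hence "a i = k - b ! i" "b ! i \<le> 10" using a by auto
    thus "a i + b ! i = k" using k by simp
  qed
  finally have sum_a: "(\<Sum>i<6. a i) + (20 - s) = 6 * k" using b(2) by simp
  have "card (pverts G) = n" using card_G cE sum_a n s by simp
  moreover have "a i > 0" if "i < 6" for i using a[OF that] k by simp
  hence "independence_number G = n - 6"
    using independence_number_G cE sum_a n s by simp
  moreover have "Digraph_Component.connected (with_proj G)"
    by (rule connected_copy_tree[OF qs(1) _ _ c]) (use qs in auto)
  ultimately show "G \<in> conn_graphs n (n - 6)" using pair_graph_G by (simp add: conn_graphs_def)
  show "graph_spectral_radius G = \<theta>"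
  proof (rule spectral_radius_G[of \<theta> "\<lambda>i. z ! i"])
    show "\<theta> > 0" using \<theta>_ge by simp
    fix i :: nat assume i: "i < 6"
    show "z ! i > 0" using z i by (simp add: perron_vector_def)
    have lt: "qs ! j \<noteq> Suc j" if "j < 5" for j
    proof -
      have "qs ! j \<le> j" using qs that by (simp add: parent_list_def)
      thus ?thesis by simp
    qed
    have "(\<Sum>e | e \<in> tree_edges qs \<and> i \<in> e. \<Sum>j\<in>e. z ! j)
        = (\<Sum>e\<in>tree_edges qs. if i \<in> e then \<Sum>j\<in>e. z ! j else 0)"
      using E_finite by (simp add: sum.inter_filter)
    also have "\<dots> = (\<Sum>j<5. if i \<in> {qs ! j, Suc j} then \<Sum>l\<in>{qs ! j, Suc j}. z ! l else 0)"
      using sum_tree_edges[OF qs(1)] qs(2) by simp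
    also have "\<dots> = (\<Sum>j<5. if qs ! j = i \<or> Suc j = i then z ! (qs ! j) + z ! Suc j else 0)"
      using lt by (intro sum.cong refl) auto
    also have "\<dots> = (b ! i + \<mu>) * z ! i" using z i by (simp add: perron_vector_def)
    finally have sum: "(\<Sum>e | e \<in> tree_edges qs \<and> i \<in> e. \<Sum>j\<in>e. z ! j) = (b ! i + \<mu>) * z ! i" .
    have "real (a i) = real k - b ! i" using a[OF i] k by (simp add: of_nat_diff)
    thus "a i * z ! i + (\<Sum>e | e \<in> tree_edges qs \<and> i \<in> e. \<Sum>j\<in>e. z ! j) = \<theta>\<^sup>2 * z ! i"
      unfolding sum \<theta>_sq by (simp only:) (simp add: algebra_simps)
  qed simp
qed

text \<open>Covering all radii up to \<theta> settles two questions at once: since listed graphs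
  have radius \<theta>, no graph lies below it, and no unlisted graph attains it.\<close>

lemma small_radius_listed:
  fixes G :: "nat pair_pre_digraph"
  assumes G: "G \<in> conn_graphs n (n - 6)" and le: "graph_spectral_radius G \<le> \<theta>"
  shows "listed k L G"
proof -
  have pg: "pair_graph G" and conn: "Digraph_Component.connected (with_proj G)"
    and cV: "card (pverts G) = n" and ind: "independence_number G = n - 6"
    using G by (auto simp: conn_graphs_def)
  interpret pair_graph G by fact
  have n6: "n \<ge> 6" using n s k by simp
  have "{S. independent_set G S} \<subseteq> Pow (pverts G)" by (auto simp: independent_set_def)
  hence "finite {S. independent_set G S}" by (rule finite_subset) simp
  moreover have "independent_set G {}" by (simp add: independent_set_def)
  ultimately have "independence_number G \<in> card ` {S. independent_set G S}"
    unfolding independence_number_def by (intro Max_in) auto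
  then obtain S where S: "independent_set G S" "card S = n - 6" using ind by auto
  have "S \<subseteq> pverts G" using S(1) by (simp add: independent_set_def)
  hence cC: "card (pverts G - S) = 6"
    using S(2) cV n6 by (simp add: card_Diff_subset finite_subset)
  have "real n + 9 = 6 * real k + real s" using arg_cong[OF n, of real] by simp
  hence lt: "real 6 * \<theta>\<^sup>2 < real n + 2 * real 6 - 2"
    unfolding \<theta>_sq using \<mu>(3) by simp
  obtain ps a0 where ps: "length ps = 5" "parent_list ps"
    and c0: "is_copy (pendant_subdivision 6 (tree_edges ps) a0) G"
    using small_radius_structure[OF pg conn S(1) cV cC _ \<theta>_ge le lt] by auto
  obtain qs where qs: "qs \<in> set six_vertex_trees" "same_shape ps qs" using shapes_five[OF ps] by blast
  have qs': "parent_list qs" "length qs = 5" using six_vertex_trees_props[OF qs(1)] by auto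
  obtain \<sigma> where \<sigma>: "bij_betw \<sigma> {..<6} {..<6}" "tree_edges qs = (`) \<sigma> ` tree_edges ps"
  proof -
    obtain \<sigma> where "bij_betw \<sigma> {..length ps} {..length ps}" "(`) \<sigma> ` tree_edges ps = tree_edges qs"
      using qs(2) unfolding same_shape_def by blast
    moreover have "{..length ps} = {..<6}" using ps(1) by auto
    ultimately show thesis using that by simp
  qed
  define a where "a = a0 \<circ> the_inv_into {..<6} \<sigma>"
  have c: "is_copy (pendant_subdivision 6 (tree_edges qs) a) G"
  proof (rule relabel_copy[OF _ \<sigma>(1) c0 \<sigma>(2)])
    show "e \<subseteq> {..<6}" if "e \<in> tree_edges ps" for e using tree_edges_subset[OF ps(2) that] ps(1) by simp
    show "a (\<sigma> i) = a0 i" if "i < 6" for i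
      using \<sigma>(1) that by (simp add: a_def bij_betw_def the_inv_into_f_f)
  qed
  \<comment> \<open>The vector \<delta> of this graph.\<close>
  define x where "x i = int k - int (a i) - int (tree_degree qs i)" for i
  have q0: "q > 0" using pq by simp
  have "dominates_tree qs (\<lambda>i. \<theta>\<^sup>2 - a i - tree_degree qs i)"
    by (rule copy_dominates_tree) (use qs' c \<theta>_ge le in auto)
  hence "dominates_tree qs (\<lambda>i. of_int (x i) + \<mu>)"
    by (rule dominates_tree_mono) (simp add: x_def \<theta>_sq)
  \<comment> \<open>Raising \<mu> to p / q keeps the form positive semidefinite and makes the
    weights rational.\<close>
  hence dom: "dominates_tree qs (\<lambda>i. of_int (x i) + of_int p / of_int q)"
    by (rule dominates_tree_mono) (use \<mu>(2) in simp)
  have x0: "x i \<ge> 0" if "i \<le> 5" for i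
  proof -
    have "0 \<le> of_int (x i) + of_int p / (of_int q :: real)"
      using dominates_tree_nonneg[OF qs'(1) dom] that qs'(2) by simp
    moreover have "of_int p / (of_int q :: real) < 1" using pq by simp
    ultimately have "real_of_int (x i) > -1" by linarith
    thus ?thesis by linarith
  qed
  have sum_x: "(\<Sum>i\<le>5. x i) = 10 - int s"
  proof -
    interpret subdivision 6 "tree_edges qs" a by (rule subdivision_tree_edges) (use qs' in auto)
    obtain g where g: "inj_on g (pverts (pendant_subdivision 6 (tree_edges qs) a))"
      "pverts G = g ` pverts (pendant_subdivision 6 (tree_edges qs) a)"
      "parcs G = map_prod g g ` parcs (pendant_subdivision 6 (tree_edges qs) a)"
      using c by (rule is_copyE)
    interpret subdivision_copy 6 "tree_edges qs" a G g by unfold_locales (fact g)+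
    have "n = 11 + (\<Sum>i<6. a i)" using card_G cV card_tree_edges[OF qs'(1)] qs'(2) by simp
    hence "real n = 11 + (\<Sum>i\<le>5. real (a i))"
      by (simp add: lessThan_Suc_atMost[of 5, simplified])
    moreover have "(\<Sum>i\<le>5. real (tree_degree qs i)) = 10"
      using sum_tree_degree[OF qs'(1), of "\<lambda>_. 1"] qs'(2) by simp
    moreover have "real_of_int (\<Sum>i\<le>5. x i) = 6 * real k - (\<Sum>i\<le>5. real (a i)) - (\<Sum>i\<le>5. real (tree_degree qs i))"
      by (simp add: x_def sum_subtractf)
    ultimately have "real_of_int (\<Sum>i\<le>5. x i) = real_of_int (10 - int s)"
      using \<open>real n + 9 = 6 * real k + real s\<close> by simp
    thus ?thesis by (simp only: of_int_eq_iff)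
  qed
  have "map x [0..<Suc 5] @ [] \<in> set (elim_search 5 qs (replicate 6 (p, q)) (10 - int s) [])"
    by (rule elim_search_complete[where w = "\<lambda>i. of_int (x i) + of_int p / of_int q"])
      (use qs' dom q0 x0 sum_x in \<open>auto simp: nth_replicate\<close>)
  \<comment> \<open>The search may return a mirror image of a listed vector; \<pi> is the symmetry
    of the tree that matches the two.\<close>
  then obtain b \<pi> where b: "(qs, b) \<in> set L" and \<pi>: "relabels \<pi> qs qs"
    and eq: "\<And>i. i < 6 \<Longrightarrow> int (b ! (\<pi> ! i)) = map x [0..<Suc 5] ! i + int (tree_degree qs i)"
    using search qs(1) unfolding search_ok_def list_all_iff list_ex_iff
    by (fastforce simp del: upt_Suc)
  have "is_copy (pendant_subdivision 6 (tree_edges qs) ((!) (map (\<lambda>x. k - x) b))) G"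
  proof (rule relabel_copy[OF _ _ c])
    show "e \<subseteq> {..<6}" if "e \<in> tree_edges qs" for e using tree_edges_subset[OF qs'(1) that] qs'(2) by simp
    show bij: "bij_betw ((!) \<pi>) {..<6} {..<6}" using relabels_bij[OF \<pi>] qs'(2) by simp
    show "tree_edges qs = (`) ((!) \<pi>) ` tree_edges qs" using relabels_tree_edges[OF \<pi>] by simp
    fix i :: nat assume i: "i < 6"
    have "\<pi> ! i < 6" using bij i by (auto simp: bij_betw_def)
    hence "map (\<lambda>x. k - x) b ! (\<pi> ! i) = k - b ! (\<pi> ! i)" using L(2)[OF b] by simp
    moreover have "int (b ! (\<pi> ! i)) = int k - int (a i)"
      using eq[OF i] i by (simp add: x_def nth_append del: upt_Suc)
    ultimately show "map (\<lambda>x. k - x) b ! (\<pi> ! i) = a i" by linarith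
  qed
  thus ?thesis using b unfolding listed_def by blast
qed

theorem minimizers_are_listed:
  "minimizer_graphs n (n - 6) = {G. listed k L G}"
  "T \<in> minimizer_graphs n (n - 6) \<Longrightarrow> graph_spectral_radius T = \<theta>"
proof -
  \<comment> \<open>The radius of a minimizer is bounded by \<theta> through comparison with an
    existing listed graph.\<close>
  have "\<exists>G0 :: nat pair_pre_digraph. listed k L G0"
  proof -
    obtain qs b where qb: "(qs, b) \<in> set L" using L(1) by (metis list.set_intros(1) neq_Nil_conv surj_pair)
    hence "parent_list qs" "length qs = 5" using L(2) six_vertex_trees_props by blast+
    hence "subdivision 6 (tree_edges qs)" by (intro subdivision_tree_edges) auto
    then obtain G0 :: "nat pair_pre_digraph" where
      "is_copy (pendant_subdivision 6 (tree_edges qs) ((!) (map (\<lambda>x. k - x) b))) G0"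
      using ex_nat_copy[OF subdivision.finite_H] by blast
    thus ?thesis using qb unfolding listed_def by blast
  qed
  then obtain G0 :: "nat pair_pre_digraph" where G0: "listed k L G0" ..
  show eq: "minimizer_graphs n (n - 6) = {G. listed k L G}"
  proof (intro equalityI subsetI)
    fix G assume "G \<in> minimizer_graphs n (n - 6)"
    hence "G \<in> conn_graphs n (n - 6)" "graph_spectral_radius G \<le> \<theta>"
      using listed_properties[OF G0] by (auto simp: minimizer_graphs_def)
    thus "G \<in> {G. listed k L G}" using small_radius_listed by blast
  next
    fix G :: "nat pair_pre_digraph" assume "G \<in> {G. listed k L G}"
    hence G: "G \<in> conn_graphs n (n - 6)" "graph_spectral_radius G = \<theta>" using listed_properties by auto
    have "\<theta> \<le> graph_spectral_radius K" if K: "K \<in> conn_graphs n (n - 6)" for K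
    proof (rule ccontr)
      assume less: "\<not> \<theta> \<le> graph_spectral_radius K"
      hence "listed k L K" using small_radius_listed[OF K] by simp
      thus False using less listed_properties by simp
    qed
    thus "G \<in> minimizer_graphs n (n - 6)" using G by (simp add: minimizer_graphs_def)
  qed
  show "graph_spectral_radius T = \<theta>" if "T \<in> minimizer_graphs n (n - 6)"
    using that listed_properties(2) unfolding eq by blast
qed

end

text \<open>
  An entry \<open>(qs, b)\<close> of \<open>listing\<close>\<open>s\<close>, where \<open>n + 9 = 6 k + s\<close>, stands for the tree \<open>qs\<close> with \<open>k - b ! i\<close> pendant
  vertices at vertex \<open>i\<close>. The fractions in the searches lie strictly between the minimum of \<open>\<rho>\<^sup>2 - k\<close>
  and its next larger value, so that rational arithmetic is enough.
\<close>

definition listing0 :: "(nat list \<times> nat list) list" where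
  "listing0 =
   [([0, 1, 1, 1, 1], [2, 10, 2, 2, 2, 2]), ([0, 1, 2, 1, 1], [2, 8, 4, 2, 2, 2]),
    ([0, 1, 2, 1, 2], [2, 6, 6, 2, 2, 2]), ([0, 1, 2, 3, 1], [2, 6, 4, 4, 2, 2]),
    ([0, 1, 2, 3, 2], [2, 4, 6, 4, 2, 2]), ([0, 1, 2, 3, 4], [2, 4, 4, 4, 4, 2])]"

definition listing1 :: "(nat list \<times> nat list) list" where
  "listing1 =
   [([0, 1, 1, 1, 1], [2, 9, 2, 2, 2, 2])]"

definition listing2 :: "(nat list \<times> nat list) list" where
  "listing2 =
   [([0, 1, 2, 1, 2], [2, 5, 5, 2, 2, 2]), ([0, 1, 2, 3, 1], [2, 5, 4, 3, 2, 2]),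
    ([0, 1, 2, 3, 4], [2, 3, 4, 4, 3, 2])]"

definition listing3 :: "(nat list \<times> nat list) list" where
  "listing3 =
   [([0, 1, 2, 3, 2], [2, 3, 6, 4, 1, 1]), ([0, 1, 2, 3, 2], [2, 3, 6, 3, 2, 1]),
    ([0, 1, 2, 3, 2], [1, 4, 6, 4, 1, 1]), ([0, 1, 2, 3, 2], [2, 3, 5, 4, 1, 2]),
    ([0, 1, 2, 3, 2], [2, 3, 5, 3, 2, 2]), ([0, 1, 2, 3, 2], [1, 4, 5, 4, 1, 2]),
    ([0, 1, 2, 3, 4], [2, 3, 4, 3, 3, 2]), ([0, 1, 2, 3, 4], [2, 3, 4, 3, 4, 1]),
    ([0, 1, 2, 3, 4], [2, 3, 3, 4, 4, 1]), ([0, 1, 2, 3, 4], [1, 4, 4, 3, 4, 1])]"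

definition listing4 :: "(nat list \<times> nat list) list" where
  "listing4 =
   [([0, 1, 2, 1, 2], [1, 6, 6, 1, 1, 1]), ([0, 1, 2, 3, 1], [1, 6, 3, 4, 1, 1]),
    ([0, 1, 2, 3, 4], [1, 4, 3, 3, 4, 1])]"

definition listing5 :: "(nat list \<times> nat list) list" where
  "listing5 =
   [([0, 1, 1, 1, 1], [1, 10, 1, 1, 1, 1])]"

lemma search_ok0: "search_ok (1, 10) 10 listing0"
  by code_simp

lemma search_ok1: "search_ok (1, 5) 9 listing1"
  by code_simp

lemma search_ok2: "search_ok (3, 7) 8 listing2"
  by code_simp

lemma search_ok3: "search_ok (5, 8) 7 listing3"
  by code_simp

lemma search_ok4: "search_ok (11, 15) 6 listing4"
  by code_simp

lemma search_ok5: "search_ok (6, 7) 5 listing5"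
  by code_simp

subsection \<open>The trees of the statement\<close>

text \<open>The core vertices of F are us and its midpoints ms, with \<open>ms ! j\<close> between
  tree vertex \<open>Suc j\<close> and its parent. The new pendant vertex \<open>Inr (i, k)\<close>
  corresponds to \<open>Leaf i k\<close>.\<close>

lemma attach_pendants_copy:
  assumes qs: "parent_list qs" and us: "length us = Suc (length qs)" and ms: "length ms = length qs"
    and dist: "distinct (us @ ms)" and verts: "pverts F = set us \<union> set ms"
    and R: "R = set (concat (map (\<lambda>j. [(us ! (qs ! j), ms ! j), (us ! Suc j, ms ! j)]) [0..<length qs]))"
    and arcs: "parcs F = R \<union> R\<inverse>"
  shows "is_copy (pendant_subdivision (Suc (length qs)) (tree_edges qs) ((!) as)) (attach_pendants (F, us) as)"
proof (rule is_copyI)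
  let ?P = "pendant_subdivision (Suc (length qs)) (tree_edges qs) ((!) as)"
  \<comment> \<open>The edge with larger end \<open>Suc j\<close> has index j, hence
    \<open>Max e - 1\<close>.\<close>
  define g where "g v = (case v of Core i \<Rightarrow> Inl (us ! i) | Mid e \<Rightarrow> Inl (ms ! (Max e - 1)) | Leaf i k \<Rightarrow> Inr (i, k))" for v
  define E where "E = {(Inl (us ! i) :: 'a + nat \<times> nat, Inr (i, k) :: 'a + nat \<times> nat) | i k. i < length us \<and> k < as ! i}"
  have lt: "qs ! j \<le> j" if "j < length qs" for j using qs that by (simp add: parent_list_def)
  have gMid: "g (Mid {qs ! j, Suc j}) = Inl (ms ! j)" if "j < length qs" for j
    using lt[OF that] by (simp add: g_def max_def)
  have MidE: "\<exists>j<length qs. e = {qs ! j, Suc j}" if "e \<in> tree_edges qs" for e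
    using that by (auto simp: tree_edges_def)
  have conv: "map_prod f f ` (X\<inverse>) = (map_prod f f ` X)\<inverse>" for f :: "'b \<Rightarrow> 'c" and X
    by force
  have R_iff: "x \<in> R \<longleftrightarrow> (\<exists>j<length qs. \<exists>i\<in>{qs ! j, Suc j}. x = (us ! i, ms ! j))" for x
    by (auto simp: R)
  have us_ms: "us ! i \<noteq> ms ! j" if "i < length us" "j < length ms" for i j
    using dist that by (auto simp: disjoint_iff dest: nth_mem)
  have du: "distinct us" and dm: "distinct ms" using dist by auto
  show "inj_on g (pverts ?P)"
  proof (rule inj_onI)
    fix u v assume uv: "u \<in> pverts ?P" "v \<in> pverts ?P" "g u = g v"
    have C: "i < length us" if "Core i \<in> pverts ?P" for i
      using that us by (auto simp: pendant_subdivision_def)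
    have M: "\<exists>j<length ms. e = {qs ! j, Suc j} \<and> g (Mid e) = Inl (ms ! j)" if "Mid e \<in> pverts ?P" for e
      using that MidE[of e] gMid ms by (auto simp: pendant_subdivision_def)
    show "u = v"
    proof (cases u)
      case u: (Core i)
      show ?thesis
      proof (cases v)
        case (Core j)
        thus ?thesis using uv u C du by (auto simp: g_def nth_eq_iff_index_eq)
      next
        case (Mid e)
        then obtain j where "j < length ms" "g v = Inl (ms ! j)" using M uv(2) by blast
        thus ?thesis using uv u C us_ms by (auto simp: g_def)
      qed (use uv u in \<open>auto simp: g_def\<close>)
    next
      case u: (Mid e)
      obtain i where i: "i < length ms" "e = {qs ! i, Suc i}" "g u = Inl (ms ! i)" using M uv(1) u by blast
      show ?thesis
      proof (cases v)
        case (Core j)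
        hence "us ! j = ms ! i" using uv(3) i(3) by (simp add: g_def)
        thus ?thesis using us_ms[of j i] C uv(2) Core i(1) by blast
      next
        case (Mid e')
        obtain j where j: "j < length ms" "e' = {qs ! j, Suc j}" "g v = Inl (ms ! j)" using M uv(2) Mid by blast
        have "i = j" using i j uv(3) dm by (simp add: nth_eq_iff_index_eq)
        thus ?thesis using u Mid i j by simp
      next
        case (Leaf j l)
        thus ?thesis using uv(3) i(3) by (simp add: g_def)
      qed
    next
      case (Leaf i l)
      thus ?thesis using uv by (cases v) (auto simp: g_def)
    qed
  qed
  have E_snd: "snd ` E = {Inr (i, k) | i k. i < length us \<and> k < as ! i}"
    by (force simp: E_def)
  have A: "attach_pendants (F, us) as = \<lparr>pverts = Inl ` pverts F \<union> snd ` E, parcs = map_prod Inl Inl ` parcs F \<union> E \<union> E\<inverse>\<rparr>"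
    by (simp add: attach_pendants_def E_def Let_def)
  have core: "g ` Core ` {..<Suc (length qs)} = Inl ` set us"
  proof -
    have "g ` Core ` {..<Suc (length qs)} = Inl ` ((!) us ` {..<length us})"
      by (simp add: image_image g_def us)
    also have "(!) us ` {..<length us} = set us" by (auto simp: set_conv_nth)
    finally show ?thesis .
  qed
  have mid: "g ` Mid ` tree_edges qs = Inl ` set ms"
  proof -
    have "g ` Mid ` tree_edges qs = (\<lambda>j. g (Mid {qs ! j, Suc j})) ` {..<length qs}"
      by (simp add: image_image tree_edges_def)
    also have "\<dots> = Inl ` ((!) ms ` {..<length ms})" by (simp add: image_image gMid ms)
    also have "(!) ms ` {..<length ms} = set ms" by (auto simp: set_conv_nth)
    finally show ?thesis .
  qed
  have "g ` {Leaf i k | i k. i < Suc (length qs) \<and> k < as ! i} = snd ` E"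
    unfolding E_snd us by (force simp: g_def image_iff)
  thus "pverts (attach_pendants (F, us) as) = g ` pverts ?P"
    unfolding A by (simp add: pendant_subdivision_def image_Un core mid verts)
  have "map_prod g g ` sub_edges (Suc (length qs)) (tree_edges qs) ((!) as) = map_prod Inl Inl ` R \<union> E"
  proof
    show "map_prod g g ` sub_edges (Suc (length qs)) (tree_edges qs) ((!) as) \<subseteq> map_prod Inl Inl ` R \<union> E"
    proof
      fix z assume "z \<in> map_prod g g ` sub_edges (Suc (length qs)) (tree_edges qs) ((!) as)"
      then consider (1) i e where "e \<in> tree_edges qs" "i \<in> e" "z = (g (Core i), g (Mid e))"
        | (2) i k where "i < Suc (length qs)" "k < as ! i" "z = (g (Core i), g (Leaf i k))"
        by (auto simp: sub_edges_def)
      thus "z \<in> map_prod Inl Inl ` R \<union> E"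
      proof cases
        case 1
        then obtain j where j: "j < length qs" "e = {qs ! j, Suc j}" using MidE by blast
        hence "z = map_prod Inl Inl (us ! i, ms ! j)" using 1 gMid by (simp add: g_def)
        moreover have "(us ! i, ms ! j) \<in> R" unfolding R_iff using 1 j by blast
        ultimately show ?thesis by (intro UnI1 image_eqI)
      next
        case 2
        thus ?thesis using us by (auto simp: E_def g_def)
      qed
    qed
    show "map_prod Inl Inl ` R \<union> E \<subseteq> map_prod g g ` sub_edges (Suc (length qs)) (tree_edges qs) ((!) as)"
    proof
      fix z assume "z \<in> map_prod Inl Inl ` R \<union> E"
      thus "z \<in> map_prod g g ` sub_edges (Suc (length qs)) (tree_edges qs) ((!) as)"
      proof
        assume "z \<in> map_prod Inl Inl ` R"
        then obtain x where x: "z = map_prod Inl Inl x" "x \<in> R" by (rule imageE)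
        obtain j i where ij: "j < length qs" "i \<in> {qs ! j, Suc j}" "x = (us ! i, ms ! j)"
          using x(2) unfolding R_iff by (elim exE bexE conjE)
        have "z = map_prod g g (Core i, Mid {qs ! j, Suc j})" using x ij gMid by (simp add: g_def)
        moreover have "(Core i, Mid {qs ! j, Suc j}) \<in> sub_edges (Suc (length qs)) (tree_edges qs) ((!) as)"
          using ij by (auto simp: sub_edges_def tree_edges_def)
        ultimately show ?thesis by (rule image_eqI)
      next
        assume "z \<in> E"
        then obtain i k where ik: "i < length us" "k < as ! i" "z = (Inl (us ! i), Inr (i, k))"
          by (auto simp: E_def)
        have "z = map_prod g g (Core i, Leaf i k)" using ik by (simp add: g_def)
        moreover have "(Core i, Leaf i k) \<in> sub_edges (Suc (length qs)) (tree_edges qs) ((!) as)"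
          using ik us by (auto simp: sub_edges_def)
        ultimately show ?thesis by (rule image_eqI)
      qed
    qed
  qed
  hence "map_prod g g ` parcs ?P = (map_prod Inl Inl ` R \<union> E) \<union> (map_prod Inl Inl ` R \<union> E)\<inverse>"
    by (simp add: pendant_subdivision_def image_Un conv)
  thus "parcs (attach_pendants (F, us) as) = map_prod g g ` parcs ?P"
    unfolding A arcs by (auto simp: image_Un conv)
qed

text \<open>Executable form of the hypotheses of \<open>attach_pendants_copy\<close>, with the edges
  of F given as a list in any orientation and compared after adding all reversals.\<close>

definition subdivides :: "nat list \<Rightarrow> 'a list \<Rightarrow> 'a list \<Rightarrow> ('a \<times> 'a) list \<Rightarrow> bool" where
  "subdivides qs us ms es \<longleftrightarrow> list_all (\<lambda>i. qs ! i \<le> i) [0..<length qs] \<and>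
     length us = Suc (length qs) \<and> length ms = length qs \<and> distinct (us @ ms) \<and>
     set (map fst es @ map snd es) = set (us @ ms) \<and>
     (let rs = concat (map (\<lambda>j. [(us ! (qs ! j), ms ! j), (us ! Suc j, ms ! j)]) [0..<length qs])
      in set (es @ map prod.swap es) = set (rs @ map prod.swap rs))"

lemma iso_attach_pendants_iff:
  fixes G :: "'b pair_pre_digraph"
  assumes sub: "subdivides qs us ms es" and len: "length qs = 5"
  shows "digraph_iso (with_proj G) (with_proj (attach_pendants (graph_of_edges (set es), us) as)) \<longleftrightarrow>
    is_copy (pendant_subdivision 6 (tree_edges qs) ((!) as)) G"
proof -
  let ?P = "pendant_subdivision 6 (tree_edges qs) ((!) as)" and ?A = "attach_pendants (graph_of_edges (set es), us) as"
  define R where "R = set (concat (map (\<lambda>j. [(us ! (qs ! j), ms ! j), (us ! Suc j, ms ! j)]) [0..<length qs]))"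
  have inv: "(set xs)\<inverse> = set (map prod.swap xs)" for xs :: "('a \<times> 'a) list"
    by (force simp: image_iff)
  have par: "parent_list qs" and us: "length us = Suc (length qs)" and ms: "length ms = length qs"
    and dist: "distinct (us @ ms)" and verts: "fst ` set es \<union> snd ` set es = set us \<union> set ms"
    and arcs: "set es \<union> (set es)\<inverse> = R \<union> R\<inverse>"
    using sub unfolding subdivides_def Let_def R_def inv by (auto simp: parent_list_def list_all_iff)
  have "Field (set es) = set us \<union> set ms"
    unfolding verts[symmetric] by (force simp: Field_def Domain_fst Range_snd)
  hence c: "is_copy ?P ?A"
    using attach_pendants_copy[OF par us ms dist _ R_def, of "graph_of_edges (set es)" as] arcs len
    by (simp add: graph_of_edges_def)
  have wf: "parcs ?P \<subseteq> pverts ?P \<times> pverts ?P"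
    by (rule subdivision.wf_H, rule subdivision_tree_edges) (use par len in auto)
  have "is_copy ?A G \<longleftrightarrow> is_copy ?P G"
    using is_copy_trans[OF c] is_copy_trans[OF is_copy_sym[OF wf c]] by blast
  thus ?thesis using digraph_iso_iff_is_copy[OF is_copy_wf[OF wf c], of G] by simp
qed

lemma path_edges_set: "path_edges k = set (map (\<lambda>i. (Vtx_v i, Vtx_v (Suc i))) [0..<k])"
  by (auto simp: path_edges_def)

lemma branch_edges_set: "branch_edges i j = set [(Vtx_v i, Vtx_x j), (Vtx_x j, Vtx_y j)]"
  by (simp add: branch_edges_def)

text \<open>Here and in the next five lemmas, ms lists the unmarked vertices in the order of the
  tree edges, each the midpoint between a marked vertex and its parent.\<close>

lemma F6_1_iso_iff:
  "digraph_iso (with_proj G) (with_proj (attach_pendants F6_1 as)) \<longleftrightarrow>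
    is_copy (pendant_subdivision 6 (tree_edges [0, 1, 1, 1, 1]) ((!) as)) G"
  unfolding F6_1_def path_edges_set branch_edges_set set_append[symmetric]
  by (rule iso_attach_pendants_iff[where ms = "[Vtx_v 1, Vtx_v 3, Vtx_x 1, Vtx_x 2, Vtx_x 3]"]) (code_simp, simp)

lemma F6_2_iso_iff:
  "digraph_iso (with_proj G) (with_proj (attach_pendants F6_2 as)) \<longleftrightarrow>
    is_copy (pendant_subdivision 6 (tree_edges [0, 1, 2, 1, 1]) ((!) as)) G"
  unfolding F6_2_def path_edges_set branch_edges_set set_append[symmetric]
  by (rule iso_attach_pendants_iff[where ms = "[Vtx_v 1, Vtx_v 3, Vtx_v 5, Vtx_x 1, Vtx_x 2]"]) (code_simp, simp)

lemma F6_3_iso_iff: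
  "digraph_iso (with_proj G) (with_proj (attach_pendants F6_3 as)) \<longleftrightarrow>
    is_copy (pendant_subdivision 6 (tree_edges [0, 1, 2, 1, 2]) ((!) as)) G"
  unfolding F6_3_def path_edges_set branch_edges_set set_append[symmetric]
  by (rule iso_attach_pendants_iff[where ms = "[Vtx_v 1, Vtx_v 3, Vtx_v 5, Vtx_x 1, Vtx_x 2]"]) (code_simp, simp)

lemma F6_4_iso_iff:
  "digraph_iso (with_proj G) (with_proj (attach_pendants F6_4 as)) \<longleftrightarrow>
    is_copy (pendant_subdivision 6 (tree_edges [0, 1, 2, 3, 1]) ((!) as)) G"
  unfolding F6_4_def path_edges_set branch_edges_set set_append[symmetric]
  by (rule iso_attach_pendants_iff[where ms = "[Vtx_v 1, Vtx_v 3, Vtx_v 5, Vtx_v 7, Vtx_x 1]"]) (code_simp, simp)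

lemma F6_5_iso_iff:
  "digraph_iso (with_proj G) (with_proj (attach_pendants F6_5 as)) \<longleftrightarrow>
    is_copy (pendant_subdivision 6 (tree_edges [0, 1, 2, 3, 2]) ((!) as)) G"
  unfolding F6_5_def path_edges_set branch_edges_set set_append[symmetric]
  by (rule iso_attach_pendants_iff[where ms = "[Vtx_v 1, Vtx_v 3, Vtx_v 5, Vtx_v 7, Vtx_x 1]"]) (code_simp, simp)

lemma F6_6_iso_iff:
  "digraph_iso (with_proj G) (with_proj (attach_pendants F6_6 as)) \<longleftrightarrow>
    is_copy (pendant_subdivision 6 (tree_edges [0, 1, 2, 3, 4]) ((!) as)) G"
  unfolding F6_6_def path_edges_set branch_edges_set set_append[symmetric]
  by (rule iso_attach_pendants_iff[where ms = "[Vtx_v 1, Vtx_v 3, Vtx_v 5, Vtx_v 7, Vtx_v 9]"]) (code_simp, simp)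

subsection \<open>Perron vectors\<close>

text \<open>Explicit lists replace the quantifier and the sum, so that \<open>simp\<close> can
  unfold all six equations.\<close>

lemma perron_vector_list:
  "perron_vector qs b \<mu> z \<longleftrightarrow> list_all (\<lambda>i. z ! i > 0 \<and>
     sum_list (map (\<lambda>j. if qs ! j = i \<or> Suc j = i then z ! (qs ! j) + z ! Suc j else 0) [0, 1, 2, 3, 4])
       = (b ! i + \<mu>) * z ! i) [0, 1, 2, 3, 4, 5]"
proof -
  have "[0, 1, 2, 3, 4] = [0..<5]" "[0, 1, 2, 3, 4, 5] = [0..<6]" by code_simp+
  thus ?thesis
    unfolding perron_vector_def list_all_iff by (simp only: interv_sum_list_conv_sum_set_nat) (auto simp: lessThan_atLeast0)
qed

text \<open>Here \<delta> is the degree vector, so b is twice the degrees and the constant vector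
  works for every tree.\<close>

lemma perron_vectors0:
  assumes "\<mu> = 0"
  shows "list_all (\<lambda>(qs, b). \<exists>z. perron_vector qs b \<mu> z) listing0"
proof -
  have "perron_vector [0, 1, 1, 1, 1] [2, 10, 2, 2, 2, 2] \<mu> [1, 1, 1, 1, 1, 1]"
    using assms by (simp add: perron_vector_list algebra_simps)
  moreover
  have "perron_vector [0, 1, 2, 1, 1] [2, 8, 4, 2, 2, 2] \<mu> [1, 1, 1, 1, 1, 1]"
    using assms by (simp add: perron_vector_list algebra_simps)
  moreover
  have "perron_vector [0, 1, 2, 1, 2] [2, 6, 6, 2, 2, 2] \<mu> [1, 1, 1, 1, 1, 1]"
    using assms by (simp add: perron_vector_list algebra_simps)
  moreover
  have "perron_vector [0, 1, 2, 3, 1] [2, 6, 4, 4, 2, 2] \<mu> [1, 1, 1, 1, 1, 1]"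
    using assms by (simp add: perron_vector_list algebra_simps)
  moreover
  have "perron_vector [0, 1, 2, 3, 2] [2, 4, 6, 4, 2, 2] \<mu> [1, 1, 1, 1, 1, 1]"
    using assms by (simp add: perron_vector_list algebra_simps)
  moreover
  have "perron_vector [0, 1, 2, 3, 4] [2, 4, 4, 4, 4, 2] \<mu> [1, 1, 1, 1, 1, 1]"
    using assms by (simp add: perron_vector_list algebra_simps)
  ultimately show ?thesis by (auto simp: listing0_def)
qed

text \<open>Here and below, the quadratic equation of \<mu> is oriented as a rewrite rule. All
  coordinates are linear in \<mu>, so each expanded equation reduces to a linear identity.\<close>

lemma perron_vectors1:
  assumes "\<mu> > 0" "\<mu> * \<mu> = 1 - 5 * \<mu>"
  shows "list_all (\<lambda>(qs, b). \<exists>z. perron_vector qs b \<mu> z) listing1"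
proof -
  have "perron_vector [0, 1, 1, 1, 1] [2, 9, 2, 2, 2, 2] \<mu> [1, 1 + \<mu>, 1, 1, 1, 1]"
    using assms by (simp add: perron_vector_list algebra_simps)
  thus ?thesis by (auto simp: listing1_def)
qed

lemma perron_vectors2:
  assumes "\<mu> > 0" "\<mu> * \<mu> = 1 - 2 * \<mu>"
  shows "list_all (\<lambda>(qs, b). \<exists>z. perron_vector qs b \<mu> z) listing2"
proof -
  have "perron_vector [0, 1, 2, 1, 2] [2, 5, 5, 2, 2, 2] \<mu> [1, 1 + \<mu>, 1 + \<mu>, 1, 1, 1]"
    using assms by (simp add: perron_vector_list algebra_simps)
  moreover
  have "perron_vector [0, 1, 2, 3, 1] [2, 5, 4, 3, 2, 2] \<mu> [1, 1 + \<mu>, 1 + \<mu>, 2, 1 + \<mu>, 1]"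
    using assms by (simp add: perron_vector_list algebra_simps)
  moreover
  have "perron_vector [0, 1, 2, 3, 4] [2, 3, 4, 4, 3, 2] \<mu> [1, 1 + \<mu>, 1, 1, 1 + \<mu>, 1]"
    using assms by (simp add: perron_vector_list algebra_simps)
  ultimately show ?thesis by (auto simp: listing2_def)
qed

lemma perron_vectors3:
  assumes "\<mu> > 0" "\<mu> * \<mu> = 1 - \<mu>"
  shows "list_all (\<lambda>(qs, b). \<exists>z. perron_vector qs b \<mu> z) listing3"
proof -
  have "perron_vector [0, 1, 2, 3, 2] [2, 3, 6, 4, 1, 1] \<mu> [\<mu>, 1, 1, 1, 1 + \<mu>, 1 + \<mu>]"
    using assms by (simp add: perron_vector_list algebra_simps)
  moreover
  have "perron_vector [0, 1, 2, 3, 2] [2, 3, 6, 3, 2, 1] \<mu> [\<mu>, 1, 1, 1, \<mu>, 1 + \<mu>]"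
    using assms by (simp add: perron_vector_list algebra_simps)
  moreover
  have "perron_vector [0, 1, 2, 3, 2] [1, 4, 6, 4, 1, 1] \<mu> [1, \<mu>, \<mu>, \<mu>, 1, 1]"
    using assms by (simp add: perron_vector_list algebra_simps)
  moreover
  have "perron_vector [0, 1, 2, 3, 2] [2, 3, 5, 4, 1, 2] \<mu> [\<mu>, 1, 1, 1, 1 + \<mu>, \<mu>]"
    using assms by (simp add: perron_vector_list algebra_simps)
  moreover
  have "perron_vector [0, 1, 2, 3, 2] [2, 3, 5, 3, 2, 2] \<mu> [\<mu>, 1, 1, 1, \<mu>, \<mu>]"
    using assms by (simp add: perron_vector_list algebra_simps)
  moreover
  have "perron_vector [0, 1, 2, 3, 2] [1, 4, 5, 4, 1, 2] \<mu> [1 + \<mu>, 1, 1, 1, 1 + \<mu>, \<mu>]"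
    using assms by (simp add: perron_vector_list algebra_simps)
  moreover
  have "perron_vector [0, 1, 2, 3, 4] [2, 3, 4, 3, 3, 2] \<mu> [\<mu>, 1, 1, 1 + \<mu>, 1 + \<mu>, 1]"
    using assms by (simp add: perron_vector_list algebra_simps)
  moreover
  have "perron_vector [0, 1, 2, 3, 4] [2, 3, 4, 3, 4, 1] \<mu> [\<mu>, 1, 1, 1 + \<mu>, 1 + \<mu>, 2 + \<mu>]"
    using assms by (simp add: perron_vector_list algebra_simps)
  moreover
  have "perron_vector [0, 1, 2, 3, 4] [2, 3, 3, 4, 4, 1] \<mu> [\<mu>, 1, 1, \<mu>, \<mu>, 1]"
    using assms by (simp add: perron_vector_list algebra_simps)
  moreover
  have "perron_vector [0, 1, 2, 3, 4] [1, 4, 4, 3, 4, 1] \<mu> [1, \<mu>, \<mu>, 1, 1, 1 + \<mu>]"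
    using assms by (simp add: perron_vector_list algebra_simps)
  ultimately show ?thesis by (auto simp: listing3_def)
qed

lemma perron_vectors4:
  assumes "\<mu> > 0" "\<mu> * \<mu> = 2 - 2 * \<mu>"
  shows "list_all (\<lambda>(qs, b). \<exists>z. perron_vector qs b \<mu> z) listing4"
proof -
  have "perron_vector [0, 1, 2, 1, 2] [1, 6, 6, 1, 1, 1] \<mu> [1, \<mu>, \<mu>, 1, 1, 1]"
    using assms by (simp add: perron_vector_list algebra_simps)
  moreover
  have "perron_vector [0, 1, 2, 3, 1] [1, 6, 3, 4, 1, 1] \<mu> [2 + \<mu>, 2, 2, 2 * \<mu>, 2, 2 + \<mu>]"
    using assms by (simp add: perron_vector_list algebra_simps)
  moreover
  have "perron_vector [0, 1, 2, 3, 4] [1, 4, 3, 3, 4, 1] \<mu> [1, \<mu>, 1, 1, \<mu>, 1]"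
    using assms by (simp add: perron_vector_list algebra_simps)
  ultimately show ?thesis by (auto simp: listing4_def)
qed

lemma perron_vectors5:
  assumes "\<mu> > 0" "\<mu> * \<mu> = 5 - 5 * \<mu>"
  shows "list_all (\<lambda>(qs, b). \<exists>z. perron_vector qs b \<mu> z) listing5"
proof -
  have "perron_vector [0, 1, 1, 1, 1] [1, 10, 1, 1, 1, 1] \<mu> [1, \<mu>, 1, 1, 1, 1]"
    using assms by (simp add: perron_vector_list algebra_simps)
  thus ?thesis by (auto simp: listing5_def)
qed

subsection \<open>The six residue classes\<close>

lemma listings_valid:
  "list_all (\<lambda>(s, L). L \<noteq> [] \<and> list_all (\<lambda>(qs, b). qs \<in> set six_vertex_trees \<and> length b = 6 \<and>
     sum_list b = 20 - s \<and> list_all (\<lambda>x. x \<le> 10) b) L)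
     [(0, listing0), (1, listing1), (2, listing2), (3, listing3), (4, listing4), (5, listing5)]"
  by code_simp

lemma minimizer_dataI:
  assumes "n + 9 = 6 * k + s" "k \<ge> 11" "0 \<le> \<mu>" "\<mu> \<le> of_int p / of_int q" "6 * of_int p / of_int q < real s + 1"
    "0 \<le> p" "p < q" "search_ok (p, q) (10 - int s) L"
    and L: "(s, L) \<in> set [(0, listing0), (1, listing1), (2, listing2), (3, listing3), (4, listing4), (5, listing5)]"
    and z: "list_all (\<lambda>(qs, b). \<exists>z. perron_vector qs b \<mu> z) L"
  shows "minimizer_data n k s p q \<mu> L"
proof
  have valid: "L \<noteq> []" "list_all (\<lambda>(qs, b). qs \<in> set six_vertex_trees \<and> length b = 6 \<and>
     sum_list b = 20 - s \<and> list_all (\<lambda>x. x \<le> 10) b) L"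
    using listings_valid L unfolding list_all_iff by fast+
  show "L \<noteq> []" by (fact valid)
  show "qs \<in> set six_vertex_trees \<and> length b = 6 \<and> sum_list b = 20 - s \<and>
      (\<forall>x\<in>set b. x \<le> 10) \<and> (\<exists>z. perron_vector qs b \<mu> z)" if "(qs, b) \<in> set L" for qs b
    using valid(2) z that unfolding list_all_iff by fast
  show "s \<le> 5" using L by auto
  show "6 * \<mu> < real s + 1" using assms(4,5) by simp
qed (use assms in auto)

lemma minimizers_excess0:
  assumes nk: "n + 9 = 6 * k + 0" "k \<ge> 11"
  shows "minimizer_graphs n (n - 6) = iso_copies
     {attach_pendants F6_1 [k - 2, k - 10, k - 2, k - 2, k - 2, k - 2],
      attach_pendants F6_2 [k - 2, k - 8, k - 4, k - 2, k - 2, k - 2],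
      attach_pendants F6_3 [k - 2, k - 6, k - 6, k - 2, k - 2, k - 2],
      attach_pendants F6_4 [k - 2, k - 6, k - 4, k - 4, k - 2, k - 2],
      attach_pendants F6_5 [k - 2, k - 4, k - 6, k - 4, k - 2, k - 2],
      attach_pendants F6_6 [k - 2, k - 4, k - 4, k - 4, k - 4, k - 2]}" (is ?min)
    and "T \<in> minimizer_graphs n (n - 6) \<Longrightarrow> graph_spectral_radius T = sqrt (real k + (0))"
proof -
  define \<mu> :: real where "\<mu> = 0"
  have bounds: "0 \<le> \<mu>" "\<mu> \<le> 1 / 10" and quad: "\<mu> = 0" by (simp_all add: \<mu>_def)
  interpret minimizer_data n k 0 "1" "10" \<mu> listing0
    by (rule minimizer_dataI) (use nk bounds search_ok0 perron_vectors0[OF quad] in simp_all)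
  show ?min
    unfolding minimizers_are_listed(1) by (auto simp: listed_def listing0_def iso_copies_def F6_1_iso_iff F6_2_iso_iff F6_3_iso_iff F6_4_iso_iff F6_5_iso_iff F6_6_iso_iff)
  show "graph_spectral_radius T = sqrt (real k + (0))" if "T \<in> minimizer_graphs n (n - 6)"
    using minimizers_are_listed(2)[OF that, unfolded \<theta>_def] by (simp add: \<mu>_def)
qed

lemma minimizers_excess1:
  assumes nk: "n + 9 = 6 * k + 1" "k \<ge> 11"
  shows "minimizer_graphs n (n - 6) = iso_copies
     {attach_pendants F6_1 [k - 2, k - 9, k - 2, k - 2, k - 2, k - 2]}" (is ?min)
    and "T \<in> minimizer_graphs n (n - 6) \<Longrightarrow> graph_spectral_radius T = sqrt (real k + (sqrt 29 / 2 - 5 / 2))"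
proof -
  define \<mu> :: real where "\<mu> = sqrt 29 / 2 - 5 / 2"
  have "5 < sqrt 29" by (rule real_less_rsqrt) (simp add: power2_eq_square)
  \<comment> \<open>The value 27/5 bounds \<mu> by 1/5, the fraction of \<open>search_ok1\<close>,
    and 6/5 stays below s + 1 = 2. The later cases choose their fractions in the same way.\<close>
  moreover have "sqrt 29 \<le> 27 / 5" by (rule real_le_lsqrt) (simp_all add: power2_eq_square)
  ultimately have bounds: "\<mu> > 0" "\<mu> \<le> 1 / 5" by (simp_all add: \<mu>_def)
  have quad: "\<mu> * \<mu> = 1 - 5 * \<mu>" by (simp add: \<mu>_def field_simps)
  interpret minimizer_data n k 1 "1" "5" \<mu> listing1
    by (rule minimizer_dataI) (use nk bounds search_ok1 perron_vectors1[OF bounds(1) quad] in simp_all)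
  show ?min
    unfolding minimizers_are_listed(1) by (auto simp: listed_def listing1_def iso_copies_def F6_1_iso_iff)
  show "graph_spectral_radius T = sqrt (real k + (sqrt 29 / 2 - 5 / 2))" if "T \<in> minimizer_graphs n (n - 6)"
    using minimizers_are_listed(2)[OF that, unfolded \<theta>_def] by (simp add: \<mu>_def)
qed

lemma minimizers_excess2:
  assumes nk: "n + 9 = 6 * k + 2" "k \<ge> 11"
  shows "minimizer_graphs n (n - 6) = iso_copies
     {attach_pendants F6_3 [k - 2, k - 5, k - 5, k - 2, k - 2, k - 2],
      attach_pendants F6_4 [k - 2, k - 5, k - 4, k - 3, k - 2, k - 2],
      attach_pendants F6_6 [k - 2, k - 3, k - 4, k - 4, k - 3, k - 2]}" (is ?min)
    and "T \<in> minimizer_graphs n (n - 6) \<Longrightarrow> graph_spectral_radius T = sqrt (real k + (sqrt 2 - 1))"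
proof -
  define \<mu> :: real where "\<mu> = sqrt 2 - 1"
  have "1 < sqrt 2" by (rule real_less_rsqrt) (simp add: power2_eq_square)
  moreover have "sqrt 2 \<le> 10 / 7" by (rule real_le_lsqrt) (simp_all add: power2_eq_square)
  ultimately have bounds: "\<mu> > 0" "\<mu> \<le> 3 / 7" by (simp_all add: \<mu>_def)
  have quad: "\<mu> * \<mu> = 1 - 2 * \<mu>" by (simp add: \<mu>_def field_simps)
  interpret minimizer_data n k 2 "3" "7" \<mu> listing2
    by (rule minimizer_dataI) (use nk bounds search_ok2 perron_vectors2[OF bounds(1) quad] in simp_all)
  show ?min
    unfolding minimizers_are_listed(1) by (auto simp: listed_def listing2_def iso_copies_def F6_3_iso_iff F6_4_iso_iff F6_6_iso_iff)
  show "graph_spectral_radius T = sqrt (real k + (sqrt 2 - 1))" if "T \<in> minimizer_graphs n (n - 6)"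
    using minimizers_are_listed(2)[OF that, unfolded \<theta>_def] by (simp add: \<mu>_def)
qed

lemma minimizers_excess3:
  assumes nk: "n + 9 = 6 * k + 3" "k \<ge> 11"
  shows "minimizer_graphs n (n - 6) = iso_copies
     {attach_pendants F6_5 [k - 2, k - 3, k - 6, k - 4, k - 1, k - 1],
      attach_pendants F6_5 [k - 2, k - 3, k - 6, k - 3, k - 2, k - 1],
      attach_pendants F6_5 [k - 1, k - 4, k - 6, k - 4, k - 1, k - 1],
      attach_pendants F6_5 [k - 2, k - 3, k - 5, k - 4, k - 1, k - 2],
      attach_pendants F6_5 [k - 2, k - 3, k - 5, k - 3, k - 2, k - 2],
      attach_pendants F6_5 [k - 1, k - 4, k - 5, k - 4, k - 1, k - 2],
      attach_pendants F6_6 [k - 2, k - 3, k - 4, k - 3, k - 3, k - 2],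
      attach_pendants F6_6 [k - 2, k - 3, k - 4, k - 3, k - 4, k - 1],
      attach_pendants F6_6 [k - 2, k - 3, k - 3, k - 4, k - 4, k - 1],
      attach_pendants F6_6 [k - 1, k - 4, k - 4, k - 3, k - 4, k - 1]}" (is ?min)
    and "T \<in> minimizer_graphs n (n - 6) \<Longrightarrow> graph_spectral_radius T = sqrt (real k + ((sqrt 5 - 1) / 2))"
proof -
  define \<mu> :: real where "\<mu> = (sqrt 5 - 1) / 2"
  have "1 < sqrt 5" by (rule real_less_rsqrt) (simp add: power2_eq_square)
  \<comment> \<open>The tightest case: 6 \<mu> is about 3.71 and must stay below 4. The value 9/4
    bounds \<mu> by 5/8, and 6 times 5/8 is 15/4.\<close>
  moreover have "sqrt 5 \<le> 9 / 4" by (rule real_le_lsqrt) (simp_all add: power2_eq_square)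
  ultimately have bounds: "\<mu> > 0" "\<mu> \<le> 5 / 8" by (simp_all add: \<mu>_def)
  have quad: "\<mu> * \<mu> = 1 - \<mu>" by (simp add: \<mu>_def field_simps)
  interpret minimizer_data n k 3 "5" "8" \<mu> listing3
    by (rule minimizer_dataI) (use nk bounds search_ok3 perron_vectors3[OF bounds(1) quad] in simp_all)
  show ?min
    unfolding minimizers_are_listed(1) by (auto simp: listed_def listing3_def iso_copies_def F6_5_iso_iff F6_6_iso_iff)
  show "graph_spectral_radius T = sqrt (real k + ((sqrt 5 - 1) / 2))" if "T \<in> minimizer_graphs n (n - 6)"
    using minimizers_are_listed(2)[OF that, unfolded \<theta>_def] by (simp add: \<mu>_def)
qed

lemma minimizers_excess4:
  assumes nk: "n + 9 = 6 * k + 4" "k \<ge> 11"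
  shows "minimizer_graphs n (n - 6) = iso_copies
     {attach_pendants F6_3 [k - 1, k - 6, k - 6, k - 1, k - 1, k - 1],
      attach_pendants F6_4 [k - 1, k - 6, k - 3, k - 4, k - 1, k - 1],
      attach_pendants F6_6 [k - 1, k - 4, k - 3, k - 3, k - 4, k - 1]}" (is ?min)
    and "T \<in> minimizer_graphs n (n - 6) \<Longrightarrow> graph_spectral_radius T = sqrt (real k + (sqrt 3 - 1))"
proof -
  define \<mu> :: real where "\<mu> = sqrt 3 - 1"
  have "1 < sqrt 3" by (rule real_less_rsqrt) (simp add: power2_eq_square)
  moreover have "sqrt 3 \<le> 26 / 15" by (rule real_le_lsqrt) (simp_all add: power2_eq_square)
  ultimately have bounds: "\<mu> > 0" "\<mu> \<le> 11 / 15" by (simp_all add: \<mu>_def)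
  have quad: "\<mu> * \<mu> = 2 - 2 * \<mu>" by (simp add: \<mu>_def field_simps)
  interpret minimizer_data n k 4 "11" "15" \<mu> listing4
    by (rule minimizer_dataI) (use nk bounds search_ok4 perron_vectors4[OF bounds(1) quad] in simp_all)
  show ?min
    unfolding minimizers_are_listed(1) by (auto simp: listed_def listing4_def iso_copies_def F6_3_iso_iff F6_4_iso_iff F6_6_iso_iff)
  show "graph_spectral_radius T = sqrt (real k + (sqrt 3 - 1))" if "T \<in> minimizer_graphs n (n - 6)"
    using minimizers_are_listed(2)[OF that, unfolded \<theta>_def] by (simp add: \<mu>_def)
qed

lemma minimizers_excess5:
  assumes nk: "n + 9 = 6 * k + 5" "k \<ge> 11"
  shows "minimizer_graphs n (n - 6) = iso_copies
     {attach_pendants F6_1 [k - 1, k - 10, k - 1, k - 1, k - 1, k - 1]}" (is ?min)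
    and "T \<in> minimizer_graphs n (n - 6) \<Longrightarrow> graph_spectral_radius T = sqrt (real k + (sqrt 45 / 2 - 5 / 2))"
proof -
  define \<mu> :: real where "\<mu> = sqrt 45 / 2 - 5 / 2"
  have "5 < sqrt 45" by (rule real_less_rsqrt) (simp add: power2_eq_square)
  moreover have "sqrt 45 \<le> 47 / 7" by (rule real_le_lsqrt) (simp_all add: power2_eq_square)
  ultimately have bounds: "\<mu> > 0" "\<mu> \<le> 6 / 7" by (simp_all add: \<mu>_def)
  have quad: "\<mu> * \<mu> = 5 - 5 * \<mu>" by (simp add: \<mu>_def field_simps)
  interpret minimizer_data n k 5 "6" "7" \<mu> listing5
    by (rule minimizer_dataI) (use nk bounds search_ok5 perron_vectors5[OF bounds(1) quad] in simp_all)
  show ?min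
    unfolding minimizers_are_listed(1) by (auto simp: listed_def listing5_def iso_copies_def F6_1_iso_iff)
  show "graph_spectral_radius T = sqrt (real k + (sqrt 45 / 2 - 5 / 2))" if "T \<in> minimizer_graphs n (n - 6)"
    using minimizers_are_listed(2)[OF that, unfolded \<theta>_def] by (simp add: \<mu>_def)
qed

text \<open>Both n + 9 and a + 9 differ from a multiple of 6 by the same e, so for a \<le> n the
  division is exact. Each fraction of the statement thus becomes k - b with b an entry of a
  listing.\<close>

lemma div_shift:
  fixes n k a b e :: nat
  assumes "n + 9 = 6 * k + e" "a + 9 = 6 * b + e"
  shows "(n - a) div 6 = k - b"
proof -
  have "n - a = 6 * k - 6 * b" using assms by linarith
  thus ?thesis by (simp flip: diff_mult_distrib2)
qed

text \<open>As n + 9 is congruent to r + 2 modulo 6, the classes r = 0, ..., 5 correspond to s = 2,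
  3, 4, 5, 0, 1. The lower bound on n gives \<open>k \<ge> 11\<close> in each of them.\<close>

lemma residue0:
  assumes "(n + 1) mod 6 = 0" "n \<ge> 101 - 5 * 0"
  shows "minimizer_graphs n (n - 6) = iso_copies
      {attach_pendants F6_3 [(n - 5) div 6, (n - 23) div 6, (n - 23) div 6, (n - 5) div 6, (n - 5) div 6, (n - 5) div 6],
      attach_pendants F6_4 [(n - 5) div 6, (n - 23) div 6, (n - 17) div 6, (n - 11) div 6, (n - 5) div 6, (n - 5) div 6],
      attach_pendants F6_6 [(n - 5) div 6, (n - 11) div 6, (n - 17) div 6, (n - 17) div 6, (n - 11) div 6, (n - 5) div 6]}" (is ?min)
    and "\<forall>T\<in>minimizer_graphs n (n - 6). graph_spectral_radius T = sqrt ((real n + 1) / 6 + sqrt 2)" (is ?radius)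
proof -
  define k where "k = (n + 7) div 6"
  have k: "n + 9 = 6 * k + 2" "k \<ge> 11" using assms by (simp_all add: k_def) presburger+
  have eqs: "(n - 5) div 6 = k - 2" "(n - 23) div 6 = k - 5" "(n - 17) div 6 = k - 4" "(n - 11) div 6 = k - 3"
    by (rule div_shift[OF k(1)], simp)+
  show ?min
    unfolding eqs by (rule minimizers_excess2(1)[OF k])
  have "real n + 9 = 6 * real k + 2" using arg_cong[OF k(1), of real] by simp
  thus ?radius
    using minimizers_excess2(2)[OF k] by (simp add: field_simps)
qed

lemma residue1:
  assumes "(n + 1) mod 6 = 1" "n \<ge> 101 - 5 * 1"
  shows "(let m = n div 6 in minimizer_graphs n (n - 6) = iso_copies
      {attach_pendants F6_5 [m - 1, m - 2, m - 5, m - 3, m, m],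
      attach_pendants F6_5 [m - 1, m - 2, m - 5, m - 2, m - 1, m],
      attach_pendants F6_5 [m, m - 3, m - 5, m - 3, m, m],
      attach_pendants F6_5 [m - 1, m - 2, m - 4, m - 3, m, m - 1],
      attach_pendants F6_5 [m - 1, m - 2, m - 4, m - 2, m - 1, m - 1],
      attach_pendants F6_5 [m, m - 3, m - 4, m - 3, m, m - 1],
      attach_pendants F6_6 [m - 1, m - 2, m - 3, m - 2, m - 2, m - 1],
      attach_pendants F6_6 [m - 1, m - 2, m - 3, m - 2, m - 3, m],
      attach_pendants F6_6 [m - 1, m - 2, m - 2, m - 3, m - 3, m],
      attach_pendants F6_6 [m, m - 3, m - 3, m - 2, m - 3, m]})" (is ?min)
    and "\<forall>T\<in>minimizer_graphs n (n - 6). graph_spectral_radius T = sqrt (real n / 6 + (1 + sqrt 5) / 2)" (is ?radius)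
proof -
  \<comment> \<open>Now m = n / 6 equals k - 1, so an entry x of the listing appears as m - (x -
    1).\<close>
  define k where "k = n div 6 + 1"
  have k: "n + 9 = 6 * k + 3" "k \<ge> 11" using assms by (simp_all add: k_def) presburger+
  have m: "n div 6 = k - 1" by (simp add: k_def)
  show ?min
    unfolding Let_def m using minimizers_excess3(1)[OF k] by (simp add: numeral_eq_Suc)
  have "real n + 9 = 6 * real k + 3" using arg_cong[OF k(1), of real] by simp
  thus ?radius
    using minimizers_excess3(2)[OF k] by (simp add: field_simps)
qed

lemma residue2:
  assumes "(n + 1) mod 6 = 2" "n \<ge> 101 - 5 * 2"
  shows "minimizer_graphs n (n - 6) = iso_copies
      {attach_pendants F6_3 [(n - 1) div 6, (n - 31) div 6, (n - 31) div 6, (n - 1) div 6, (n - 1) div 6, (n - 1) div 6],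
      attach_pendants F6_4 [(n - 1) div 6, (n - 31) div 6, (n - 13) div 6, (n - 19) div 6, (n - 1) div 6, (n - 1) div 6],
      attach_pendants F6_6 [(n - 1) div 6, (n - 19) div 6, (n - 13) div 6, (n - 13) div 6, (n - 19) div 6, (n - 1) div 6]}" (is ?min)
    and "\<forall>T\<in>minimizer_graphs n (n - 6). graph_spectral_radius T = sqrt ((real n - 1) / 6 + sqrt 3)" (is ?radius)
proof -
  define k where "k = (n + 5) div 6"
  have k: "n + 9 = 6 * k + 4" "k \<ge> 11" using assms by (simp_all add: k_def) presburger+
  have eqs: "(n - 1) div 6 = k - 1" "(n - 31) div 6 = k - 6" "(n - 13) div 6 = k - 3" "(n - 19) div 6 = k - 4"
    by (rule div_shift[OF k(1)], simp)+
  show ?min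
    unfolding eqs by (rule minimizers_excess4(1)[OF k])
  have "real n + 9 = 6 * real k + 4" using arg_cong[OF k(1), of real] by simp
  thus ?radius
    using minimizers_excess4(2)[OF k] by (simp add: field_simps)
qed

lemma residue3:
  assumes "(n + 1) mod 6 = 3" "n \<ge> 101 - 5 * 3"
  shows "minimizer_graphs n (n - 6) = iso_copies
      {attach_pendants F6_1 [(n - 2) div 6, (n - 56) div 6, (n - 2) div 6, (n - 2) div 6, (n - 2) div 6, (n - 2) div 6]}" (is ?min)
    and "\<forall>T\<in>minimizer_graphs n (n - 6). graph_spectral_radius T = sqrt ((real n - 11) / 6 + sqrt 45 / 2)" (is ?radius)
proof -
  define k where "k = (n + 4) div 6"
  have k: "n + 9 = 6 * k + 5" "k \<ge> 11" using assms by (simp_all add: k_def) presburger+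
  have eqs: "(n - 2) div 6 = k - 1" "(n - 56) div 6 = k - 10"
    by (rule div_shift[OF k(1)], simp)+
  show ?min
    unfolding eqs by (rule minimizers_excess5(1)[OF k])
  have "real n + 9 = 6 * real k + 5" using arg_cong[OF k(1), of real] by simp
  thus ?radius
    using minimizers_excess5(2)[OF k] by (simp add: field_simps)
qed

lemma residue4:
  assumes "(n + 1) mod 6 = 4" "n \<ge> 101 - 5 * 4"
  shows "minimizer_graphs n (n - 6) = iso_copies
      {attach_pendants F6_1 [(n - 3) div 6, (n - 51) div 6, (n - 3) div 6, (n - 3) div 6, (n - 3) div 6, (n - 3) div 6],
      attach_pendants F6_2 [(n - 3) div 6, (n - 39) div 6, (n - 15) div 6, (n - 3) div 6, (n - 3) div 6, (n - 3) div 6],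
      attach_pendants F6_3 [(n - 3) div 6, (n - 27) div 6, (n - 27) div 6, (n - 3) div 6, (n - 3) div 6, (n - 3) div 6],
      attach_pendants F6_4 [(n - 3) div 6, (n - 27) div 6, (n - 15) div 6, (n - 15) div 6, (n - 3) div 6, (n - 3) div 6],
      attach_pendants F6_5 [(n - 3) div 6, (n - 15) div 6, (n - 27) div 6, (n - 15) div 6, (n - 3) div 6, (n - 3) div 6],
      attach_pendants F6_6 [(n - 3) div 6, (n - 15) div 6, (n - 15) div 6, (n - 15) div 6, (n - 15) div 6, (n - 3) div 6]}" (is ?min)
    and "\<forall>T\<in>minimizer_graphs n (n - 6). graph_spectral_radius T = sqrt ((real n + 9) / 6)" (is ?radius)
proof -
  define k where "k = (n + 9) div 6"
  have k: "n + 9 = 6 * k + 0" "k \<ge> 11" using assms by (simp_all add: k_def) presburger+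
  have eqs: "(n - 3) div 6 = k - 2" "(n - 51) div 6 = k - 10" "(n - 39) div 6 = k - 8" "(n - 15) div 6 = k - 4" "(n - 27) div 6 = k - 6"
    by (rule div_shift[OF k(1)], simp)+
  show ?min
    unfolding eqs by (rule minimizers_excess0(1)[OF k])
  have "real n + 9 = 6 * real k + 0" using arg_cong[OF k(1), of real] by simp
  thus ?radius
    using minimizers_excess0(2)[OF k] by (simp add: field_simps)
qed

lemma residue5:
  assumes "(n + 1) mod 6 = 5" "n \<ge> 101 - 5 * 5"
  shows "minimizer_graphs n (n - 6) = iso_copies
      {attach_pendants F6_1 [(n - 4) div 6, (n - 46) div 6, (n - 4) div 6, (n - 4) div 6, (n - 4) div 6, (n - 4) div 6]}" (is ?min)
    and "\<forall>T\<in>minimizer_graphs n (n - 6). graph_spectral_radius T = sqrt ((real n - 7) / 6 + sqrt 29 / 2)" (is ?radius)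
proof -
  define k where "k = (n + 8) div 6"
  have k: "n + 9 = 6 * k + 1" "k \<ge> 11" using assms by (simp_all add: k_def) presburger+
  have eqs: "(n - 4) div 6 = k - 2" "(n - 46) div 6 = k - 9"
    by (rule div_shift[OF k(1)], simp)+
  show ?min
    unfolding eqs by (rule minimizers_excess1(1)[OF k])
  have "real n + 9 = 6 * real k + 1" using arg_cong[OF k(1), of real] by simp
  thus ?radius
    using minimizers_excess1(2)[OF k] by (simp add: field_simps)
qed

theorem theorem5p2:
  fixes r n \<alpha> :: nat
  assumes "r \<in> {0..5}"
    and "[n + 1 = r] (mod 6)"
    and "n \<ge> 101 - 5 * r"
    and "\<alpha> = n - 6"
  shows "(r = 0 \<longrightarrow>
        minimizer_graphs n \<alpha> = iso_copies
          {attach_pendants F6_3 [(n - 5) div 6, (n - 23) div 6, (n - 23) div 6, (n - 5) div 6, (n - 5) div 6, (n - 5) div 6],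
            attach_pendants F6_4 [(n - 5) div 6, (n - 23) div 6, (n - 17) div 6, (n - 11) div 6, (n - 5) div 6, (n - 5) div 6],
            attach_pendants F6_6 [(n - 5) div 6, (n - 11) div 6, (n - 17) div 6, (n - 17) div 6, (n - 11) div 6, (n - 5) div 6]} \<and>
        (\<forall>T\<in>minimizer_graphs n \<alpha>.
        graph_spectral_radius T = sqrt ((real n + 1) / 6 + sqrt 2))) \<and>
     (r = 1 \<longrightarrow>
        (let m = n div 6 in minimizer_graphs n \<alpha> = iso_copies
          {attach_pendants F6_5 [m - 1, m - 2, m - 5, m - 3, m, m],
            attach_pendants F6_5 [m - 1, m - 2, m - 5, m - 2, m - 1, m],
            attach_pendants F6_5 [m, m - 3, m - 5, m - 3, m, m],
            attach_pendants F6_5 [m - 1, m - 2, m - 4, m - 3, m, m - 1],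
            attach_pendants F6_5 [m - 1, m - 2, m - 4, m - 2, m - 1, m - 1],
            attach_pendants F6_5 [m, m - 3, m - 4, m - 3, m, m - 1],
            attach_pendants F6_6 [m - 1, m - 2, m - 3, m - 2, m - 2, m - 1],
            attach_pendants F6_6 [m - 1, m - 2, m - 3, m - 2, m - 3, m],
            attach_pendants F6_6 [m - 1, m - 2, m - 2, m - 3, m - 3, m],
            attach_pendants F6_6 [m, m - 3, m - 3, m - 2, m - 3, m]}) \<and>
        (\<forall>T\<in>minimizer_graphs n \<alpha>.
        graph_spectral_radius T = sqrt (real n / 6 + (1 + sqrt 5) / 2))) \<and>
     (r = 2 \<longrightarrow>
        minimizer_graphs n \<alpha> = iso_copies
          {attach_pendants F6_3 [(n - 1) div 6, (n - 31) div 6, (n - 31) div 6, (n - 1) div 6, (n - 1) div 6, (n - 1) div 6],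
            attach_pendants F6_4 [(n - 1) div 6, (n - 31) div 6, (n - 13) div 6, (n - 19) div 6, (n - 1) div 6, (n - 1) div 6],
            attach_pendants F6_6 [(n - 1) div 6, (n - 19) div 6, (n - 13) div 6, (n - 13) div 6, (n - 19) div 6, (n - 1) div 6]} \<and>
        (\<forall>T\<in>minimizer_graphs n \<alpha>.
        graph_spectral_radius T = sqrt ((real n - 1) / 6 + sqrt 3))) \<and>
     (r = 3 \<longrightarrow>
        minimizer_graphs n \<alpha> = iso_copies
          {attach_pendants F6_1 [(n - 2) div 6, (n - 56) div 6, (n - 2) div 6, (n - 2) div 6, (n - 2) div 6, (n - 2) div 6]} \<and>
        (\<forall>T\<in>minimizer_graphs n \<alpha>.
        graph_spectral_radius T = sqrt ((real n - 11) / 6 + sqrt 45 / 2))) \<and>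
     (r = 4 \<longrightarrow>
        minimizer_graphs n \<alpha> = iso_copies
          {attach_pendants F6_1 [(n - 3) div 6, (n - 51) div 6, (n - 3) div 6, (n - 3) div 6, (n - 3) div 6, (n - 3) div 6],
            attach_pendants F6_2 [(n - 3) div 6, (n - 39) div 6, (n - 15) div 6, (n - 3) div 6, (n - 3) div 6, (n - 3) div 6],
            attach_pendants F6_3 [(n - 3) div 6, (n - 27) div 6, (n - 27) div 6, (n - 3) div 6, (n - 3) div 6, (n - 3) div 6],
            attach_pendants F6_4 [(n - 3) div 6, (n - 27) div 6, (n - 15) div 6, (n - 15) div 6, (n - 3) div 6, (n - 3) div 6],
            attach_pendants F6_5 [(n - 3) div 6, (n - 15) div 6, (n - 27) div 6, (n - 15) div 6, (n - 3) div 6, (n - 3) div 6],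
            attach_pendants F6_6 [(n - 3) div 6, (n - 15) div 6, (n - 15) div 6, (n - 15) div 6, (n - 15) div 6, (n - 3) div 6]} \<and>
        (\<forall>T\<in>minimizer_graphs n \<alpha>.
        graph_spectral_radius T = sqrt ((real n + 9) / 6))) \<and>
     (r = 5 \<longrightarrow>
        minimizer_graphs n \<alpha> = iso_copies
          {attach_pendants F6_1 [(n - 4) div 6, (n - 46) div 6, (n - 4) div 6, (n - 4) div 6, (n - 4) div 6, (n - 4) div 6]} \<and>
        (\<forall>T\<in>minimizer_graphs n \<alpha>.
        graph_spectral_radius T = sqrt ((real n - 7) / 6 + sqrt 29 / 2)))"
proof -
  have mod: "(n + 1) mod 6 = r" using assms(1,2) by (simp add: cong_def)
  show ?thesis
    unfolding assms(4)
    by (intro conjI impI; rule residue0 residue1 residue2 residue3 residue4 residue5; use mod assms(3) in simp)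
qed

end
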